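(* Let $w \in \mathfrak{S}_n$. The following are equivalent: (VT1) the undirected Bruhat graph $\Gamma(e,w)$ is a vertex-transitive graph; (VT2) $w$ avoids each of the patterns $3412$, $4231$, $34521$ and $54123$.
   Context: $\mathfrak{S}_n$ is the symmetric group, viewed as a Coxeter group with simple generators the adjacent transpositions $s_i=(i\ i{+}1)$, $1\le i\le n-1$; its reflections $T$ are all transpositions. $\ell$ denotes Coxeter length and $\leq$ the (strong) Bruhat order, i.e. the transitive closure of the relations $x < xt$ for $t\in T$ with $\ell(xt)>\ell(x)$; $[u,v]=\{x : u\le x\le v\}$ and $e$ is the identity. The undirected Bruhat graph $\Gamma(u,v)$ is the simple graph with vertex set $[u,v]$ and an edge between $x$ and $y$ whenever $y=xt$ for some reflection $t$. A graph is vertex-transitive if its automorphism group acts transitively on its vertices. A permutation $w$ (in one-line notation $w(1)\cdots w(n)$) contains a pattern $p\in\mathfrak{S}_k$ if there are indices $a_1<\cdots<a_k$ such that $w(a_1),\ldots,w(a_k)$ are in the same relative order as $p(1),\ldots,p(k)$; otherwise $w$ avoids $p$. *)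

theory Defs
  imports "HOL-Combinatorics.Combinatorics"
begin

(* Permutations of {1..n}, as functions nat => nat fixing everything outside {1..n}.
   Product xy means composition x \<circ> y (apply y first), so one-line notation w(1)...w(n). *)

definition Sym :: "nat \<Rightarrow> (nat \<Rightarrow> nat) set" where
  "Sym n = {w. w permutes {1..n}}"

definition simple_refl :: "nat \<Rightarrow> (nat \<Rightarrow> nat) \<Rightarrow> bool" where
  "simple_refl n s \<longleftrightarrow> (\<exists>i. 1 \<le> i \<and> i < n \<and> s = transpose i (Suc i))"

definition reflection :: "nat \<Rightarrow> (nat \<Rightarrow> nat) \<Rightarrow> bool" where
  "reflection n t \<longleftrightarrow> (\<exists>a b. a \<in> {1..n} \<and> b \<in> {1..n} \<and> a \<noteq> b \<and> t = transpose a b)"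

definition coxeter_length :: "nat \<Rightarrow> (nat \<Rightarrow> nat) \<Rightarrow> nat" where
  "coxeter_length n w =
     (LEAST k. \<exists>ss. length ss = k \<and> (\<forall>s\<in>set ss. simple_refl n s) \<and> w = foldl (\<circ>) id ss)"

definition bruhat_step :: "nat \<Rightarrow> (nat \<Rightarrow> nat) \<Rightarrow> (nat \<Rightarrow> nat) \<Rightarrow> bool" where
  "bruhat_step n x y \<longleftrightarrow> x \<in> Sym n \<and>
     (\<exists>t. reflection n t \<and> y = x \<circ> t \<and> coxeter_length n (x \<circ> t) > coxeter_length n x)"

definition bruhat_le :: "nat \<Rightarrow> (nat \<Rightarrow> nat) \<Rightarrow> (nat \<Rightarrow> nat) \<Rightarrow> bool" where
  "bruhat_le n x y \<longleftrightarrow> x \<in> Sym n \<and> (bruhat_step n)\<^sup>*\<^sup>* x y"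

definition bruhat_interval :: "nat \<Rightarrow> (nat \<Rightarrow> nat) \<Rightarrow> (nat \<Rightarrow> nat) \<Rightarrow> (nat \<Rightarrow> nat) set" where
  "bruhat_interval n u v = {x. bruhat_le n u x \<and> bruhat_le n x v}"

definition bruhat_adj :: "nat \<Rightarrow> (nat \<Rightarrow> nat) \<Rightarrow> (nat \<Rightarrow> nat) \<Rightarrow> bool" where
  "bruhat_adj n x y \<longleftrightarrow> (\<exists>t. reflection n t \<and> y = x \<circ> t)"

definition vertex_transitive :: "'a set \<Rightarrow> ('a \<Rightarrow> 'a \<Rightarrow> bool) \<Rightarrow> bool" where
  "vertex_transitive V E \<longleftrightarrow>
     (\<forall>x\<in>V. \<forall>y\<in>V. \<exists>\<sigma>. bij_betw \<sigma> V V \<and>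
        (\<forall>a\<in>V. \<forall>b\<in>V. E a b \<longleftrightarrow> E (\<sigma> a) (\<sigma> b)) \<and> \<sigma> x = y)"

definition contains_pattern :: "nat \<Rightarrow> (nat \<Rightarrow> nat) \<Rightarrow> nat list \<Rightarrow> bool" where
  "contains_pattern n w p \<longleftrightarrow>
     (\<exists>a :: nat \<Rightarrow> nat. strict_mono_on {1..length p} a \<and> a ` {1..length p} \<subseteq> {1..n} \<and>
        (\<forall>i\<in>{1..length p}. \<forall>j\<in>{1..length p}. w (a i) < w (a j) \<longleftrightarrow> p ! (i - 1) < p ! (j - 1)))"

definition avoids_pattern :: "nat \<Rightarrow> (nat \<Rightarrow> nat) \<Rightarrow> nat list \<Rightarrow> bool" where
  "avoids_pattern n w p \<longleftrightarrow> \<not> contains_pattern n w p"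

end

(*
  Bruhat order is compared through the rank function rk x p q = #{i < p. q <= x i}; the interval
  [id, w] becomes "below S w".

  If w avoids the four patterns, split w at every k with w{..<k} <= {..k} (or the same for the inverse):
  the interval then is a product of two smaller ones, and its Bruhat graph is the product graph.  When no
  such k is left, right multiplication by a right descent of w and left multiplication by a left descent
  are automorphisms, and they connect every x to id: the descent sets of w cover overlapping intervals of
  simple reflections, alternating between left and right, and an x <= w sharing no descent with w is
  forced to fix one point after the other.

  Conversely, a transitive graph is regular.  The degree of w is its number of inversions, the degree of
  id is the number of transpositions below w; deleting the value n shows by induction that the latter is
  at least the former, with equality only if w avoids 3412 and 4231.  For 34521 (and 54123 by inversion)
  count common neighbours: x t and x t' have three of them exactly if t, t' do not commute and both
  x t t' and x t' t lie in the interval.  At w, the descent "21" of the pattern thus lies in three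
  triangles of reflections that are otherwise unrelated, whereas at id two of any three reflections
  (a v) always lie in a common triangle.
*)
theory Submission
  imports Defs
begin

section \<open>Rank functions, Coxeter length and Bruhat order\<close>


text \<open>Ranks turn Bruhat order, a reachability relation, into a family of inequalities that can
  be read off region by region or refuted at a single corner; products, deletion of a position and
  exclusion of single elements all rest on this. The two factors of a split share the point
  \<open>k\<close>, so they live on overlapping intervals. In the unsplit case the obstacle is that
  removing the first position may destroy the monotone shape that drives the recursion; avoiding
  34521 then supplies the same shape for the inverse, so the recursion changes sides, and 54123
  plays this part on the other side. For the converse, degrees cannot detect 34521: it avoids 3412
  and 4231, so its own lower interval is regular. A finer invariant is needed. Every edge changes
  parity, so the Bruhat graph has no triangles; that three edges at a vertex come from one copy of
  the symmetric group on three points shows instead in their having three common neighbours, the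
  vertex and its products with the two three-cycles.\<close>

definition rk :: "(nat \<Rightarrow> nat) \<Rightarrow> nat \<Rightarrow> nat \<Rightarrow> nat" where
  "rk x p q = card {i. i < p \<and> q \<le> x i}"

definition rle :: "(nat \<Rightarrow> nat) \<Rightarrow> (nat \<Rightarrow> nat) \<Rightarrow> bool" where
  "rle x y \<longleftrightarrow> (\<forall>p q. rk x p q \<le> rk y p q)"

definition Inv :: "(nat \<Rightarrow> nat) \<Rightarrow> (nat \<times> nat) set" where
  "Inv x = {(i, j). i < j \<and> x j < x i}"

lemma rle_refl: "rle x x"
  by (simp add: rle_def)

lemma rle_trans: "rle x y \<Longrightarrow> rle y z \<Longrightarrow> rle x z"
  unfolding rle_def by (meson le_trans)

lemma rleD: "rle x y \<Longrightarrow> rk x p q \<le> rk y p q"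
  by (simp add: rle_def)

lemma rk_Suc: "rk x (Suc p) q = rk x p q + (if q \<le> x p then 1 else 0)"
proof -
  have "{i. i < Suc p \<and> q \<le> x i} = {i. i < p \<and> q \<le> x i} \<union> (if q \<le> x p then {p} else {})"
    by (auto simp: less_Suc_eq)
  then show ?thesis by (simp add: rk_def)
qed

lemma rk_cong: "(\<And>i. i < p \<Longrightarrow> (q \<le> x i) = (q \<le> y i)) \<Longrightarrow> rk x p q = rk y p q"
  unfolding rk_def by (metis (mono_tags, lifting))

lemma rk_pos: "0 < rk x p q \<longleftrightarrow> (\<exists>i<p. q \<le> x i)"
  unfolding rk_def by (auto simp: card_gt_0_iff)

lemma rk_eq_0: "rk x p q = 0 \<longleftrightarrow> (\<forall>i<p. x i < q)"
  using rk_pos[of x p q] by (auto simp: not_le)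

lemma rk_split:
  assumes "q \<le> q'"
  shows "rk x p q = rk x p q' + card {i. i < p \<and> q \<le> x i \<and> x i < q'}"
proof -
  have "{i. i < p \<and> q \<le> x i} = {i. i < p \<and> q' \<le> x i} \<union> {i. i < p \<and> q \<le> x i \<and> x i < q'}"
    using assms by auto
  then show ?thesis unfolding rk_def by (simp add: card_Un_disjoint disjoint_iff)
qed

text \<open>The points \<open>(i, x i)\<close> with \<open>i < q\<close> and \<open>x i < p\<close>
  number \<open>q - rk x q p\<close> when counted by positions and \<open>p - rk (inv x) p q\<close>
  when counted by values. The additive form avoids truncated subtraction.\<close>

lemma rk_inv:
  assumes "bij x"
  shows "rk (inv x) p q + q = rk x q p + p"
proof -
  have inj: "inj_on x A" for A using assms by (meson bij_is_inj inj_on_subset subset_UNIV)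
  have surj: "x (inv x j) = j" "inv x (x j) = j" for j
    using assms by (simp_all add: bij_is_inj bij_is_surj surj_f_inv_f)
  have "{j. j < p \<and> q \<le> inv x j} = x ` {i. q \<le> i \<and> x i < p}"
    by (force simp: image_iff surj)
  then have 1: "rk (inv x) p q = card {i. q \<le> i \<and> x i < p}"
    unfolding rk_def by (simp only: card_image[OF inj])
  have img: "x ` {i. x i < p} = {..<p}"
    by (auto simp: image_iff) (metis surj(1))
  then have fin: "finite {i. x i < p}" by (metis inj finite_imageD finite_lessThan)
  have "p = card {i. x i < p}"
    using card_image[OF inj, of "{i. x i < p}"] img by simp
  also have "{i. x i < p} = {i. q \<le> i \<and> x i < p} \<union> {i. i < q \<and> x i < p}" by auto
  also have "card \<dots> = card {i. q \<le> i \<and> x i < p} + card {i. i < q \<and> x i < p}"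
    using fin by (intro card_Un_disjoint) (auto elim: rev_finite_subset)
  finally have 2: "p = rk (inv x) p q + card {i. i < q \<and> x i < p}" using 1 by simp
  have "q = card {..<q}" by simp
  also have "{..<q} = {i. i < q \<and> p \<le> x i} \<union> {i. i < q \<and> x i < p}" by auto
  also have "card \<dots> = rk x q p + card {i. i < q \<and> x i < p}"
    unfolding rk_def by (intro card_Un_disjoint) auto
  finally show ?thesis using 2 by linarith
qed

lemma rle_inv:
  assumes "bij x" "bij y" "rle x y"
  shows "rle (inv x) (inv y)"
  unfolding rle_def
proof (intro allI)
  fix p q
  show "rk (inv x) p q \<le> rk (inv y) p q"
    using rk_inv[OF assms(1), of p q] rk_inv[OF assms(2), of p q] rleD[OF assms(3), of q p] by linarith
qed

lemma rle_transpose: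
  assumes "a < b" "x a < x b"
  shows "rle x (x \<circ> transpose a b)"
  unfolding rle_def
proof (intro allI)
  fix p q
  let ?t = "transpose a b"
  \<comment> \<open>If \<open>a\<close> and \<open>b\<close> both lie before \<open>p\<close>, the
    counted positions are exchanged along with the values. If only \<open>a\<close> does, it stays,
    and its value grows from \<open>x a\<close> to \<open>x b\<close>.\<close>
  let ?f = "\<lambda>i. if ?t i < p then ?t i else i"
  show "rk x p q \<le> rk (x \<circ> ?t) p q"
    unfolding rk_def
  proof (rule card_inj_on_le[where f = ?f])
    show "inj_on ?f {i. i < p \<and> q \<le> x i}"
      by (auto simp: inj_on_def inj_eq[OF inj_transpose] split: if_splits)
    show "?f ` {i. i < p \<and> q \<le> x i} \<subseteq> {i. i < p \<and> q \<le> (x \<circ> ?t) i}"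
      using assms by (auto simp: transpose_def split: if_splits)
  qed auto
qed

section \<open>Inversions and Coxeter length\<close>

lemma inversion_in_support:
  assumes x: "x permutes {l..u::nat}" and "i < j" "x j < x i"
  shows "l \<le> i \<and> i \<le> u \<and> l \<le> j \<and> j \<le> u"
proof -
  have i: "i \<in> {l..u}"
  proof (rule ccontr)
    assume *: "i \<notin> {l..u}"
    then have "x i = i" using x by (simp add: permutes_not_in)
    then have "x j \<noteq> j" using assms by simp
    then have "x j \<in> {l..u}" "j \<in> {l..u}" using x by (metis permutes_not_in permutes_in_image)+
    then show False using * assms \<open>x i = i\<close> by auto
  qed
  moreover have "j \<in> {l..u}"
  proof (rule ccontr)
    assume *: "j \<notin> {l..u}"
    then have "x j = j" using x by (simp add: permutes_not_in)
    moreover have "x i \<in> {l..u}" using i x by (simp only: permutes_in_image)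
    ultimately show False using * assms i by auto
  qed
  ultimately show ?thesis by simp
qed

lemma Inv_subset: "x permutes {l..u} \<Longrightarrow> Inv x \<subseteq> {l..u} \<times> {l..u}"
  by (auto simp: Inv_def dest: inversion_in_support)

lemma finite_Inv: "x permutes {l..u} \<Longrightarrow> finite (Inv x)"
  using Inv_subset by (meson finite_SigmaI finite_atLeastAtMost finite_subset)

lemma permutes_comp_transpose:
  "x permutes S \<Longrightarrow> a \<in> S \<Longrightarrow> b \<in> S \<Longrightarrow> x \<circ> transpose a b permutes S"
  by (simp add: permutes_compose permutes_swap_id)

lemma transpose_not_less_cases:
  fixes a b i j :: nat
  assumes "a < b" "i < j" "\<not> transpose a b i < transpose a b j"
  shows "(i = a \<and> a < j \<and> j \<le> b) \<or> (j = b \<and> a \<le> i \<and> i < b)"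
  using assms unfolding transpose_def by presburger

text \<open>An injection into the new inversions that misses \<open>(a, b)\<close>: a pair is
  carried along by the transposition unless this would reverse its positions. In that case it stays
  where it is and remains an inversion because \<open>x a < x b\<close>.\<close>

lemma card_Inv_transpose:
  assumes x: "x permutes {l..u}" and ab: "a \<in> {l..u}" "b \<in> {l..u}" "a < b" "x a < x b"
  shows "card (Inv x) < card (Inv (x \<circ> transpose a b))"
proof -
  let ?t = "transpose a b"
  let ?f = "\<lambda>(i, j). if ?t i < ?t j then (?t i, ?t j) else (i, j)"
  have inj: "inj_on ?f (Inv x)"
  proof (rule inj_onI, clarify)
    fix i j i' j'
    assume "(i, j) \<in> Inv x" "(i', j') \<in> Inv x"
      and eq: "(if ?t i < ?t j then (?t i, ?t j) else (i, j)) = (if ?t i' < ?t j' then (?t i', ?t j') else (i', j'))"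
    then have less: "i < j" "i' < j'" by (auto simp: Inv_def)
    show "i = i' \<and> j = j'"
    proof (cases "?t i < ?t j"; cases "?t i' < ?t j'")
      assume *: "?t i < ?t j" "\<not> ?t i' < ?t j'"
      then have "i' = ?t i" "j' = ?t j" using eq by simp_all
      with * less show ?thesis by simp
    next
      assume *: "\<not> ?t i < ?t j" "?t i' < ?t j'"
      then have "i = ?t i'" "j = ?t j'" using eq by simp_all
      with * less show ?thesis by simp
    qed (use eq in \<open>auto simp: inj_eq[OF inj_transpose]\<close>)
  qed
  have fin: "finite (Inv (x \<circ> ?t))"
    using finite_Inv permutes_comp_transpose[OF x ab(1,2)] by blast
  have "?f (i, j) \<in> Inv (x \<circ> ?t) - {(a, b)}" if "(i, j) \<in> Inv x" for i j
  proof -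
    have ij: "i < j" "x j < x i" using that by (auto simp: Inv_def)
    show ?thesis
    proof (cases "?t i < ?t j")
      case True
      moreover have "\<not> (?t i = a \<and> ?t j = b)"
      proof
        assume "?t i = a \<and> ?t j = b"
        then have "?t a = i" "?t b = j" by (metis transpose_involutory)+
        then show False using ij(1) ab(3) by simp
      qed
      ultimately show ?thesis using ij by (auto simp: Inv_def)
    next
      case False
      from transpose_not_less_cases[OF ab(3) ij(1) False] show ?thesis
      proof (elim disjE conjE)
        assume "i = a" "a < j" "j \<le> b"
        then show ?thesis using False ij ab(3,4) by (cases "j = b") (auto simp: Inv_def transpose_def)
      next
        assume "j = b" "a \<le> i" "i < b"
        then show ?thesis using False ij ab(3,4) by (cases "i = a") (auto simp: Inv_def transpose_def)
      qed
    qed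
  qed
  then have "?f ` Inv x \<subseteq> Inv (x \<circ> ?t) - {(a, b)}" by (force simp only: image_subset_iff split_paired_all)
  then have "card (Inv x) \<le> card (Inv (x \<circ> ?t) - {(a, b)})"
    using card_inj_on_le[OF inj] fin by simp
  moreover have "(a, b) \<in> Inv (x \<circ> ?t)" using ab by (simp add: Inv_def)
  ultimately show ?thesis using fin
    by (metis card_Diff1_less order_le_less_trans)
qed

lemma card_Inv_simple_le:
  assumes x: "x permutes {l..u}" and "a \<in> {l..u}" "Suc a \<in> {l..u}"
  shows "card (Inv (x \<circ> transpose a (Suc a))) \<le> Suc (card (Inv x))"
proof -
  let ?t = "transpose a (Suc a)"
  let ?f = "\<lambda>(i, j). (?t i, ?t j)"
  have "inj_on ?f (Inv (x \<circ> ?t) - {(a, Suc a)})"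
    by (rule inj_onI) (auto simp: inj_eq[OF inj_transpose])
  moreover have "?f (i, j) \<in> Inv x" if "(i, j) \<in> Inv (x \<circ> ?t) - {(a, Suc a)}" for i j
  proof -
    have ij: "i < j" "x (?t j) < x (?t i)" "\<not> (i = a \<and> j = Suc a)" using that by (auto simp: Inv_def)
    then have "?t i < ?t j" using transpose_not_less_cases[OF lessI, of i j a] by linarith
    then show ?thesis using ij by (simp add: Inv_def)
  qed
  then have "?f ` (Inv (x \<circ> ?t) - {(a, Suc a)}) \<subseteq> Inv x" by fast
  ultimately have "card (Inv (x \<circ> ?t) - {(a, Suc a)}) \<le> card (Inv x)"
    using card_inj_on_le finite_Inv[OF x] by blast
  moreover have "card (Inv (x \<circ> ?t)) - 1 \<le> card (Inv (x \<circ> ?t) - {(a, Suc a)})"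
    using diff_card_le_card_Diff[of "{(a, Suc a)}" "Inv (x \<circ> ?t)"] by simp
  ultimately show ?thesis by linarith
qed

lemma increasing_on_interval:
  fixes x :: "nat \<Rightarrow> nat"
  assumes "i < j" "\<And>k. i \<le> k \<Longrightarrow> k < j \<Longrightarrow> x k < x (Suc k)"
  shows "x i < x j"
  using assms
proof (induction j)
  case (Suc j)
  show ?case
  proof (cases "i = j")
    case True
    then show ?thesis using Suc.prems by simp
  next
    case False
    then have "x i < x j" using Suc by simp
    also have "x j < x (Suc j)" using Suc.prems by simp
    finally show ?thesis .
  qed
qed simp

lemma descent_exists:
  fixes x :: "nat \<Rightarrow> nat"
  assumes "bij x" "i < j" "x j < x i"
  shows "\<exists>k. i \<le> k \<and> k < j \<and> x (Suc k) < x k"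
proof (rule ccontr)
  assume "\<not> ?thesis"
  moreover have "x k \<noteq> x (Suc k)" for k
    using assms(1) by (simp add: bij_is_inj inj_eq)
  ultimately have "x k < x (Suc k)" if "i \<le> k" "k < j" for k
    using that by (meson linorder_neqE_nat)
  then have "x i < x j" by (rule increasing_on_interval[where x = x, OF assms(2)])
  with assms(3) show False by simp
qed

lemma permutes_no_inversion:
  assumes x: "x permutes {l..u::nat}" and "Inv x = {}"
  shows "x = id"
proof (rule ccontr)
  assume "x \<noteq> id"
  then have ex: "\<exists>i. x i \<noteq> i" by auto
  define a where "a = (LEAST i. x i \<noteq> i)"
  have a: "x a \<noteq> a" unfolding a_def using ex by (rule LeastI_ex)
  have less: "x i = i" if "i < a" for i using not_less_Least that unfolding a_def by blast
  have inj: "inj x" and "surj x" using x by (auto dest: permutes_inj permutes_surj)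
  obtain b where b: "x b = a" using \<open>surj x\<close> by (metis surjD)
  have "\<not> b < a" "b \<noteq> a" using a b less[of b] by auto
  then have "a < b" by simp
  moreover have "\<not> x a < a" using a less[of "x a"] inj by (auto dest: injD)
  then have "a < x a" using a by simp
  ultimately have "(a, b) \<in> Inv x" using b by (simp add: Inv_def)
  with assms(2) show False by simp
qed

lemma foldl_comp_snoc: "foldl (\<circ>) id (ss @ [s]) = foldl (\<circ>) id ss \<circ> s"
  by simp

lemma word_permutes_card_Inv_le:
  assumes "\<forall>s\<in>set ss. simple_refl n s"
  shows "foldl (\<circ>) id ss permutes {1..n} \<and> card (Inv (foldl (\<circ>) id ss)) \<le> length ss"
  using assms
proof (induction ss rule: rev_induct)
  case Nil
  have "Inv id = {}" by (auto simp: Inv_def)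
  then show ?case using permutes_id[of "{1..n}"] by (simp add: id_def)
next
  case (snoc s ss)
  then obtain i where i: "1 \<le> i" "i < n" "s = transpose i (Suc i)" by (auto simp: simple_refl_def)
  let ?w = "foldl (\<circ>) id ss"
  have "\<forall>s\<in>set ss. simple_refl n s" using snoc.prems by simp
  from snoc.IH[OF this] have w: "?w permutes {1..n}" "card (Inv ?w) \<le> length ss" by blast+
  have "card (Inv (?w \<circ> s)) \<le> Suc (card (Inv ?w))"
    unfolding i(3) using i by (intro card_Inv_simple_le[OF w(1)]) auto
  moreover have "?w \<circ> s permutes {1..n}"
    unfolding i(3) using i by (intro permutes_comp_transpose[OF w(1)]) auto
  ultimately show ?case using w(2) unfolding foldl_comp_snoc length_append_singleton by linarith
qed

lemma reduced_word_exists: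
  assumes "x permutes {1..n}"
  shows "\<exists>ss. length ss = card (Inv x) \<and> (\<forall>s\<in>set ss. simple_refl n s) \<and> x = foldl (\<circ>) id ss"
  using assms
proof (induction "card (Inv x)" arbitrary: x)
  case 0
  then have "x = id" using finite_Inv[of x 1 n] permutes_no_inversion[of x 1 n] by simp
  then show ?case using 0 by (intro exI[of _ "[]"]) simp
next
  case (Suc m)
  note x = Suc.prems
  have "Inv x \<noteq> {}" using Suc(2) by auto
  then obtain i j where ij: "i < j" "x j < x i" by (auto simp: Inv_def)
  obtain k where k: "i \<le> k" "k < j" "x (Suc k) < x k"
    using descent_exists[OF permutes_bij[OF x] ij] by blast
  have kn: "k \<in> {1..n}" "Suc k \<in> {1..n}" using inversion_in_support[OF x lessI k(3)] by auto
  let ?s = "transpose k (Suc k)"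
  let ?y = "x \<circ> ?s"
  have y: "?y permutes {1..n}" by (rule permutes_comp_transpose[OF x kn])
  have "card (Inv ?y) < card (Inv (?y \<circ> ?s))"
    using k by (intro card_Inv_transpose[OF y kn]) auto
  moreover have "card (Inv (?y \<circ> ?s)) \<le> Suc (card (Inv ?y))"
    by (rule card_Inv_simple_le[OF y kn])
  moreover have yx: "?y \<circ> ?s = x" by (simp add: comp_assoc)
  ultimately have m: "m = card (Inv ?y)" using Suc(2) by simp
  from Suc(1)[OF m y] obtain ss where ss: "length ss = card (Inv ?y)"
      "\<forall>s\<in>set ss. simple_refl n s" "?y = foldl (\<circ>) id ss" by blast
  have "simple_refl n ?s" using kn by (auto simp: simple_refl_def)
  moreover have "x = foldl (\<circ>) id (ss @ [?s])"
    using ss(3) yx by (simp only: foldl_comp_snoc)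
  ultimately show ?case using ss m Suc(2) by (intro exI[of _ "ss @ [?s]"]) auto
qed

lemma coxeter_length_eq:
  assumes "x permutes {1..n}"
  shows "coxeter_length n x = card (Inv x)"
  unfolding coxeter_length_def
  using reduced_word_exists[OF assms] word_permutes_card_Inv_le
  by (intro Least_equality) auto

section \<open>Bruhat order as comparison of ranks\<close>

lemma rk_comp_transpose_le:
  assumes "a < b" "x a < x b"
  shows "rk (x \<circ> transpose a b) p q \<le> rk x p q + (if a < p \<and> p \<le> b \<and> x a < q \<and> q \<le> x b then 1 else 0)"
proof (cases "a < p \<and> p \<le> b \<and> x a < q \<and> q \<le> x b")
  case True
  then have "{i. i < p \<and> q \<le> (x \<circ> transpose a b) i} = insert a {i. i < p \<and> q \<le> x i}"
    using assms by (auto simp: transpose_def)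
  then show ?thesis using True by (simp add: rk_def)
next
  case False
  let ?t = "transpose a b"
  let ?f = "\<lambda>i. if ?t i < p then ?t i else i"
  have "rk (x \<circ> ?t) p q \<le> rk x p q"
    unfolding rk_def
  proof (rule card_inj_on_le[where f = ?f])
    show "inj_on ?f {i. i < p \<and> q \<le> (x \<circ> ?t) i}"
      by (auto simp: inj_on_def inj_eq[OF inj_transpose] split: if_splits)
    show "?f ` {i. i < p \<and> q \<le> (x \<circ> ?t) i} \<subseteq> {i. i < p \<and> q \<le> x i}"
      using False assms by (auto simp: transpose_def split: if_splits)
  qed auto
  then show ?thesis by simp
qed

text \<open>The heart of the rank criterion: an \<open>x\<close> strictly below \<open>y\<close> can
  be raised by one Bruhat step and still stay below \<open>y\<close>. Here \<open>a\<close> is the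
  first position where they differ and \<open>b\<close> the first later position whose value lies
  above \<open>x a\<close> and not above \<open>y a\<close>. Minimality of \<open>b\<close> keeps
  the rectangle where ranks grow free of other such values.\<close>

lemma exchange_towards:
  assumes x: "x permutes {1..n}" and y: "y permutes {1..n}" and le: "rle x y" and ne: "x \<noteq> y"
  shows "\<exists>a\<in>{1..n}. \<exists>b\<in>{1..n}. a < b \<and> x a < x b \<and> rle (x \<circ> transpose a b) y"
proof -
  define a where "a = (LEAST i. x i \<noteq> y i)"
  have ex: "\<exists>i. x i \<noteq> y i" using ne by auto
  have a: "x a \<noteq> y a" unfolding a_def using ex by (rule LeastI_ex)
  have eq: "x i = y i" if "i < a" for i using not_less_Least that unfolding a_def by blast
  have injx: "inj x" and injy: "inj y" and "surj x"
    using x y by (auto dest: permutes_inj permutes_surj)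
  have rka: "rk x a q = rk y a q" for q using eq by (intro rk_cong) auto
  have "x a < y a"
    using rleD[OF le, of "Suc a" "x a"] a rka by (auto simp: rk_Suc split: if_splits)
  obtain c where c: "x c = y a" using \<open>surj x\<close> by (metis surjD)
  have "\<not> c < a" "c \<noteq> a" using a c eq[of c] injy by (auto dest: injD)
  then have "a < c" by simp
  define b where "b = (LEAST b. a < b \<and> x a < x b \<and> x b \<le> y a)"
  have b: "a < b \<and> x a < x b \<and> x b \<le> y a"
    unfolding b_def by (rule LeastI[of _ c]) (use c \<open>a < c\<close> \<open>x a < y a\<close> in auto)
  have between: "\<not> (x a < x i \<and> x i \<le> y a)" if "a < i" "i < b" for i
    using not_less_Least[of i "\<lambda>b. a < b \<and> x a < x b \<and> x b \<le> y a"] that unfolding b_def by blast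
  let ?t = "transpose a b"
  let ?x = "x \<circ> ?t"
  have "?x b < ?x a" using b by simp
  have in_n: "a \<in> {1..n} \<and> b \<in> {1..n}"
  proof -
    have "a \<in> {1..n}" using a x y by (metis permutes_not_in)
    moreover have "b \<in> {1..n}"
    proof (rule ccontr)
      assume b': "b \<notin> {1..n}"
      then have "x b = b" using x by (metis permutes_not_in)
      moreover have "y a \<in> {1..n}" using \<open>a \<in> {1..n}\<close> y by (metis permutes_in_image)
      ultimately show False using b b' \<open>a \<in> {1..n}\<close> by auto
    qed
    ultimately show ?thesis by simp
  qed
  have "rle ?x y"
    unfolding rle_def
  proof (intro allI)
    fix p q
    show "rk ?x p q \<le> rk y p q"
    proof (cases "a < p \<and> p \<le> b \<and> x a < q \<and> q \<le> x b")
      case True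
      then have pq: "a < p" "p \<le> b" "x a < q" "q \<le> x b" by auto
      \<comment> \<open>One unit of slack is needed on the rectangle. Values above
        \<open>y a\<close> are compared by hypothesis. Values of \<open>x\<close> from
        \<open>q\<close> to \<open>y a\<close> placed before \<open>p\<close> all occur before
        \<open>a\<close>, where \<open>x\<close> and \<open>y\<close> agree; \<open>y\<close> has
        one more of them, at \<open>a\<close> itself.\<close>
      have "rk ?x p q \<le> Suc (rk x p q)" using rk_comp_transpose_le[of a b x p q] b True by simp
      also have "rk x p q = rk x p (Suc (y a)) + card {i. i < p \<and> q \<le> x i \<and> x i < Suc (y a)}"
        using pq b by (intro rk_split) auto
      also have "{i. i < p \<and> q \<le> x i \<and> x i < Suc (y a)} \<subseteq> {i. i < a \<and> q \<le> x i \<and> x i \<le> y a}"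
      proof clarify
        fix i assume i: "i < p" "q \<le> x i" "x i < Suc (y a)"
        then have "\<not> a < i" "i \<noteq> a" using between[of i] pq by auto
        then show "i < a \<and> q \<le> x i \<and> x i \<le> y a" using i by simp
      qed
      then have "card {i. i < p \<and> q \<le> x i \<and> x i < Suc (y a)} \<le> card {i. i < a \<and> q \<le> x i \<and> x i \<le> y a}"
        by (intro card_mono) auto
      also have "{i. i < a \<and> q \<le> x i \<and> x i \<le> y a} = {i. i < a \<and> q \<le> y i \<and> y i \<le> y a}"
        using eq by auto
      also have "Suc (rk x p (Suc (y a)) + card {i. i < a \<and> q \<le> y i \<and> y i \<le> y a})
          \<le> rk y p (Suc (y a)) + card (insert a {i. i < a \<and> q \<le> y i \<and> y i \<le> y a})"
        using rleD[OF le] by simp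
      also have "card (insert a {i. i < a \<and> q \<le> y i \<and> y i \<le> y a})
          \<le> card {i. i < p \<and> q \<le> y i \<and> y i < Suc (y a)}"
        using pq b by (intro card_mono) auto
      also have "rk y p (Suc (y a)) + card {i. i < p \<and> q \<le> y i \<and> y i < Suc (y a)} = rk y p q"
        using pq b by (intro rk_split[symmetric]) auto
      finally show ?thesis by this simp_all
    next
      case False
      then have "rk ?x p q \<le> rk x p q" using rk_comp_transpose_le[of a b x p q] b by (simp only: if_False add_0_right)
      also have "rk x p q \<le> rk y p q" by (rule rleD[OF le])
      finally show ?thesis .
    qed
  qed
  then show ?thesis using in_n b by blast
qed

lemma bruhat_step_iff:
  assumes "x permutes {1..n}"
  shows "bruhat_step n x y \<longleftrightarrow>
    (\<exists>a\<in>{1..n}. \<exists>b\<in>{1..n}. a < b \<and> x a < x b \<and> y = x \<circ> transpose a b)"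
proof -
  have *: "card (Inv x) < card (Inv (x \<circ> transpose a b)) \<longleftrightarrow> x a < x b"
    if "a \<in> {1..n}" "b \<in> {1..n}" "a < b" for a b
  proof
    assume less: "card (Inv x) < card (Inv (x \<circ> transpose a b))"
    show "x a < x b"
    proof (rule ccontr)
      assume "\<not> x a < x b"
      moreover have "x a \<noteq> x b" using assms that by (metis less_irrefl permutes_inj injD)
      ultimately have "card (Inv (x \<circ> transpose a b)) < card (Inv (x \<circ> transpose a b \<circ> transpose a b))"
        using that by (intro card_Inv_transpose[OF permutes_comp_transpose[OF assms]]) auto
      then show False using less by (simp add: comp_assoc)
    qed
  qed (use card_Inv_transpose[OF assms] that in blast)
  show ?thesis (is "?L \<longleftrightarrow> ?R")
  proof
    assume ?L
    then obtain a b where ab: "a \<in> {1..n}" "b \<in> {1..n}" "a \<noteq> b" "y = x \<circ> transpose a b"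
      "card (Inv x) < card (Inv (x \<circ> transpose a b))"
      unfolding bruhat_step_def reflection_def
      by (metis coxeter_length_eq assms permutes_comp_transpose)
    show ?R
    proof (cases "a < b")
      case True
      then show ?thesis using ab * by blast
    next
      case False
      then have "b < a" "transpose a b = transpose b a" using ab by (auto simp: transpose_commute)
      then show ?thesis using ab *[of b a] by metis
    qed
  next
    assume ?R
    then obtain a b where ab: "a \<in> {1..n}" "b \<in> {1..n}" "a < b" "x a < x b" "y = x \<circ> transpose a b"
      by blast
    then have "coxeter_length n x < coxeter_length n (x \<circ> transpose a b)"
      using * assms by (metis coxeter_length_eq permutes_comp_transpose)
    then show ?L unfolding bruhat_step_def reflection_def
      using ab assms by (metis Sym_def less_irrefl mem_Collect_eq)
  qed
qed

lemma bruhat_steps_rle: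
  assumes "(bruhat_step n)\<^sup>*\<^sup>* x y" "x permutes {1..n}"
  shows "y permutes {1..n} \<and> rle x y"
  using assms
proof (induction rule: rtranclp_induct)
  case base
  then show ?case by (simp add: rle_refl)
next
  case (step y z)
  then have "y permutes {1..n}" "rle x y" by auto
  moreover from step obtain a b where "a\<in>{1..n}" "b\<in>{1..n}" "a < b" "y a < y b" "z = y \<circ> transpose a b"
    by (auto simp: bruhat_step_iff)
  ultimately show ?case using permutes_comp_transpose rle_transpose rle_trans by metis
qed

lemma rle_bruhat_steps:
  assumes "x permutes {1..n}" "y permutes {1..n}" "rle x y"
  shows "(bruhat_step n)\<^sup>*\<^sup>* x y"
  using assms
\<comment> \<open>Each exchange adds inversions, and \<open>n * n\<close> bounds their
  number.\<close>
proof (induction "n * n - card (Inv x)" arbitrary: x rule: less_induct)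
  case less
  show ?case
  proof (cases "x = y")
    case False
    then obtain a b where ab: "a\<in>{1..n}" "b\<in>{1..n}" "a < b" "x a < x b" "rle (x \<circ> transpose a b) y"
      using exchange_towards less.prems by blast
    let ?x = "x \<circ> transpose a b"
    have x': "?x permutes {1..n}" using less.prems(1) ab by (intro permutes_comp_transpose)
    have "card (Inv ?x) \<le> card ({1..n} \<times> {1..n})"
      using Inv_subset[OF x'] by (intro card_mono) auto
    then have "card (Inv ?x) \<le> n * n" by simp
    moreover have "card (Inv x) < card (Inv ?x)" using card_Inv_transpose less.prems(1) ab by blast
    ultimately have "(bruhat_step n)\<^sup>*\<^sup>* ?x y"
      using less.prems ab x' by (intro less.hyps) auto
    moreover have "bruhat_step n x ?x" using bruhat_step_iff less.prems(1) ab by blast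
    ultimately show ?thesis by (metis converse_rtranclp_into_rtranclp)
  qed simp
qed

lemma bruhat_le_iff:
  "bruhat_le n x y \<longleftrightarrow> x permutes {1..n} \<and> y permutes {1..n} \<and> rle x y"
  unfolding bruhat_le_def Sym_def using bruhat_steps_rle rle_bruhat_steps by blast

lemma rk_id: "rk id p q = p - q"
proof -
  have "{i. i < p \<and> q \<le> id i} = {q..<p}" by auto
  then show ?thesis by (simp add: rk_def)
qed

lemma rle_id:
  assumes "bij x"
  shows "rle id x"
  unfolding rle_def
proof (intro allI)
  fix p q
  show "rk id p q \<le> rk x p q" using rk_inv[OF assms, of q p] unfolding rk_id by linarith
qed


section \<open>Lower intervals, patterns and automorphisms\<close>


text \<open>No range is imposed on \<open>a\<close> and \<open>b\<close>: a transposition relating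
  two permutations of the same set can only move points of that set.\<close>

definition adj :: "(nat \<Rightarrow> nat) \<Rightarrow> (nat \<Rightarrow> nat) \<Rightarrow> bool" where
  "adj x y \<longleftrightarrow> (\<exists>a b. a \<noteq> b \<and> y = x \<circ> transpose a b)"

definition below :: "nat set \<Rightarrow> (nat \<Rightarrow> nat) \<Rightarrow> (nat \<Rightarrow> nat) set" where
  "below S w = {x. x permutes S \<and> rle x w}"

definition has_3412 :: "(nat \<Rightarrow> nat) \<Rightarrow> bool" where
  "has_3412 w \<longleftrightarrow> (\<exists>a b c d. a < b \<and> b < c \<and> c < d \<and> w c < w d \<and> w d < w a \<and> w a < w b)"

definition has_4231 :: "(nat \<Rightarrow> nat) \<Rightarrow> bool" where
  "has_4231 w \<longleftrightarrow> (\<exists>a b c d. a < b \<and> b < c \<and> c < d \<and> w d < w b \<and> w b < w c \<and> w c < w a)"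

definition has_34521 :: "(nat \<Rightarrow> nat) \<Rightarrow> bool" where
  "has_34521 w \<longleftrightarrow> (\<exists>a b c d e. a < b \<and> b < c \<and> c < d \<and> d < e \<and>
     w e < w d \<and> w d < w a \<and> w a < w b \<and> w b < w c)"

definition has_54123 :: "(nat \<Rightarrow> nat) \<Rightarrow> bool" where
  "has_54123 w \<longleftrightarrow> (\<exists>a b c d e. a < b \<and> b < c \<and> c < d \<and> d < e \<and>
     w c < w d \<and> w d < w e \<and> w e < w b \<and> w b < w a)"

lemma has_3412I: "a < b \<Longrightarrow> b < c \<Longrightarrow> c < d \<Longrightarrow> w c < w d \<Longrightarrow> w d < w a \<Longrightarrow> w a < w b \<Longrightarrow> has_3412 w"
  unfolding has_3412_def by blast

lemma has_4231I: "a < b \<Longrightarrow> b < c \<Longrightarrow> c < d \<Longrightarrow> w d < w b \<Longrightarrow> w b < w c \<Longrightarrow> w c < w a \<Longrightarrow> has_4231 w"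
  unfolding has_4231_def by blast

lemma has_34521I: "a < b \<Longrightarrow> b < c \<Longrightarrow> c < d \<Longrightarrow> d < e \<Longrightarrow>
    w e < w d \<Longrightarrow> w d < w a \<Longrightarrow> w a < w b \<Longrightarrow> w b < w c \<Longrightarrow> has_34521 w"
  unfolding has_34521_def by blast

lemma has_54123I: "a < b \<Longrightarrow> b < c \<Longrightarrow> c < d \<Longrightarrow> d < e \<Longrightarrow>
    w c < w d \<Longrightarrow> w d < w e \<Longrightarrow> w e < w b \<Longrightarrow> w b < w a \<Longrightarrow> has_54123 w"
  unfolding has_54123_def by blast

lemma inv_apply:
  assumes "bij x"
  shows "inv x (x i) = i" "x (inv x i) = i"
  using assms by (simp_all add: bij_is_inj bij_is_surj surj_f_inv_f)

text \<open>An occurrence in the inverse has the old values as positions. As permutations, 3412 and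
  4231 are involutions, while 34521 and 54123 are inverse to each other.\<close>

lemma has_inv_aux:
  assumes "bij w"
  shows "has_3412 w \<Longrightarrow> has_3412 (inv w)" "has_4231 w \<Longrightarrow> has_4231 (inv w)"
    "has_34521 w \<Longrightarrow> has_54123 (inv w)" "has_54123 w \<Longrightarrow> has_34521 (inv w)"
proof -
  note [simp] = inv_apply[OF assms]
  show "has_3412 (inv w)" if "has_3412 w"
  proof -
    from that obtain a b c d where "a < b" "b < c" "c < d" "w c < w d" "w d < w a" "w a < w b"
      unfolding has_3412_def by blast
    then show ?thesis by (intro has_3412I[of "w c" "w d" "w a" "w b"]) simp_all
  qed
  show "has_4231 (inv w)" if "has_4231 w"
  proof -
    from that obtain a b c d where "a < b" "b < c" "c < d" "w d < w b" "w b < w c" "w c < w a"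
      unfolding has_4231_def by blast
    then show ?thesis by (intro has_4231I[of "w d" "w b" "w c" "w a"]) simp_all
  qed
  show "has_54123 (inv w)" if "has_34521 w"
  proof -
    from that obtain a b c d e where "a < b" "b < c" "c < d" "d < e"
        "w e < w d" "w d < w a" "w a < w b" "w b < w c"
      unfolding has_34521_def by blast
    then show ?thesis by (intro has_54123I[of "w e" "w d" "w a" "w b" "w c"]) simp_all
  qed
  show "has_34521 (inv w)" if "has_54123 w"
  proof -
    from that obtain a b c d e where "a < b" "b < c" "c < d" "d < e"
        "w c < w d" "w d < w e" "w e < w b" "w b < w a"
      unfolding has_54123_def by blast
    then show ?thesis by (intro has_34521I[of "w c" "w d" "w e" "w b" "w a"]) simp_all
  qed
qed

lemma has_inv:
  assumes "bij w"
  shows "has_3412 (inv w) = has_3412 w" "has_4231 (inv w) = has_4231 w"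
    "has_34521 (inv w) = has_54123 w" "has_54123 (inv w) = has_34521 w"
  using has_inv_aux[OF assms] has_inv_aux[OF bij_imp_bij_inv[OF assms]] inv_inv_eq[OF assms] by auto

definition avoids :: "(nat \<Rightarrow> nat) \<Rightarrow> bool" where
  "avoids w \<longleftrightarrow> \<not> has_3412 w \<and> \<not> has_4231 w \<and> \<not> has_34521 w \<and> \<not> has_54123 w"

lemma avoids_inv: "bij w \<Longrightarrow> avoids (inv w) = avoids w"
  by (auto simp: avoids_def has_inv)

section \<open>Symmetries of the Bruhat graph\<close>

lemma conj_transpose:
  fixes x :: "nat \<Rightarrow> nat"
  assumes "bij x"
  shows "x \<circ> transpose a b = transpose (x a) (x b) \<circ> x"
  using assms by (auto simp: transpose_def fun_eq_iff inj_eq bij_is_inj)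

lemma inv_comp_transpose:
  fixes x :: "nat \<Rightarrow> nat"
  assumes "bij x"
  shows "inv (x \<circ> transpose a b) = inv x \<circ> transpose (x a) (x b)"
proof -
  have "inv (x \<circ> transpose a b) = transpose a b \<circ> inv x"
    using assms by (simp add: o_inv_distrib)
  also have "\<dots> = inv x \<circ> transpose (x a) (x b)"
    using conj_transpose[OF bij_imp_bij_inv[OF assms], of "x a" "x b"] by (simp add: inv_apply[OF assms])
  finally show ?thesis .
qed

lemma adj_inv:
  assumes "bij x" "bij y"
  shows "adj (inv x) (inv y) = adj x y"
proof -
  have *: "adj (inv x) (inv y)" if "adj x y" "bij x" for x y
  proof -
    from that obtain a b where ab: "a \<noteq> b" "y = x \<circ> transpose a b" by (auto simp: adj_def)
    then have "inv y = inv x \<circ> transpose (x a) (x b)" "x a \<noteq> x b"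
      using that inv_comp_transpose by (auto simp: bij_is_inj inj_eq)
    then show ?thesis unfolding adj_def by blast
  qed
  from *[of x y] *[of "inv x" "inv y"] assms show ?thesis by (auto simp: bij_imp_bij_inv inv_inv_eq)
qed

lemma adj_comp_left:
  assumes "bij g"
  shows "adj (g \<circ> x) (g \<circ> y) = adj x y"
proof -
  have "g \<circ> y = g \<circ> (x \<circ> t) \<longleftrightarrow> y = x \<circ> t" for t
    using assms by (metis bij_is_inj fun.inj_map inj_eq)
  then show ?thesis by (simp add: adj_def comp_assoc)
qed

lemma adj_comp_right:
  assumes "bij g"
  shows "adj (x \<circ> g) (y \<circ> g) = adj x y"
proof -
  have *: "adj (x \<circ> g) (y \<circ> g)" if "adj x y" "bij g" for x y g
  proof -
    from that obtain a b where ab: "a \<noteq> b" "y = x \<circ> transpose a b" by (auto simp: adj_def)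
    have "transpose a b \<circ> g = g \<circ> transpose (inv g a) (inv g b)"
      using conj_transpose[OF \<open>bij g\<close>, of "inv g a" "inv g b"] by (simp add: inv_apply[OF \<open>bij g\<close>])
    then have "y \<circ> g = (x \<circ> g) \<circ> transpose (inv g a) (inv g b)"
      using ab by (simp add: comp_assoc)
    moreover have "inv g a \<noteq> inv g b" using ab \<open>bij g\<close> by (metis inv_apply(2))
    ultimately show ?thesis unfolding adj_def by blast
  qed
  have cancel: "(z \<circ> g) \<circ> inv g = z" for z
    using assms by (auto simp: fun_eq_iff inv_apply)
  show ?thesis
  proof
    assume "adj (x \<circ> g) (y \<circ> g)"
    from *[OF this bij_imp_bij_inv[OF assms]] show "adj x y" by (simp only: cancel)
  qed (rule *[OF _ assms])
qed

lemma vertex_transitive_iso: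
  assumes vt: "vertex_transitive V E" and f: "bij_betw f V V'"
    and E: "\<And>a b. a \<in> V \<Longrightarrow> b \<in> V \<Longrightarrow> E' (f a) (f b) = E a b"
  shows "vertex_transitive V' E'"
  unfolding vertex_transitive_def
proof (intro ballI)
  fix x y assume x: "x \<in> V'" and y: "y \<in> V'"
  let ?g = "inv_into V f"
  have g: "bij_betw ?g V' V" by (rule bij_betw_inv_into[OF f])
  have gV: "?g a \<in> V" "f (?g a) = a" if "a \<in> V'" for a
    using g f that by (auto simp: bij_betw_apply bij_betw_inv_into_right)
  from vt x y gV obtain \<sigma> where s: "bij_betw \<sigma> V V"
    "\<forall>a\<in>V. \<forall>b\<in>V. E a b \<longleftrightarrow> E (\<sigma> a) (\<sigma> b)" "\<sigma> (?g x) = ?g y"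
    unfolding vertex_transitive_def by blast
  have sV: "\<sigma> a \<in> V" if "a \<in> V" for a using s(1) that by (rule bij_betw_apply)
  let ?\<tau> = "f \<circ> (\<sigma> \<circ> ?g)"
  have "bij_betw ?\<tau> V' V'" using bij_betw_trans[OF bij_betw_trans[OF g s(1)] f] .
  moreover have "E' a b \<longleftrightarrow> E' (?\<tau> a) (?\<tau> b)" if "a \<in> V'" "b \<in> V'" for a b
    using E[of "?g a" "?g b"] E[of "\<sigma> (?g a)" "\<sigma> (?g b)"] s(2) gV sV that by simp
  moreover have "?\<tau> x = y" using s(3) gV y by simp
  ultimately show "\<exists>\<sigma>. bij_betw \<sigma> V' V' \<and> (\<forall>a\<in>V'. \<forall>b\<in>V'. E' a b \<longleftrightarrow> E' (\<sigma> a) (\<sigma> b)) \<and> \<sigma> x = y"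
    by blast
qed

lemma below_inv:
  assumes w: "w permutes S"
  shows "bij_betw inv (below S w) (below S (inv w))"
proof (rule bij_betw_byWitness[where f' = inv])
  have *: "inv ` below S w \<subseteq> below S (inv w)" if "w permutes S" for w
    using that by (auto simp: below_def permutes_inv rle_inv permutes_bij)
  show "inv ` below S w \<subseteq> below S (inv w)" using * w by blast
  show "inv ` below S (inv w) \<subseteq> below S w"
    using *[of "inv w"] w by (simp add: permutes_inv permutes_inv_inv)
qed (auto simp: below_def permutes_inv_inv)

lemma vertex_transitive_below_inv:
  assumes w: "w permutes S" and "vertex_transitive (below S w) adj"
  shows "vertex_transitive (below S (inv w)) adj"
  using assms(2) below_inv[OF w]
  by (rule vertex_transitive_iso) (auto simp: below_def adj_inv permutes_bij)

text \<open>The lifting property. Only the rank at \<open>p = Suc i\<close> changes. For fixed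
  \<open>q\<close> the ranks of \<open>w\<close> at \<open>i\<close>, \<open>i + 1\<close>,
  \<open>i + 2\<close> have increments that do not increase, because \<open>w\<close> descends at
  \<open>i\<close>; so the bounds for \<open>x\<close> at the two outer places give the one required
  in the middle.\<close>

lemma rle_descent_right:
  assumes "w (Suc i) < w i" "rle x w"
  shows "rle (x \<circ> transpose i (Suc i)) w"
  unfolding rle_def
proof (intro allI)
  fix p q
  let ?y = "x \<circ> transpose i (Suc i)"
  have lt: "rk ?y p q = rk x p q" if "p \<le> i" for p
    using that by (intro rk_cong) (auto simp: transpose_def)
  have y: "?y i = x (Suc i)" "?y (Suc i) = x i" by auto
  have ge: "rk ?y p q = rk x p q" if "Suc (Suc i) \<le> p" for p
    using that
  proof (induction p rule: dec_induct)
    case base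
    then show ?case using lt[of i] by (simp only: rk_Suc y)
  next
    case (step p)
    then have "?y p = x p" by (simp add: transpose_def)
    then show ?case using step by (simp only: rk_Suc)
  qed
  show "rk ?y p q \<le> rk w p q"
  proof (cases "p = Suc i")
    case True
    have "rk ?y p q = rk x i q + (if q \<le> x (Suc i) then 1 else 0)"
      using lt[of i] True by (simp only: rk_Suc y)
    moreover have "rk x i q \<le> rk w i q" "rk x (Suc (Suc i)) q \<le> rk w (Suc (Suc i)) q"
      using rleD[OF assms(2)] by blast+
    ultimately show ?thesis using True assms(1) by (auto simp: rk_Suc split: if_splits)
  next
    case False
    then have "p \<le> i \<or> Suc (Suc i) \<le> p" by linarith
    then show ?thesis using lt[of p] ge[of p] rleD[OF assms(2), of p q] by metis
  qed
qed

lemma card_Inv_inv: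
  assumes "bij x"
  shows "card (Inv (inv x)) = card (Inv x)"
proof -
  note [simp] = inv_apply[OF assms]
  have "bij_betw (\<lambda>(i, j). (x j, x i)) (Inv x) (Inv (inv x))"
    by (rule bij_betw_byWitness[where f' = "\<lambda>(i, j). (inv x j, inv x i)"]) (auto simp: Inv_def)
  then show ?thesis by (simp add: bij_betw_same_card)
qed

section \<open>Automorphisms of the interval coming from descents\<close>

definition automorphism :: "'a set \<Rightarrow> ('a \<Rightarrow> 'a \<Rightarrow> bool) \<Rightarrow> ('a \<Rightarrow> 'a) \<Rightarrow> bool" where
  "automorphism V E \<sigma> \<longleftrightarrow> bij_betw \<sigma> V V \<and> (\<forall>a\<in>V. \<forall>b\<in>V. E a b \<longleftrightarrow> E (\<sigma> a) (\<sigma> b))"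

lemma automorphism_comp:
  assumes "automorphism V E \<sigma>" "automorphism V E \<tau>"
  shows "automorphism V E (\<tau> \<circ> \<sigma>)"
proof -
  have "bij_betw \<sigma> V V" "bij_betw \<tau> V V" using assms by (auto simp: automorphism_def)
  then have "bij_betw (\<tau> \<circ> \<sigma>) V V" "\<And>a. a \<in> V \<Longrightarrow> \<sigma> a \<in> V"
    by (auto intro: bij_betw_trans bij_betw_apply)
  then show ?thesis using assms unfolding automorphism_def comp_apply by meson
qed

lemma automorphism_inv_into:
  assumes "automorphism V E \<sigma>"
  shows "automorphism V E (inv_into V \<sigma>)"
proof -
  have b: "bij_betw \<sigma> V V" and E: "\<And>a b. a \<in> V \<Longrightarrow> b \<in> V \<Longrightarrow> E a b = E (\<sigma> a) (\<sigma> b)"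
    using assms by (auto simp: automorphism_def)
  have "inv_into V \<sigma> a \<in> V \<and> \<sigma> (inv_into V \<sigma> a) = a" if "a \<in> V" for a
    using b that by (meson bij_betw_apply bij_betw_inv_into bij_betw_inv_into_right)
  then show ?thesis using E b by (auto simp: automorphism_def bij_betw_inv_into)
qed

lemma automorphism_involution:
  assumes "\<And>a. a \<in> V \<Longrightarrow> \<sigma> a \<in> V" "\<And>a. a \<in> V \<Longrightarrow> \<sigma> (\<sigma> a) = a"
    "\<And>a b. a \<in> V \<Longrightarrow> b \<in> V \<Longrightarrow> E (\<sigma> a) (\<sigma> b) = E a b"
  shows "automorphism V E \<sigma>"
  unfolding automorphism_def using assms
  by (auto intro!: bij_betw_byWitness[where f' = \<sigma>])

lemma vertex_transitiveI:
  assumes c: "c \<in> V" and "\<And>x. x \<in> V \<Longrightarrow> \<exists>\<sigma>. automorphism V E \<sigma> \<and> \<sigma> x = c"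
  shows "vertex_transitive V E"
  unfolding vertex_transitive_def
proof (intro ballI)
  fix x y assume x: "x \<in> V" and y: "y \<in> V"
  obtain \<sigma> where s: "automorphism V E \<sigma>" "\<sigma> x = c" using assms(2)[OF x] by blast
  obtain \<tau> where t: "automorphism V E \<tau>" "\<tau> y = c" using assms(2)[OF y] by blast
  let ?g = "inv_into V \<tau> \<circ> \<sigma>"
  have "automorphism V E ?g" using s t automorphism_comp automorphism_inv_into by blast
  moreover have "?g x = y"
  proof -
    have "inv_into V \<tau> (\<tau> y) = y"
      using t(1) y by (intro bij_betw_inv_into_left) (auto simp: automorphism_def)
    then show ?thesis using s(2) t(2) by simp
  qed
  ultimately show "\<exists>\<sigma>. bij_betw \<sigma> V V \<and> (\<forall>a\<in>V. \<forall>b\<in>V. E a b \<longleftrightarrow> E (\<sigma> a) (\<sigma> b)) \<and> \<sigma> x = y"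
    unfolding automorphism_def by blast
qed

lemma right_automorphism:
  assumes w: "w permutes {l..u}" and d: "w (Suc i) < w i"
  shows "automorphism (below {l..u} w) adj (\<lambda>x. x \<circ> transpose i (Suc i))"
proof -
  have i: "i \<in> {l..u}" "Suc i \<in> {l..u}" using inversion_in_support[OF w lessI d] by auto
  show ?thesis
    by (rule automorphism_involution)
      (use i d in \<open>auto simp: below_def comp_assoc adj_comp_right intro: rle_descent_right permutes_comp_transpose\<close>)
qed

lemma left_automorphism:
  assumes w: "w permutes {l..u}" and d: "inv w (Suc i) < inv w i"
  shows "automorphism (below {l..u} w) adj (\<lambda>x. transpose i (Suc i) \<circ> x)"
proof (rule automorphism_involution)
  let ?t = "transpose i (Suc i)"
  have i: "i \<in> {l..u}" "Suc i \<in> {l..u}"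
    using inversion_in_support[OF permutes_inv[OF w] lessI d] by auto
  fix x assume "x \<in> below {l..u} w"
  then have x: "x permutes {l..u}" "rle x w" by (auto simp: below_def)
  \<comment> \<open>Left multiplication is right multiplication of the inverses, so the lifting
    property is applied there and carried back.\<close>
  have "rle (inv x \<circ> ?t) (inv w)"
    by (intro rle_descent_right d rle_inv) (use x w permutes_bij in auto)
  moreover have p: "inv x \<circ> ?t permutes {l..u}"
    using i x by (intro permutes_comp_transpose permutes_inv)
  ultimately have "rle (inv (inv x \<circ> ?t)) (inv (inv w))"
    using w by (intro rle_inv) (auto intro: permutes_bij permutes_inv)
  moreover have e: "inv (inv x \<circ> ?t) = ?t \<circ> x"
    using o_inv_distrib[OF permutes_bij[OF permutes_inv[OF x(1)]] bij_transpose] permutes_inv_inv[OF x(1)]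
    by simp
  moreover have "inv (inv x \<circ> ?t) permutes {l..u}" using p by (rule permutes_inv)
  ultimately show "?t \<circ> x \<in> below {l..u} w" using w by (simp add: below_def permutes_inv_inv)
next
  fix x y show "adj (transpose i (Suc i) \<circ> x) (transpose i (Suc i) \<circ> y) = adj x y"
    by (rule adj_comp_left) simp
qed (simp add: o_assoc)

text \<open>A descent shared by \<open>w\<close> and \<open>x\<close> on the same side gives an
  automorphism of the interval that shortens \<open>x\<close>. Iterating leads every
  \<open>x\<close> to \<open>id\<close>, so transitivity is reduced to finding a common
  descent.\<close>

lemma vertex_transitive_by_descents:
  assumes w: "w permutes {l..u}"
    and step: "\<And>x. x \<in> below {l..u} w \<Longrightarrow> x \<noteq> id \<Longrightarrow>
      \<exists>i. (w (Suc i) < w i \<and> x (Suc i) < x i) \<or> (inv w (Suc i) < inv w i \<and> inv x (Suc i) < inv x i)"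
  shows "vertex_transitive (below {l..u} w) adj"
proof (rule vertex_transitiveI)
  let ?V = "below {l..u} w"
  show "id \<in> ?V" using w by (auto simp: below_def permutes_id permutes_bij rle_id)
  have dec: "card (Inv (x \<circ> transpose i (Suc i))) < card (Inv x)"
    if x: "x permutes {l..u}" and d: "x (Suc i) < x i" for x i
  proof -
    have i: "i \<in> {l..u}" "Suc i \<in> {l..u}" using inversion_in_support[OF x lessI d] by auto
    have "card (Inv (x \<circ> transpose i (Suc i))) < card (Inv (x \<circ> transpose i (Suc i) \<circ> transpose i (Suc i)))"
      using d i x by (intro card_Inv_transpose[of _ l u] permutes_comp_transpose) auto
    then show ?thesis by (simp add: comp_assoc)
  qed
  show "\<exists>\<sigma>. automorphism ?V adj \<sigma> \<and> \<sigma> x = id" if "x \<in> ?V" for x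
    using that
  proof (induction "card (Inv x)" arbitrary: x rule: less_induct)
    case less
    then have x: "x permutes {l..u}" by (simp add: below_def)
    show ?case
    proof (cases "x = id")
      case True
      have "automorphism ?V adj id" by (simp add: automorphism_def)
      then show ?thesis using True by (intro exI[of _ id]) simp
    next
      case False
      have "\<exists>\<sigma>. automorphism ?V adj \<sigma> \<and> card (Inv (\<sigma> x)) < card (Inv x)"
      proof -
        from step[OF less.prems False] consider
          i where "w (Suc i) < w i" "x (Suc i) < x i"
          | i where "inv w (Suc i) < inv w i" "inv x (Suc i) < inv x i" by blast
        then show ?thesis
        proof cases
          case 1
          show ?thesis
            by (rule exI, rule conjI, rule right_automorphism[OF w 1(1)]) (rule dec[OF x 1(2)])
        next
          case (2 i)
          let ?t = "transpose i (Suc i)"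
          have "bij (?t \<circ> x)" using permutes_bij[OF x] by (simp add: bij_comp)
          then have "card (Inv (?t \<circ> x)) = card (Inv (inv (?t \<circ> x)))" by (simp add: card_Inv_inv)
          also have "inv (?t \<circ> x) = inv x \<circ> ?t" using permutes_bij[OF x] by (simp add: o_inv_distrib)
          also have "card (Inv \<dots>) < card (Inv (inv x))" by (rule dec[OF permutes_inv[OF x] 2(2)])
          also have "\<dots> = card (Inv x)" using permutes_bij[OF x] by (rule card_Inv_inv)
          finally show ?thesis using left_automorphism[OF w 2(1)] by blast
        qed
      qed
      then obtain \<sigma> where s: "automorphism ?V adj \<sigma>" "card (Inv (\<sigma> x)) < card (Inv x)" by blast
      then have "\<sigma> x \<in> ?V" using less.prems by (auto simp: automorphism_def bij_betw_apply)
      from less.hyps[OF s(2) this] obtain \<tau> where "automorphism ?V adj \<tau>" "\<tau> (\<sigma> x) = id" by blast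
      then show ?thesis using s(1) automorphism_comp by (intro exI[of _ "\<tau> \<circ> \<sigma>"]) auto
    qed
  qed
qed


section \<open>Permutations that do not split\<close>


text \<open>In each of the four patterns every letter takes part in some inversion. Hence an
  occurrence in \<open>x\<close> lies inside \<open>S\<close> as soon as all inversions of
  \<open>x\<close> do, and \<phi> then carries it to \<open>w\<close>.\<close>

lemma avoids_transfer:
  fixes x w \<phi> :: "nat \<Rightarrow> nat"
  assumes supp: "\<And>i j. i < j \<Longrightarrow> x j < x i \<Longrightarrow> i \<in> S \<and> j \<in> S"
    and mono: "\<And>i j. i \<in> S \<Longrightarrow> j \<in> S \<Longrightarrow> i < j \<Longrightarrow> \<phi> i < \<phi> j"
    and val: "\<And>i j. i \<in> S \<Longrightarrow> j \<in> S \<Longrightarrow> x i < x j \<Longrightarrow> w (\<phi> i) < w (\<phi> j)"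
  shows "has_3412 x \<Longrightarrow> has_3412 w" "has_4231 x \<Longrightarrow> has_4231 w"
    "has_34521 x \<Longrightarrow> has_34521 w" "has_54123 x \<Longrightarrow> has_54123 w"
proof -
  show "has_3412 w" if "has_3412 x"
  proof -
    from that obtain a b c d where *: "a < b" "b < c" "c < d" "x c < x d" "x d < x a" "x a < x b"
      unfolding has_3412_def by blast
    then have "a \<in> S" "b \<in> S" "c \<in> S" "d \<in> S"
      using supp[of a d] supp[of b c] by linarith+
    then show ?thesis using * mono val by (intro has_3412I[of "\<phi> a" "\<phi> b" "\<phi> c" "\<phi> d"]) blast+
  qed
  show "has_4231 w" if "has_4231 x"
  proof -
    from that obtain a b c d where *: "a < b" "b < c" "c < d" "x d < x b" "x b < x c" "x c < x a"
      unfolding has_4231_def by blast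
    then have "a \<in> S" "b \<in> S" "c \<in> S" "d \<in> S"
      using supp[of a c] supp[of b d] by linarith+
    then show ?thesis using * mono val by (intro has_4231I[of "\<phi> a" "\<phi> b" "\<phi> c" "\<phi> d"]) blast+
  qed
  show "has_34521 w" if "has_34521 x"
  proof -
    from that obtain a b c d e where *: "a < b" "b < c" "c < d" "d < e"
        "x e < x d" "x d < x a" "x a < x b" "x b < x c"
      unfolding has_34521_def by blast
    then have "a \<in> S" "b \<in> S" "c \<in> S" "d \<in> S" "e \<in> S"
      using supp[of a d] supp[of b d] supp[of c e] by linarith+
    then show ?thesis using * mono val
      by (intro has_34521I[of "\<phi> a" "\<phi> b" "\<phi> c" "\<phi> d" "\<phi> e"]) blast+
  qed
  show "has_54123 w" if "has_54123 x"
  proof -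
    from that obtain a b c d e where *: "a < b" "b < c" "c < d" "d < e"
        "x c < x d" "x d < x e" "x e < x b" "x b < x a"
      unfolding has_54123_def by blast
    then have "a \<in> S" "b \<in> S" "c \<in> S" "d \<in> S" "e \<in> S"
      using supp[of a c] supp[of b d] supp[of b e] by linarith+
    then show ?thesis using * mono val
      by (intro has_54123I[of "\<phi> a" "\<phi> b" "\<phi> c" "\<phi> d" "\<phi> e"]) blast+
  qed
qed

text \<open>The two conjuncts negate the splitting conditions at \<open>k\<close> for
  \<open>w\<close> and for its inverse. At the end points these conditions hold trivially for a
  permutation of \<open>{l..u}\<close>, so \<open>k\<close> runs strictly between them.\<close>

definition unsplit :: "nat \<Rightarrow> nat \<Rightarrow> (nat \<Rightarrow> nat) \<Rightarrow> bool" where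
  "unsplit l u w \<longleftrightarrow> (\<forall>k. l < k \<and> k < u \<longrightarrow> (\<exists>i<k. k < w i) \<and> (\<exists>i>k. w i < k))"

lemma unsplit_inv:
  assumes "bij w" "unsplit l u w"
  shows "unsplit l u (inv w)"
  unfolding unsplit_def
proof (intro allI impI)
  fix k assume "l < k \<and> k < u"
  then obtain i j where "i < k" "k < w i" "j > k" "w j < k"
    using assms(2) unfolding unsplit_def by blast
  then have "inv w (w j) > k" "inv w (w i) < k" by (simp_all add: inv_apply[OF assms(1)])
  then show "(\<exists>i<k. k < inv w i) \<and> (\<exists>i>k. inv w i < k)"
    using \<open>k < w i\<close> \<open>w j < k\<close> by blast
qed

text \<open>For a permutation of \<open>{l..u}\<close>: all of \<open>l, \<dots>, w l - 1\<close> are left descents of \<open>w\<close>.\<close>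
definition head_decreasing :: "nat \<Rightarrow> (nat \<Rightarrow> nat) \<Rightarrow> bool" where
  "head_decreasing l w \<longleftrightarrow> (\<forall>i j. l \<le> i \<and> i < j \<and> w j \<le> w l \<longrightarrow> w j < w i)"

lemma permutes_ge:
  assumes "x permutes {l..u::nat}"
  shows "l \<le> x i \<longleftrightarrow> l \<le> i"
proof (cases "i \<in> {l..u}")
  case True
  then have "x i \<in> {l..u}" using assms by (simp only: permutes_in_image)
  then show ?thesis using True by simp
next
  case False
  then show ?thesis using assms by (simp add: permutes_not_in)
qed

lemma permutes_le:
  assumes "x permutes {l..u::nat}"
  shows "x i \<le> u \<longleftrightarrow> i \<le> u"
proof (cases "i \<in> {l..u}")
  case True
  then have "x i \<in> {l..u}" using assms by (simp only: permutes_in_image)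
  then show ?thesis using True by simp
next
  case False
  then show ?thesis using assms by (simp add: permutes_not_in)
qed

lemma permutes_lt_fixed: "x permutes {l..u::nat} \<Longrightarrow> i < l \<Longrightarrow> x i = i"
  by (simp add: permutes_not_in)

lemma permutes_gt_fixed: "x permutes {l..u::nat} \<Longrightarrow> u < i \<Longrightarrow> x i = i"
  by (simp add: permutes_not_in)

text \<open>A failure for \<open>w\<close> is an ascent \<open>i, j\<close> among the values below
  \<open>w l\<close>; a failure for the inverse is an ascent \<open>i1, i2\<close> to the left of
  the position \<open>a\<close> of the value \<open>l\<close>. Together with the positions
  \<open>l\<close> and \<open>a\<close> the two ascents always complete a forbidden pattern of
  length four.\<close>

lemma head_decreasing_or_inv:
  assumes w: "w permutes {l..u}" and "\<not> has_3412 w" "\<not> has_4231 w"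
  shows "head_decreasing l w \<or> head_decreasing l (inv w)"
proof (rule ccontr)
  note [simp] = inv_apply[OF permutes_bij[OF w]]
  note inj = permutes_inj[OF w, THEN injD]
  assume "\<not> ?thesis"
  then obtain i j p q where ij: "l \<le> i" "i < j" "w j \<le> w l" "\<not> w j < w i"
    and pq: "l \<le> p" "p < q" "inv w q \<le> inv w l" "\<not> inv w q < inv w p"
    unfolding head_decreasing_def by blast
  define a where "a = inv w l"
  have wa: "w a = l" by (simp add: a_def)
  define i1 i2 where "i1 = inv w p" and "i2 = inv w q"
  have ws: "w i1 = p" "w i2 = q" by (simp_all add: i1_def i2_def)
  have "i1 \<noteq> i2" using ws pq(2) by auto
  then have 1: "l \<le> i1" "i1 < i2" "i2 \<le> a" "w i1 < w i2"
    using pq permutes_ge[OF permutes_inv[OF w], of p] by (simp_all add: i1_def i2_def a_def)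
  have 2: "i2 \<noteq> a" using wa ws pq by auto
  have big: "w l < w i2"
  proof (rule ccontr)
    assume *: "\<not> w l < w i2"
    then have "i1 \<noteq> l" using 1 by auto
    have "w i2 \<noteq> w l" using 1 inj[of i2 l] by auto
    have "w a < w i1" using 1 2 wa ws pq \<open>i1 \<noteq> l\<close> by (metis inj le_neq_implies_less less_not_refl order_less_le_trans)
    then have "has_4231 w" using * 1 2 \<open>i1 \<noteq> l\<close> \<open>w i2 \<noteq> w l\<close> by (intro has_4231I[of l i1 i2 a]) auto
    then show False using assms by simp
  qed
  have "w i \<noteq> w j" using ij inj[of i j] by auto
  then have "w i < w j" using ij by simp
  have "w j \<noteq> w l" using ij inj[of j l] by auto
  then have "w j < w l" using ij by simp
  have "i \<noteq> l" using \<open>w i < w j\<close> ij by auto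
  have li: "l \<le> w i" using permutes_ge[OF w] ij by simp
  show False
  \<comment> \<open>Before \<open>a\<close> the ascent gives the 4231 at \<open>l, i, j, a\<close>.
    Past \<open>a\<close>, the larger value at \<open>i2\<close> completes the 3412 at
    \<open>l, i2, a, j\<close>.\<close>
  proof (cases "j < a")
    case True
    have "w i \<noteq> w a" using ij True inj[of i a] by auto
    then have "w a < w i" using li wa by simp
    then have "has_4231 w"
      using True ij \<open>i \<noteq> l\<close> \<open>w i < w j\<close> \<open>w j < w l\<close> by (intro has_4231I[of l i j a]) auto
    then show False using assms by simp
  next
    case False
    have "j \<noteq> a" using \<open>w i < w j\<close> li wa by auto
    then have "has_3412 w"
      using False 1 2 big wa li \<open>w i < w j\<close> \<open>w j < w l\<close> by (intro has_3412I[of l i2 a j]) auto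
    then show False using assms by simp
  qed
qed

lemma first_gt:
  fixes w :: "nat \<Rightarrow> nat"
  assumes "v < w y"
  shows "\<exists>p\<le>y. v < w p \<and> (\<forall>i<p. w i \<le> v)"
  using assms LeastI[of "\<lambda>p. v < w p" y] Least_le[of "\<lambda>p. v < w p" y] not_less_Least[of _ "\<lambda>p. v < w p"]
  by (meson leI)

text \<open>If \<open>w l < w (Suc l)\<close>, then removing the first position need not leave a
  head-decreasing permutation. This lemma is what makes the inverse of the result head-decreasing,
  and it is the place where 34521 has to be excluded. The positions \<open>A\<close> and
  \<open>B\<close> of the values \<open>l + 1\<close> and \<open>l\<close> come in this order and
  serve as the final letters 2 and 1.\<close>

lemma head_decreasing_next:
  assumes w: "w permutes {l..u}" and av: "avoids w" and un: "unsplit l u w"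
    and hd: "head_decreasing l w" and u: "l + 2 \<le> u" and asc: "w l < w (Suc l)"
    and yy: "Suc l \<le> y" "y < y'" "y' \<le> inv w l"
  shows "w y' < w y"
proof (rule ccontr)
  note [simp] = inv_apply[OF permutes_bij[OF w]]
  note inj = permutes_inj[OF w, THEN injD]
  note no = av[unfolded avoids_def]
  assume "\<not> w y' < w y"
  moreover have "w y \<noteq> w y'" using yy inj[of y y'] by auto
  ultimately have asc': "w y < w y'" by simp
  define A B where "A = inv w (Suc l)" and "B = inv w l"
  have wA: "w A = Suc l" and wB: "w B = l" by (simp_all add: A_def B_def)
  have v1: "l + 2 \<le> w l"
  proof -
    have "l < Suc l \<and> Suc l < u" using u by simp
    then obtain i where i: "i < Suc l" "Suc l < w i" using un unfolding unsplit_def by blast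
    then have "i = l" using permutes_lt_fixed[OF w, of i] by (cases "i < l") auto
    then show ?thesis using i by simp
  qed
  have dec: "w j < w i" if "l \<le> i" "i < j" "w j \<le> w l" for i j
    using hd that unfolding head_decreasing_def by blast
  have "A \<noteq> l" "B \<noteq> l" "A \<noteq> Suc l" using v1 wA wB asc by auto
  moreover have "l \<le> A" "l \<le> B" using permutes_ge[OF w] wA wB by (metis le_Suc_eq order_refl)+
  ultimately have A: "Suc l < A" and "l < B" by simp_all
  have AB: "A < B"
  proof (rule ccontr)
    assume "\<not> A < B"
    moreover have "A \<noteq> B" using wA wB by auto
    ultimately show False using dec[of B A] \<open>l \<le> B\<close> wA wB v1 by simp
  qed
  have y'B: "y' < B"
  proof -
    have "l \<le> w y" using permutes_ge[OF w] yy by simp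
    then have "y' \<noteq> B" using asc' wB by auto
    then show ?thesis using yy by (simp add: B_def)
  qed
  have big: "w l < w y'" using dec[of y y'] asc' yy by (meson Suc_leD leI less_asym')
  show False
  proof (cases "A < y'")
    case True
    have "w y' \<noteq> w (Suc l)" using True A inj[of y' "Suc l"] by auto
    then consider "w y' < w (Suc l)" | "w (Suc l) < w y'" by linarith
    then show False
    proof cases
      case 1
      then have "has_4231 w" using True A y'B wA wB big v1
        by (intro has_4231I[of "Suc l" A y' B]) auto
      then show False using no by simp
    next
      case 2
      \<comment> \<open>The first entry above \<open>w (Suc l)\<close> is chosen so that all entries
        before \<open>p\<close> are bounded by \<open>w (Suc l)\<close>; splitting at
        \<open>p\<close> then bounds \<open>w (Suc l)\<close> from below.\<close>
      then obtain p where p: "p \<le> y'" "w (Suc l) < w p" "\<And>i. i < p \<Longrightarrow> w i \<le> w (Suc l)"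
        using first_gt[of "w (Suc l)" w y'] by blast
      have "w p \<noteq> w A" using p(2) wA v1 asc by linarith
      then have "p \<noteq> A" by blast
      have "Suc l < p"
      proof (rule ccontr)
        assume "\<not> Suc l < p"
        then consider "p < l" | "p = l" | "p = Suc l" by linarith
        then show False
        proof cases
          case 1
          then show False using p(2) asc v1 permutes_lt_fixed[OF w 1] by linarith
        qed (use p(2) asc in simp_all)
      qed
      show False
      proof (cases "p < A")
        case True
        then have "has_34521 w" using \<open>Suc l < p\<close> AB asc p(2) wA wB v1
          by (intro has_34521I[of l "Suc l" p A B]) auto
        then show False using no by simp
      next
        case False
        then have "A < p" using \<open>p \<noteq> A\<close> by simp
        have "B \<le> u" using permutes_le[OF w, of B] wB u by simp
        then have "l < p \<and> p < u" using \<open>Suc l < p\<close> p(1) y'B by simp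
        then obtain i where i: "i < p" "p < w i" using un unfolding unsplit_def by blast
        have v2: "p < w (Suc l)" using p(3)[OF i(1)] i(2) by simp
        \<comment> \<open>As \<open>p < w (Suc l)\<close>, the values from \<open>l + 1\<close> to
          \<open>w (Suc l)\<close> outnumber the positions from \<open>l\<close> to
          \<open>p - 1\<close>, so one of these values is placed at \<open>p\<close> or later. It
          completes a 4231 if it comes before \<open>B\<close> and a 3412 if it comes after.\<close>
        have "\<exists>h\<ge>p. Suc l \<le> w h \<and> w h \<le> w (Suc l)"
        proof (rule ccontr)
          assume *: "\<not> ?thesis"
          have "v \<in> w ` {l..<p}" if "v \<in> {Suc l..w (Suc l)}" for v
          proof (rule image_eqI)
            show "v = w (inv w v)" by simp
            have "\<not> p \<le> inv w v" using that spec[OF *[simplified], of "inv w v"] by auto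
            moreover have "l \<le> inv w v" using that permutes_ge[OF permutes_inv[OF w]] by simp
            ultimately show "inv w v \<in> {l..<p}" by simp
          qed
          then have "card {Suc l..w (Suc l)} \<le> card {l..<p}"
            by (meson card_image_le card_mono finite_atLeastLessThan finite_imageI le_trans subsetI)
          then show False using v2 \<open>Suc l < p\<close> by simp
        qed
        then obtain h where h: "p \<le> h" "Suc l \<le> w h" "w h \<le> w (Suc l)" by blast
        have "h \<noteq> p" using h p by auto
        then have "p < h" using h by simp
        have "w h \<noteq> w (Suc l)" using \<open>p < h\<close> \<open>Suc l < p\<close> inj[of h "Suc l"] by auto
        have "w h \<noteq> w A" using \<open>p < h\<close> \<open>A < p\<close> inj[of h A] by auto
        then have "Suc l < w h" using h wA by simp
        have "h \<noteq> B" using \<open>Suc l < w h\<close> wB by auto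
        show False
        proof (cases "h < B")
          case True
          then have "has_4231 w" using A \<open>A < p\<close> \<open>p < h\<close> \<open>Suc l < w h\<close> wA wB h \<open>w h \<noteq> w (Suc l)\<close>
            by (intro has_4231I[of "Suc l" A h B]) auto
          then show False using no by simp
        next
          case False
          then have "p < B" "B < h" using \<open>h \<noteq> B\<close> p(1) y'B by auto
          then have "has_3412 w" using \<open>Suc l < p\<close> \<open>Suc l < w h\<close> wB h \<open>w h \<noteq> w (Suc l)\<close> p(2)
            by (intro has_3412I[of "Suc l" p B h]) auto
          then show False using no by simp
        qed
      qed
    qed
  next
    case False
    have "y' \<noteq> A" using big wA v1 by auto
    then have y'A: "y' < A" using False by simp
    show False
    proof (cases "w l < w y")
      case True
      then have "has_34521 w" using yy y'A AB wA wB asc' v1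
        by (intro has_34521I[of l y y' A B]) auto
      then show False using no by simp
    next
      case False
      have "w y \<noteq> w l" using yy inj[of y l] by auto
      then have lt: "w y < w l" using False by simp
      then have "y \<noteq> Suc l" using asc by auto
      have "w y' \<noteq> w (Suc l)" using yy inj[of y' "Suc l"] by auto
      then consider "w y' < w (Suc l)" | "w (Suc l) < w y'" by linarith
      then show False
      proof cases
        case 1
        have "l \<le> w y" using permutes_ge[OF w] yy by simp
        moreover have "w y \<noteq> w B" using inj[of y B] y'B yy by auto
        ultimately have "w B < w y" using wB by simp
        then have "has_4231 w" using 1 \<open>y \<noteq> Suc l\<close> yy y'B asc'
          by (intro has_4231I[of "Suc l" y y' B]) auto
        then show False using no by simp
      next
        case 2
        then have "has_34521 w" using yy y'A AB asc wA wB v1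
          by (intro has_34521I[of l "Suc l" y' A B]) auto
        then show False using no by simp
      qed
    qed
  qed
qed



text \<open>Left multiplication by the cycle \<open>w l \<mapsto> l \<mapsto> l + 1 \<mapsto> \<dots> \<mapsto> w l\<close>.\<close>
definition peel :: "nat \<Rightarrow> (nat \<Rightarrow> nat) \<Rightarrow> nat \<Rightarrow> nat" where
  "peel l w = (\<lambda>i. if i = l then l else if l < i \<and> w i < w l then Suc (w i) else w i)"

section \<open>Removing the first position of a head-decreasing permutation\<close>

context
  fixes l u :: nat and w :: "nat \<Rightarrow> nat"
  assumes w: "w permutes {l..u}" and hd: "head_decreasing l w" and lu: "l \<le> u"
begin

lemma head_decreasingD: "l \<le> i \<Longrightarrow> i < j \<Longrightarrow> w j \<le> w l \<Longrightarrow> w j < w i"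
  using hd unfolding head_decreasing_def by blast

lemma value_ne_head: "i \<noteq> l \<Longrightarrow> w i \<noteq> w l"
  using inj_eq[OF permutes_inj[OF w]] by simp

lemma peel_l: "peel l w l = l"
  by (simp add: peel_def)

lemma peel_less: "l < i \<Longrightarrow> w i < w l \<Longrightarrow> peel l w i = Suc (w i)"
  by (simp add: peel_def)

lemma peel_greater: "w l < w i \<Longrightarrow> peel l w i = w i"
  by (cases "i = l") (simp_all add: peel_def)

text \<open>Values below \<open>w l\<close> move up by one into the gap left by \<open>w l\<close>,
  which keeps the relative order of the remaining entries.\<close>

lemma peel_less_iff:
  assumes "l < i" "l < j"
  shows "peel l w i < peel l w j \<longleftrightarrow> w i < w j"
proof -
  have "w i < w l \<or> w l < w i" "w j < w l \<or> w l < w j"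
    using assms value_ne_head[of i] value_ne_head[of j] by linarith+
  then show ?thesis
    using assms by (elim disjE) (simp_all add: peel_less peel_greater)
qed

lemma peel_eq_iff:
  assumes "l < i" "l < j"
  shows "peel l w i = peel l w j \<longleftrightarrow> w i = w j"
  using peel_less_iff[OF assms] peel_less_iff[OF assms(2,1)] by (metis linorder_less_linear less_irrefl)

lemma peel_permutes: "peel l w permutes {Suc l..u}"
proof (rule inj_imp_permutes)
  show "inj_on (peel l w) {Suc l..u}"
    by (rule inj_onI) (simp add: peel_eq_iff inj_eq[OF permutes_inj[OF w]])
next
  fix i assume i: "i \<in> {Suc l..u}"
  have "w i \<le> u" "l \<le> w i" "w l \<le> u" "l \<le> w l"
    using i lu permutes_le[OF w] permutes_ge[OF w] by auto
  then show "peel l w i \<in> {Suc l..u}"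
    using i value_ne_head[of i] by (auto simp: peel_def)
next
  fix i assume i: "i \<notin> {Suc l..u}"
  then consider "i < l" | "i = l" | "u < i" by fastforce
  then show "peel l w i = i"
  proof cases
    case 1
    then show ?thesis using permutes_lt_fixed[OF w 1] by (simp add: peel_def)
  next
    case 3
    then have "w i = i" "w l \<le> u" using permutes_gt_fixed[OF w] permutes_le[OF w] lu by auto
    then show ?thesis using 3 by (simp add: peel_def)
  qed (simp add: peel_def)
qed simp

lemma peel_avoids: "avoids w \<Longrightarrow> avoids (peel l w)"
proof -
  have S: "i \<in> {l<..} \<and> j \<in> {l<..}" if "i < j" "peel l w j < peel l w i" for i j
    using inversion_in_support[OF peel_permutes that] by auto
  have "has_3412 (peel l w) \<Longrightarrow> has_3412 w" "has_4231 (peel l w) \<Longrightarrow> has_4231 w"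
    "has_34521 (peel l w) \<Longrightarrow> has_34521 w" "has_54123 (peel l w) \<Longrightarrow> has_54123 w"
    by (rule avoids_transfer[where \<phi> = "\<lambda>i. i" and S = "{l<..}"]; use S peel_less_iff in auto)+
  then show "avoids w \<Longrightarrow> avoids (peel l w)" by (auto simp: avoids_def)
qed

text \<open>The values up to \<open>w l\<close> occur in decreasing order. If position
  \<open>l + 1\<close> carries one of them, it must be \<open>w l - 1\<close>, which peeling raises
  by one.\<close>

lemma peel_second:
  assumes "w (Suc l) < w l"
  shows "peel l w (Suc l) = w l"
proof -
  have "l \<le> w (Suc l)" using permutes_ge[OF w] by simp
  define j where "j = inv w (w l - 1)"
  have wj: "w j = w l - 1" by (simp add: j_def inv_apply[OF permutes_bij[OF w]])
  have "l \<le> w j" using wj assms \<open>l \<le> w (Suc l)\<close> by simp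
  then have "l \<le> j" using permutes_ge[OF w] by simp
  have "j \<noteq> l" using wj assms by auto
  have "\<not> Suc l < j"
    using head_decreasingD[of "Suc l" j] wj assms by auto
  then have "j = Suc l" using \<open>l \<le> j\<close> \<open>j \<noteq> l\<close> by simp
  then show ?thesis using wj assms by (simp add: peel_def)
qed

lemma inv_value_cancel: "inv w (w i) = i" "w (inv w i) = i"
  using inv_apply[OF permutes_bij[OF w]] by auto

lemma inv_peel: "inv (peel l w) (peel l w i) = i" "peel l w (inv (peel l w) i) = i"
  using inv_apply[OF permutes_bij[OF peel_permutes]] by auto

lemma inv_peel_greater: "w l < v \<Longrightarrow> inv (peel l w) v = inv w v"
  using inv_peel(1)[of "inv w v"] peel_greater[of "inv w v"] by (simp add: inv_value_cancel)

lemma inv_peel_le: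
  assumes "l < v" "v \<le> w l"
  shows "inv (peel l w) v = inv w (v - 1)"
proof -
  have "l \<le> inv w (v - 1)" using permutes_ge[OF permutes_inv[OF w], of "v - 1"] assms by simp
  moreover have "inv w (v - 1) \<noteq> l" using assms inv_value_cancel(2)[of "v - 1"] by auto
  ultimately have "peel l w (inv w (v - 1)) = v" using assms by (simp add: peel_def inv_value_cancel)
  then show ?thesis using inv_peel(1)[of "inv w (v - 1)"] by simp
qed

lemma inv_head_decreasing:
  assumes "l \<le> v" "v < v'" "v' \<le> w l"
  shows "inv w v' < inv w v"
proof (rule ccontr)
  assume *: "\<not> inv w v' < inv w v"
  have "inv w v \<noteq> inv w v'" using assms inv_value_cancel(2)[of v] inv_value_cancel(2)[of v'] by auto
  then have "inv w v < inv w v'" using * by simp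
  moreover have "l \<le> inv w v" using permutes_ge[OF permutes_inv[OF w]] assms by simp
  ultimately show False using head_decreasingD[of "inv w v" "inv w v'"] assms by (simp add: inv_value_cancel)
qed

text \<open>Two witnesses may be lost. A large entry at position \<open>l\<close> is replaced by the
  one at \<open>l + 1\<close>, whose peeled value is at least \<open>w l\<close>. A small entry may
  be raised to \<open>k\<close> itself; then the position of the value \<open>l\<close>, which lies
  at least as far to the right, has peeled value \<open>l + 1 < k\<close>.\<close>

lemma peel_unsplit:
  assumes "unsplit l u w"
  shows "unsplit (Suc l) u (peel l w)"
  unfolding unsplit_def
proof (intro allI impI)
  fix k assume k: "Suc l < k \<and> k < u"
  then have "l < k \<and> k < u" by simp
  then obtain i j where i: "i < k" "k < w i" and j: "k < j" "w j < k"
    using assms unfolding unsplit_def by blast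
  have "\<exists>i<k. k < peel l w i"
  proof (cases "i = l")
    case False
    then show ?thesis using i by (intro exI[of _ i]) (auto simp: peel_def)
  next
    case True
    show ?thesis
    proof (cases "w (Suc l) < w l")
      case t: True
      then show ?thesis using k i True peel_second by (intro exI[of _ "Suc l"]) auto
    next
      case False
      then have "w l < w (Suc l)" using value_ne_head[of "Suc l"] by simp
      then show ?thesis using k i True by (intro exI[of _ "Suc l"]) (auto simp: peel_def)
    qed
  qed
  moreover have "\<exists>j>k. peel l w j < k"
  proof (cases "w j < w l")
    case False
    then show ?thesis using j k value_ne_head[of j] by (intro exI[of _ j]) (auto simp: peel_def)
  next
    case True
    have "l \<le> w j" using permutes_ge[OF w] j k by simp
    then have "j \<le> inv w l"
      using inv_head_decreasing[of l "w j"] True by (cases "w j = l") (auto simp: inv_value_cancel)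
    moreover have "peel l w (inv w l) = Suc l"
      using True \<open>l \<le> w j\<close> j k \<open>j \<le> inv w l\<close> by (simp add: peel_def inv_value_cancel)
    ultimately show ?thesis using j k by (intro exI[of _ "inv w l"]) auto
  qed
  ultimately show "(\<exists>i<k. k < peel l w i) \<and> (\<exists>j>k. peel l w j < k)" by blast
qed

text \<open>Ranks at \<open>Suc l\<close> give \<open>x l \<le> w l\<close>, and since the inverse
  of \<open>x\<close> increases from \<open>l\<close> to \<open>w l\<close>, the value
  \<open>l\<close> cannot come after \<open>x l\<close>; so \<open>x\<close> fixes \<open>l\<close>.
  For \<open>q \<le> w l\<close> one passes to the height \<open>q - 1\<close>: there
  \<open>w\<close> gains exactly the position \<open>l\<close>, and the monotone inverse of
  \<open>x\<close> allows for this gain.\<close>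

lemma rle_peel:
  assumes x: "x permutes {l..u}" and le: "rle x w"
    and inc: "\<And>v. l \<le> v \<Longrightarrow> v < w l \<Longrightarrow> inv x v < inv x (Suc v)"
  shows "x l = l" "rle x (peel l w)"
proof -
  have invx: "inv x (x i) = i" "x (inv x i) = i" for i
    using inv_apply[OF permutes_bij[OF x]] by auto
  have incr: "inv x v < inv x v'" if "l \<le> v" "v < v'" "v' \<le> w l" for v v'
    by (rule increasing_on_interval[where x = "inv x"]) (use that inc in auto)
  have "rk w (Suc l) (Suc (w l)) = 0"
    unfolding rk_eq_0
  proof (intro allI impI)
    fix i assume "i < Suc l"
    then show "w i < Suc (w l)"
      using permutes_lt_fixed[OF w, of i] permutes_ge[OF w, of l] by (cases "i = l") auto
  qed
  then have "rk x (Suc l) (Suc (w l)) = 0" using rleD[OF le, of "Suc l" "Suc (w l)"] by simp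
  then have "x l \<le> w l" by (simp add: rk_eq_0 less_Suc_eq_le)
  have "l \<le> x l" using permutes_ge[OF x] by simp
  have "l \<le> inv x l" using permutes_ge[OF permutes_inv[OF x]] by simp
  have "inv x l \<le> inv x (x l)"
    using incr[of l "x l"] \<open>x l \<le> w l\<close> \<open>l \<le> x l\<close> by (cases "x l = l") auto
  then have "inv x l = l" using \<open>l \<le> inv x l\<close> invx by simp
  then show xl: "x l = l" using invx(2)[of l] by simp
  show "rle x (peel l w)"
    unfolding rle_def
  proof (intro allI)
    fix p q
    consider "q \<le> l" | "p \<le> l" | "w l < q" | "l < q" "q \<le> w l" "l < p" by linarith
    then show "rk x p q \<le> rk (peel l w) p q"
    proof cases
      case 1
      have "(q \<le> x i) = (q \<le> peel l w i)" for i
        using 1 permutes_ge[OF x, of i] permutes_ge[OF peel_permutes, of i] xl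
          permutes_lt_fixed[OF x, of i] permutes_lt_fixed[OF peel_permutes, of i]
        by (cases "i < l"; cases "i = l") auto
      then have "rk x p q = rk (peel l w) p q" by (intro rk_cong) auto
      then show ?thesis by simp
    next
      case 2
      have "rk x p q = rk (peel l w) p q"
        by (intro rk_cong) (use 2 permutes_lt_fixed[OF x] permutes_lt_fixed[OF peel_permutes] in auto)
      then show ?thesis by simp
    next
      case 3
      have "(q \<le> w i) = (q \<le> peel l w i)" for i
        using 3 permutes_ge[OF w, of l] by (auto simp: peel_def)
      then have "rk w p q = rk (peel l w) p q" by (intro rk_cong) auto
      then show ?thesis using rleD[OF le, of p q] by simp
    next
      case 4
      then obtain e where q: "q = Suc e" by (cases q) auto
      then have e: "l \<le> e" "e < w l" using 4 by simp_all
      \<comment> \<open>For \<open>i > l\<close> the condition \<open>e \<le> w i\<close> turns into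
        \<open>Suc e \<le> peel l w i\<close>; only the position \<open>l\<close> drops out.\<close>
      have "{i. i < p \<and> e \<le> w i} = insert l {i. i < p \<and> q \<le> peel l w i}"
      proof (rule set_eqI)
        fix i
        show "i \<in> {i. i < p \<and> e \<le> w i} \<longleftrightarrow> i \<in> insert l {i. i < p \<and> q \<le> peel l w i}"
        proof (cases "l < i")
          case True
          then show ?thesis using q e value_ne_head[of i] by (auto simp: peel_def)
        next
          case False
          then show ?thesis using q e 4 permutes_lt_fixed[OF w, of i] by (cases "i = l") (auto simp: peel_def)
        qed
      qed
      then have rkw: "rk w p e = Suc (rk (peel l w) p q)"
        using 4 q by (simp add: rk_def peel_def)
      have "Suc (rk x p q) \<le> rk w p e"
      proof (cases "inv x e < p")
        case True
        have "{i. i < p \<and> e \<le> x i} = insert (inv x e) {i. i < p \<and> q \<le> x i}"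
        proof (rule set_eqI)
          fix i
          have "e \<le> x i \<longleftrightarrow> x i = e \<or> q \<le> x i" using q by linarith
          moreover have "x i = e \<longleftrightarrow> i = inv x e" using invx by metis
          ultimately show "i \<in> {i. i < p \<and> e \<le> x i} \<longleftrightarrow>
              i \<in> insert (inv x e) {i. i < p \<and> q \<le> x i}"
            using True by (simp only: mem_Collect_eq insert_iff) blast
        qed
        then have "rk x p e = card (insert (inv x e) {i. i < p \<and> q \<le> x i})"
          by (simp only: rk_def)
        also have "\<dots> = Suc (rk x p q)"
          unfolding rk_def by (rule card_insert_disjoint) (simp_all add: q invx)
        finally have "rk x p e = Suc (rk x p q)" .
        then show ?thesis using rleD[OF le, of p "e"] by simp
      next
        case False
        \<comment> \<open>If the value \<open>e\<close> is not placed before \<open>p\<close>, then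
          none of the values from \<open>e + 1\<close> to \<open>w l\<close> is, since their
          positions increase. Only values above \<open>w l\<close> are counted for \<open>x\<close>,
          and on the side of \<open>w\<close> the position \<open>l\<close> comes in addition to
          those.\<close>
        have "q \<le> x i \<longleftrightarrow> Suc (w l) \<le> x i" if "i < p" for i
        proof (rule ccontr)
          assume "\<not> ?thesis"
          then have "l \<le> e" "e < x i" "x i \<le> w l" using q e by linarith+
          then have "inv x e < inv x (x i)" by (rule incr)
          then show False using that False by (simp add: invx)
        qed
        then have "rk x p q = rk x p (Suc (w l))"
          unfolding rk_def by (intro arg_cong[where f = card] Collect_cong) blast
        also have "\<dots> \<le> rk w p (Suc (w l))" by (rule rleD[OF le])
        finally have "Suc (rk x p q) \<le> Suc (rk w p (Suc (w l)))" by simp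
        also have "\<dots> = card (insert l {i. i < p \<and> Suc (w l) \<le> w i})"
          by (simp add: rk_def)
        also have "\<dots> \<le> rk w p e"
          unfolding rk_def using 4 e by (intro card_mono) auto
        finally show ?thesis .
      qed
      then show ?thesis using rkw by simp
    qed
  qed
qed

lemma peel_head_decreasing:
  assumes "w (Suc l) < w l"
  shows "head_decreasing (Suc l) (peel l w)"
  unfolding head_decreasing_def
proof (intro allI impI)
  fix i j assume ij: "Suc l \<le> i \<and> i < j \<and> peel l w j \<le> peel l w (Suc l)"
  then have "peel l w j \<le> w l" using peel_second[OF assms] by simp
  then have "w j \<le> w l" using ij by (auto simp: peel_def split: if_splits)
  then have "w j < w i" using ij by (intro head_decreasingD) auto
  then show "peel l w j < peel l w i" using peel_less_iff[of j i] ij by simp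
qed

end



text \<open>The descents excluded by \<open>left\<close> and \<open>right\<close> are exactly those that survive peeling:
  peeling may create a new left descent at \<open>w l\<close>, which lies below the range of \<open>right\<close> for the
  inverse of the peeled permutation.\<close>
lemma no_common_descent_imp_id:
  assumes "w permutes {l..u}" "avoids w" "unsplit l u w" "head_decreasing l w"
    and "x permutes {l..u}" "rle x w"
    and left: "\<And>v. l \<le> v \<Longrightarrow> inv w (Suc v) < inv w v \<Longrightarrow> inv x v < inv x (Suc v)"
    and right: "\<And>i p. p \<le> i \<Longrightarrow> w l < w p \<Longrightarrow> w (Suc i) < w i \<Longrightarrow> x i < x (Suc i)"
  shows "x = id"
  using assms
proof (induction "Suc u - l" arbitrary: l w x rule: less_induct)
  case less
  note w = less.prems(1) and av = less.prems(2) and un = less.prems(3) and hd = less.prems(4)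
    and x = less.prems(5) and le = less.prems(6) and left = less.prems(7) and right = less.prems(8)
  show ?case
  proof (cases "l \<le> u")
    case False
    then show ?thesis using x by (simp add: permutes_empty)
  next
    case lu: True
    note inv_hd = inv_head_decreasing[OF w hd lu]
    have inc: "inv x v < inv x (Suc v)" if "l \<le> v" "v < w l" for v
      using left[OF that(1)] inv_hd[of v "Suc v"] that by simp
    note xl = rle_peel(1)[OF w hd lu x le inc] and xp = rle_peel(2)[OF w hd lu x le inc]
    have x': "x permutes {Suc l..u}"
      by (rule permutes_superset[OF x]) (use xl in \<open>auto simp: not_less_eq_eq intro: le_antisym\<close>)
    let ?w = "peel l w"
    note w' = peel_permutes[OF w hd lu]
    show ?thesis
    \<comment> \<open>The ascending case needs the splitting condition at \<open>l + 1\<close>,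
      hence \<open>l + 1 < u\<close>. Otherwise \<open>x\<close>, which fixes \<open>l\<close>, acts
      on at most one point.\<close>
    proof (cases "l + 2 \<le> u")
      case False
      have "Inv x = {}"
        using inversion_in_support[OF x'] False by (fastforce simp: Inv_def)
      then show ?thesis using permutes_no_inversion[OF x] by simp
    next
      case u: True
      have dec: "Suc u - Suc l < Suc u - l" using lu by simp
      show ?thesis
      proof (cases "w (Suc l) < w l")
        case True
        show ?thesis
        proof (rule less.hyps[OF dec w' peel_avoids[OF w hd lu av] peel_unsplit[OF w hd lu un]
              peel_head_decreasing[OF w hd lu True] x' xp])
          fix v assume v: "Suc l \<le> v" "inv ?w (Suc v) < inv ?w v"
          show "inv x v < inv x (Suc v)"
          proof (cases "v < w l")
            case True
            then show ?thesis using v by (intro inc) auto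
          next
            case False
            \<comment> \<open>At the possible new descent the value \<open>w l\<close> now sits at
              the first remaining position \<open>l + 1\<close>, so no descent arises there.\<close>
            have "v \<noteq> w l"
            proof
              assume vl: "v = w l"
              have "inv ?w v = Suc l"
                using peel_second[OF w hd lu True] inv_peel(1)[OF w hd lu, of "Suc l"] vl by simp
              moreover have "Suc l \<le> inv ?w (Suc v)"
                using permutes_ge[OF permutes_inv[OF w']] v by simp
              ultimately show False using v by simp
            qed
            then have "inv ?w v = inv w v" "inv ?w (Suc v) = inv w (Suc v)"
              using False inv_peel_greater[OF w hd lu] by auto
            then show ?thesis using v by (intro left) auto
          qed
        next
          fix i p assume p: "p \<le> i" "?w (Suc l) < ?w p" "?w (Suc i) < ?w i"
          then have "w l < ?w p" using peel_second[OF w hd lu True] by simp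
          have wp: "w l < w p"
          proof (rule ccontr)
            assume *: "\<not> w l < w p"
            have "?w p \<le> w l"
            proof (cases "p = l")
              case True
              have "l \<le> w l" using permutes_ge[OF w, of l] by blast
              then show ?thesis unfolding True peel_l[OF w hd lu] .
            next
              case False
              then have "w p < w l" using * value_ne_head[OF w hd lu False] by linarith
              moreover have "?w p \<le> Suc (w p)" using False by (simp add: peel_def)
              ultimately show ?thesis by linarith
            qed
            then show False using \<open>w l < ?w p\<close> by simp
          qed
          have "l < p"
          proof (rule ccontr)
            assume "\<not> l < p"
            moreover have "p \<noteq> l" using wp by blast
            ultimately have "p < l" by linarith
            moreover have "l \<le> w l" using permutes_ge[OF w, of l] by blast
            ultimately show False using wp permutes_lt_fixed[OF w, of p] by linarith
          qed
          then have "w (Suc i) < w i" using p peel_less_iff[OF w hd lu, of "Suc i" i] by simp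
          then show "x i < x (Suc i)" by (rule right[OF p(1) wp])
        qed
      next
        case False
        then have asc: "w l < w (Suc l)" using value_ne_head[OF w hd lu, of "Suc l"] by simp
        \<comment> \<open>The recursion continues with the inverses, so \<open>left\<close> and
          \<open>right\<close> change places. Because of \<open>w l < w (Suc l)\<close>, the
          hypothesis \<open>right\<close> is available for all positions from \<open>l + 1\<close>
          on, which is all that the new \<open>left\<close> asks for.\<close>
        let ?g = "inv ?w"
        define a where "a = inv w l"
        have wl: "l + 2 \<le> w l"
        proof -
          have "l < Suc l \<and> Suc l < u" using u by simp
          then obtain i where i: "i < Suc l" "Suc l < w i" using un unfolding unsplit_def by blast
          then have "i = l" using permutes_lt_fixed[OF w, of i] by (cases "i < l") auto
          then show ?thesis using i by simp
        qed
        have ga: "?g (Suc l) = a" using inv_peel_le[OF w hd lu, of "Suc l"] wl by (simp add: a_def)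
        have wg: "inv ?g = ?w" using w' by (rule permutes_inv_inv)
        have hd': "head_decreasing (Suc l) ?g"
          unfolding head_decreasing_def
        proof (intro allI impI)
          fix v v' assume v: "Suc l \<le> v \<and> v < v' \<and> ?g v' \<le> ?g (Suc l)"
          show "?g v' < ?g v"
          proof (rule ccontr)
            assume *: "\<not> ?g v' < ?g v"
            have gv: "?w (?g v) = v" "?w (?g v') = v'" using inv_peel(2)[OF w hd lu] by auto
            then have "?g v < ?g v'" using * v by (metis less_irrefl linorder_neqE_nat)
            moreover have l: "Suc l \<le> ?g v" using permutes_ge[OF permutes_inv[OF w']] v by simp
            ultimately have "w (?g v') < w (?g v)"
              using v ga by (intro head_decreasing_next[OF w av un hd u asc]) (auto simp: a_def)
            then have "?w (?g v') < ?w (?g v)"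
              using peel_less_iff[OF w hd lu] l \<open>?g v < ?g v'\<close> by simp
            then show False using gv v by simp
          qed
        qed
        have "inv x = id"
        proof (rule less.hyps[OF dec permutes_inv[OF w'] _ _ hd' permutes_inv[OF x']])
          show "avoids ?g" using avoids_inv[OF permutes_bij[OF w']] peel_avoids[OF w hd lu av] by simp
          show "unsplit (Suc l) u ?g"
            by (rule unsplit_inv[OF permutes_bij[OF w'] peel_unsplit[OF w hd lu un]])
          show "rle (inv x) ?g" by (rule rle_inv[OF permutes_bij[OF x] permutes_bij[OF w'] xp])
        next
          fix i assume i: "Suc l \<le> i" "inv ?g (Suc i) < inv ?g i"
          then have "w (Suc i) < w i" using peel_less_iff[OF w hd lu, of "Suc i" i] wg by simp
          then have "x i < x (Suc i)" by (rule right[OF i(1) asc])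
          then show "inv (inv x) i < inv (inv x) (Suc i)" using x by (simp add: permutes_inv_inv)
        next
          fix v p assume p: "p \<le> v" "?g (Suc l) < ?g p" "?g (Suc v) < ?g v"
          \<comment> \<open>For values from \<open>l + 1\<close> to \<open>w l\<close> the function
            \<open>?g\<close> decreases from its value \<open>a\<close> at \<open>l + 1\<close>, and
            values up to \<open>l\<close> sit at positions up to \<open>l\<close>. So
            \<open>?g p > a\<close> forces \<open>p\<close> above \<open>w l\<close>, where peeling
            changes nothing.\<close>
          have "w l < p"
          proof (rule ccontr)
            assume *: "\<not> w l < p"
            show False
            proof (cases "l < p")
              case True
              then obtain e where e: "p = Suc e" "l \<le> e" by (cases p) simp_all
              have "inv w e \<le> inv w l"
              proof (cases "e = l")
                case False
                then have "inv w e < inv w l" using e * by (intro inv_hd) linarith+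
                then show ?thesis by simp
              qed simp
              moreover have "?g p = inv w e"
                using inv_peel_le[OF w hd lu True] * e(1) by simp
              ultimately show False using p(2) unfolding ga a_def by linarith
            next
              case False
              then have "\<not> Suc l \<le> ?g p" using permutes_ge[OF permutes_inv[OF w'], of p] by simp
              moreover have "Suc l \<le> ?g (Suc l)" using permutes_ge[OF permutes_inv[OF w']] by simp
              ultimately show False using p by simp
            qed
          qed
          then have "?g v = inv w v" "?g (Suc v) = inv w (Suc v)"
            using p inv_peel_greater[OF w hd lu] by auto
          moreover have "l \<le> v" using \<open>w l < p\<close> p wl by simp
          ultimately show "inv x v < inv x (Suc v)" using p by (intro left) auto
        qed
        then show ?thesis by (metis inv_id permutes_inv_inv x)
      qed
    qed
  qed
qed

text \<open>Without a common descent the hypotheses of \<open>no_common_descent_imp_id\<close> hold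
  without any restriction on the range, for \<open>w\<close> or for its inverse, whichever is
  head-decreasing.\<close>

lemma common_descent:
  assumes w: "w permutes {l..u}" and av: "avoids w" and un: "unsplit l u w"
    and x: "x \<in> below {l..u} w" "x \<noteq> id"
  shows "\<exists>i. (w (Suc i) < w i \<and> x (Suc i) < x i) \<or> (inv w (Suc i) < inv w i \<and> inv x (Suc i) < inv x i)"
proof (rule ccontr)
  assume no: "\<not> ?thesis"
  have xp: "x permutes {l..u}" "rle x w" using x by (auto simp: below_def)
  have "x i \<noteq> x (Suc i)" "inv x i \<noteq> inv x (Suc i)" for i
    using permutes_inj[OF xp(1)] permutes_inj[OF permutes_inv[OF xp(1)]] by (auto simp: inj_eq)
  then have 1: "x i < x (Suc i)" if "w (Suc i) < w i" for i
    using no that by (meson linorder_neqE_nat)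
  have 2: "inv x i < inv x (Suc i)" if "inv w (Suc i) < inv w i" for i
    using no that \<open>\<And>i. inv x i \<noteq> inv x (Suc i)\<close> by (meson linorder_neqE_nat)
  consider "head_decreasing l w" | "head_decreasing l (inv w)"
    using head_decreasing_or_inv[OF w] av by (auto simp: avoids_def)
  then show False
  proof cases
    case 1
    have "x = id"
      by (rule no_common_descent_imp_id[OF w av un 1 xp])
        (use \<open>\<And>i. w (Suc i) < w i \<Longrightarrow> x i < x (Suc i)\<close> 2 in blast)+
    then show False using x by simp
  next
    case h: 2
    have "inv x = id"
    proof (rule no_common_descent_imp_id[OF permutes_inv[OF w] _ _ h permutes_inv[OF xp(1)]])
      show "avoids (inv w)" using avoids_inv[OF permutes_bij[OF w]] av by simp
      show "unsplit l u (inv w)" by (rule unsplit_inv[OF permutes_bij[OF w] un])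
      show "rle (inv x) (inv w)" by (rule rle_inv[OF permutes_bij[OF xp(1)] permutes_bij[OF w] xp(2)])
    next
      fix v assume "inv (inv w) (Suc v) < inv (inv w) v"
      then show "inv (inv x) v < inv (inv x) (Suc v)"
        using 1 w xp(1) by (simp add: permutes_inv_inv)
    next
      fix i assume "inv w (Suc i) < inv w i"
      then show "inv x i < inv x (Suc i)" by (rule 2)
    qed
    then show False using x(2) by (metis inv_id permutes_inv_inv xp(1))
  qed
qed

lemma vertex_transitive_unsplit:
  assumes "w permutes {l..u}" "avoids w" "unsplit l u w"
  shows "vertex_transitive (below {l..u} w) adj"
  by (rule vertex_transitive_by_descents[OF assms(1)]) (rule common_descent[OF assms])


section \<open>Products\<close>


lemma permutes_singleton_eq_id:
  assumes "x permutes S" "\<And>i. i \<noteq> k \<Longrightarrow> x i = i"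
  shows "x = id"
proof -
  have "x permutes {k}" by (rule permutes_superset[OF assms(1)]) (use assms(2) in auto)
  then show ?thesis by (simp add: permutes_sing)
qed

text \<open>A permutation cannot move the point \<open>k\<close> alone. So if both factors are
  nontrivial, \<open>a\<close> moves some \<open>i < k\<close> and \<open>b\<close> some
  \<open>j > k\<close>, and the product moves both. Being a transposition it would exchange them,
  but the image of \<open>i\<close> is at most \<open>k\<close>.\<close>

lemma adj_id_comp_iff:
  assumes a: "a permutes {l..k}" and b: "b permutes {k..u::nat}"
  shows "adj id (a \<circ> b) \<longleftrightarrow> (a = id \<and> adj id b) \<or> (b = id \<and> adj id a)"
proof (cases "a = id \<or> b = id")
  case True
  have "\<not> adj id id"
  proof
    assume "adj id id"
    then obtain p q :: nat where "p \<noteq> q" "transpose p q = id"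
      unfolding adj_def by (metis id_comp)
    then show False by (simp add: transpose_eq_id_iff)
  qed
  then show ?thesis using True by auto
next
  case False
  obtain i where i: "i \<noteq> k" "a i \<noteq> i" using False permutes_singleton_eq_id[OF a] by blast
  obtain j where j: "j \<noteq> k" "b j \<noteq> j" using False permutes_singleton_eq_id[OF b] by blast
  have "i < k" using i permutes_gt_fixed[OF a, of i] by linarith
  have "k < j" using j permutes_lt_fixed[OF b, of j] by linarith
  have bi: "b i = i" by (rule permutes_lt_fixed[OF b \<open>i < k\<close>])
  have "k \<le> b j" using permutes_ge[OF b] \<open>k < j\<close> by simp
  have abj: "a (b j) \<noteq> j"
  proof (cases "b j = k")
    case True
    have "a k \<le> k" using permutes_le[OF a] by blast
    then show ?thesis using True \<open>k < j\<close> by simp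
  next
    case False
    then have "a (b j) = b j" using \<open>k \<le> b j\<close> by (intro permutes_gt_fixed[OF a]) simp
    then show ?thesis using j by simp
  qed
  have "\<not> adj id (a \<circ> b)"
  proof
    assume "adj id (a \<circ> b)"
    then obtain p q where "p \<noteq> q" and pq: "a \<circ> b = transpose p q" by (auto simp: adj_def)
    have ab: "a (b v) = transpose p q v" for v using fun_cong[OF pq, of v] by simp
    have "i \<in> {p, q}" using ab[of i] bi i by (auto simp: transpose_def split: if_splits)
    moreover have "j \<in> {p, q}" using ab[of j] abj by (auto simp: transpose_def split: if_splits)
    moreover have "i \<noteq> j" using \<open>i < k\<close> \<open>k < j\<close> by simp
    ultimately have "transpose p q i = j" by auto
    then have "a i = j" using ab[of i] bi by simp
    moreover have "a i \<le> k" using permutes_le[OF a, of i] \<open>i < k\<close> by simp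
    ultimately show False using \<open>k < j\<close> by simp
  qed
  then show ?thesis using False by simp
qed

text \<open>Multiplication by \<open>inv x1\<close> on the left and \<open>inv x2\<close> on the
  right preserves adjacency and moves the first vertex to \<open>id\<close>, while the second
  becomes a product over the same two intervals. The outcome is the adjacency of a Cartesian product
  of graphs.\<close>

lemma adj_comp_iff:
  assumes x1: "x1 permutes {l..k}" and y1: "y1 permutes {l..k}"
    and x2: "x2 permutes {k..u::nat}" and y2: "y2 permutes {k..u}"
  shows "adj (x1 \<circ> x2) (y1 \<circ> y2) \<longleftrightarrow> (x1 = y1 \<and> adj x2 y2) \<or> (x2 = y2 \<and> adj x1 y1)"
proof -
  let ?a = "inv x1 \<circ> y1" and ?b = "y2 \<circ> inv x2"
  have cancel: "inv x1 \<circ> x1 = id" "x1 \<circ> inv x1 = id" "inv x2 \<circ> x2 = id" "x2 \<circ> inv x2 = id"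
    using x1 x2 by (auto simp: permutes_inv_o)
  have bij: "bij (inv x1)" "bij (inv x2)" "bij x1" "bij x2"
    using x1 x2 by (auto intro: permutes_bij permutes_inv)
  have "adj (x1 \<circ> x2) (y1 \<circ> y2) = adj (inv x1 \<circ> (x1 \<circ> x2)) (inv x1 \<circ> (y1 \<circ> y2))"
    using bij by (simp only: adj_comp_left)
  also have "\<dots> = adj (inv x1 \<circ> (x1 \<circ> x2) \<circ> inv x2) (inv x1 \<circ> (y1 \<circ> y2) \<circ> inv x2)"
    using bij by (simp only: adj_comp_right)
  also have "inv x1 \<circ> (x1 \<circ> x2) \<circ> inv x2 = (inv x1 \<circ> x1) \<circ> (x2 \<circ> inv x2)" by (simp only: comp_assoc)
  also have "\<dots> = id" by (simp only: cancel id_comp)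
  also have "inv x1 \<circ> (y1 \<circ> y2) \<circ> inv x2 = ?a \<circ> ?b" by (simp only: comp_assoc)
  also have "adj id (?a \<circ> ?b) \<longleftrightarrow> (?a = id \<and> adj id ?b) \<or> (?b = id \<and> adj id ?a)"
    by (rule adj_id_comp_iff) (use x1 y1 x2 y2 in \<open>auto intro: permutes_compose permutes_inv\<close>)
  also have "?a = id \<longleftrightarrow> x1 = y1"
  proof
    assume "?a = id"
    then have "x1 \<circ> (inv x1 \<circ> y1) = x1" by simp
    then show "x1 = y1" by (simp only: comp_assoc[symmetric] cancel id_comp)
  qed (use cancel in auto)
  also have "?b = id \<longleftrightarrow> x2 = y2"
  proof
    assume "?b = id"
    then have "(y2 \<circ> inv x2) \<circ> x2 = x2" by simp
    then show "x2 = y2" by (simp only: comp_assoc cancel comp_id)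
  qed (use cancel in auto)
  also have "adj id ?a = adj x1 y1"
    using adj_comp_left[OF bij(1), of x1 y1] by (simp only: cancel)
  also have "adj id ?b = adj x2 y2"
    using adj_comp_right[OF bij(2), of x2 y2] by (simp only: cancel)
  finally show ?thesis .
qed

text \<open>The supports share only \<open>k\<close>, so \<open>inv y1 \<circ> x1\<close> fixes
  every point other than \<open>k\<close>, and therefore \<open>k\<close> as well.\<close>

lemma comp_eq_iff:
  assumes x1: "x1 permutes {l..k}" and y1: "y1 permutes {l..k}"
    and x2: "x2 permutes {k..u::nat}" and y2: "y2 permutes {k..u}"
    and eq: "x1 \<circ> x2 = y1 \<circ> y2"
  shows "x1 = y1 \<and> x2 = y2"
proof -
  have c: "inv y1 (y1 i) = i" "y1 (inv y1 i) = i" for i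
    using inv_apply[OF permutes_bij[OF y1]] by auto
  have "inv y1 \<circ> x1 = id"
  proof (rule permutes_singleton_eq_id)
    show "inv y1 \<circ> x1 permutes {l..k}" using x1 y1 by (auto intro: permutes_compose permutes_inv)
    fix i assume "i \<noteq> k"
    show "(inv y1 \<circ> x1) i = i"
    proof (cases "i < k")
      case True
      have "x1 i = y1 i"
        using fun_cong[OF eq, of i] permutes_lt_fixed[OF x2 True] permutes_lt_fixed[OF y2 True] by simp
      then show ?thesis using c by simp
    next
      case False
      then have "k < i" using \<open>i \<noteq> k\<close> by simp
      then show ?thesis
        using permutes_gt_fixed[OF x1] permutes_gt_fixed[OF permutes_inv[OF y1]] by simp
    qed
  qed
  then have "y1 (inv y1 (x1 i)) = y1 i" for i by (metis comp_apply id_apply)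
  then have "x1 = y1" using c by auto
  moreover have "x2 = y2"
  proof
    fix i
    have "inv y1 (y1 (x2 i)) = inv y1 (y1 (y2 i))" using fun_cong[OF eq, of i] \<open>x1 = y1\<close> by simp
    then show "x2 i = y2 i" using c by simp
  qed
  ultimately show ?thesis by simp
qed

lemma split_permutation:
  assumes x: "x permutes {l..u::nat}" and k: "l < k" "k \<le> u" and le: "\<And>i. i < k \<Longrightarrow> x i \<le> k"
  obtains x1 x2 where "x1 permutes {l..k}" "x2 permutes {k..u}" "x = x1 \<circ> x2"
proof -
  note inj = permutes_inj[OF x]
  have "card (x ` {..<k}) = k" using inj by (simp add: card_image inj_on_subset)
  \<comment> \<open>There are \<open>k\<close> positions below \<open>k\<close> and
    \<open>k + 1\<close> values up to \<open>k\<close>: exactly one value \<open>z\<close> is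
    missed, and it becomes the value of the first factor at \<open>k\<close>.\<close>
  then have "card ({..k} - x ` {..<k}) = 1"
    using le by (subst card_Diff_subset) auto
  then obtain z where z: "{..k} - x ` {..<k} = {z}" by (auto simp: card_1_singleton_iff)
  then have "z \<le> k" and zi: "\<And>i. i < k \<Longrightarrow> x i \<noteq> z" by auto
  define x1 where "x1 = (\<lambda>i. if i < k then x i else if i = k then z else i)"
  have "l \<le> z"
  proof (rule ccontr)
    assume "\<not> l \<le> z"
    then show False using permutes_lt_fixed[OF x, of z] zi[of z] k by simp
  qed
  have x1: "x1 permutes {l..k}"
  proof (rule inj_imp_permutes)
    show "inj_on x1 {l..k}"
    proof (rule inj_onI)
      fix i j assume "i \<in> {l..k}" "j \<in> {l..k}" "x1 i = x1 j"
      then show "i = j" using zi[of i] zi[of j] inj_eq[OF inj, of i j]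
        by (cases "i < k"; cases "j < k") (auto simp: x1_def)
    qed
    fix i assume "i \<in> {l..k}"
    then show "x1 i \<in> {l..k}"
      using le[of i] permutes_ge[OF x, of i] \<open>z \<le> k\<close> \<open>l \<le> z\<close> by (auto simp: x1_def)
  next
    fix i assume "i \<notin> {l..k}"
    then show "x1 i = i" using permutes_lt_fixed[OF x, of i] k by (auto simp: x1_def)
  qed simp
  have c: "inv x1 (x1 i) = i" "x1 (inv x1 i) = i" for i
    using inv_apply[OF permutes_bij[OF x1]] by auto
  have "inv x1 \<circ> x permutes {k..u}"
  proof (rule permutes_superset)
    have "inv x1 permutes {l..u}" by (rule permutes_subset[OF permutes_inv[OF x1]]) (use k in auto)
    then show "inv x1 \<circ> x permutes {l..u}" using x by (intro permutes_compose)
    fix i assume "i \<in> {l..u} - {k..u}"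
    then have "i < k" by auto
    then have "x i = x1 i" by (simp add: x1_def)
    then show "(inv x1 \<circ> x) i = i" using c by simp
  qed
  moreover have "x = x1 \<circ> (inv x1 \<circ> x)" using c by (simp add: fun_eq_iff)
  ultimately show ?thesis using that x1 by blast
qed

section \<open>Ranks of a product over two intervals sharing one point\<close>

context
  fixes l k u :: nat and x1 x2 :: "nat \<Rightarrow> nat"
  assumes x1: "x1 permutes {l..k}" and x2: "x2 permutes {k..u}"
begin

lemma rk_split_low:
  assumes "p \<le> k"
  shows "rk (x1 \<circ> x2) p q = rk x1 p q"
  by (rule rk_cong) (use assms permutes_lt_fixed[OF x2] in simp)

lemma rk_split_high:
  assumes "k < q"
  shows "rk (x1 \<circ> x2) p q = rk x2 p q"
proof (rule rk_cong)
  fix i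
  show "q \<le> (x1 \<circ> x2) i \<longleftrightarrow> q \<le> x2 i"
  proof (cases "k < x2 i")
    case True
    then show ?thesis using permutes_gt_fixed[OF x1] by simp
  next
    case False
    then have "x1 (x2 i) \<le> k" using permutes_le[OF x1] by simp
    then show ?thesis using False assms by simp
  qed
qed

text \<open>Through \<open>rk_inv\<close> the excess over \<open>p - q\<close> counts the values
  below \<open>q\<close> at positions from \<open>p\<close> on. Such an entry has to pass through
  \<open>k\<close>, so it can only be the value \<open>x1 k\<close> at position
  \<open>inv x2 k\<close>. The two conditions are written as positivity of ranks because this is
  monotone under \<open>rle\<close>.\<close>

lemma rk_split_corner:
  assumes "k < p" "q \<le> k"
  shows "rk (x1 \<circ> x2) p q + q = p + (if 0 < rk (inv x1) q k \<and> 0 < rk (inv x2) (Suc k) p then 1 else 0)"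
proof -
  have b: "bij x1" "bij x2" using x1 x2 by (auto intro: permutes_bij)
  note c = inv_apply[OF b(1)] inv_apply[OF b(2)]
  have i1: "inv x1 v \<le> k" if "v < q" for v
    using permutes_le[OF permutes_inv[OF x1], of v] that assms by simp
  have i2: "inv x2 v < p" if "v < k" for v
    using permutes_lt_fixed[OF permutes_inv[OF x2] that] that assms by simp
  have h1: "0 < rk (inv x1) q k \<longleftrightarrow> x1 k < q"
  proof
    assume "0 < rk (inv x1) q k"
    then obtain v where v: "v < q" "k \<le> inv x1 v" by (auto simp: rk_pos)
    then have "inv x1 v = k" using i1[of v] by simp
    then have "x1 k = v" using c(2)[of v] by simp
    then show "x1 k < q" using v by simp
  next
    assume "x1 k < q"
    then show "0 < rk (inv x1) q k" using c(1)[of k] by (auto simp: rk_pos intro!: exI[of _ "x1 k"])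
  qed
  have h2: "0 < rk (inv x2) (Suc k) p \<longleftrightarrow> p \<le> inv x2 k"
    using i2 by (auto simp: rk_pos less_Suc_eq) (meson leD)
  have "inv (x1 \<circ> x2) v = inv x2 (inv x1 v)" for v
    using b by (simp add: o_inv_distrib)
  then have "{v. v < q \<and> p \<le> inv (x1 \<circ> x2) v} = {v. v < q \<and> p \<le> inv x2 (inv x1 v)}" by simp
  also have "\<dots> = (if x1 k < q \<and> p \<le> inv x2 k then {x1 k} else {})"
  proof (rule set_eqI)
    fix v
    have "v = x1 k \<longleftrightarrow> inv x1 v = k" using c(1)[of k] c(2)[of v] by auto
    moreover have "inv x1 v = k" if "v < q" "p \<le> inv x2 (inv x1 v)"
    proof (rule ccontr)
      assume "inv x1 v \<noteq> k"
      then have "inv x2 (inv x1 v) < p" using i1[OF that(1)] by (intro i2) simp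
      then show False using that by simp
    qed
    ultimately show "v \<in> {v. v < q \<and> p \<le> inv x2 (inv x1 v)} \<longleftrightarrow>
        v \<in> (if x1 k < q \<and> p \<le> inv x2 k then {x1 k} else {})"
      by auto
  qed
  finally have "rk (inv (x1 \<circ> x2)) q p = (if x1 k < q \<and> p \<le> inv x2 k then 1 else 0)"
    by (simp add: rk_def)
  then show ?thesis using rk_inv[OF bij_comp[OF b(2,1)], of q p] h1 h2 by simp
qed

lemma rk_low_outside:
  assumes "k < p"
  shows "rk x1 p q + q = rk id q p + p"
proof -
  have "rk (inv x1) q p = rk id q p"
  proof (rule rk_cong)
    fix v
    show "p \<le> inv x1 v \<longleftrightarrow> p \<le> id v"
      using permutes_gt_fixed[OF permutes_inv[OF x1], of v] permutes_le[OF permutes_inv[OF x1], of v] assms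
      by (cases "k < v") auto
  qed
  then show ?thesis using rk_inv[OF permutes_bij[OF x1], of q p] by simp
qed

lemma rk_high_outside:
  assumes "q \<le> k"
  shows "rk x2 p q = rk id p q"
proof (rule rk_cong)
  fix i
  show "q \<le> x2 i \<longleftrightarrow> q \<le> id i"
    using permutes_lt_fixed[OF x2, of i] permutes_ge[OF x2, of i] assms
    by (cases "i < k") auto
qed

end

text \<open>In two regions of the \<open>(p, q)\<close> plane the rank of the product is that of one
  factor, and outside its own region the rank of a factor depends only on its support. In the
  remaining corner both factors enter through positivity alone.\<close>

lemma rle_comp_iff:
  assumes x1: "x1 permutes {l..k}" and x2: "x2 permutes {k..u}"
    and w1: "w1 permutes {l..k}" and w2: "w2 permutes {k..u::nat}"
  shows "rle (x1 \<circ> x2) (w1 \<circ> w2) \<longleftrightarrow> rle x1 w1 \<and> rle x2 w2"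
proof
  assume le: "rle (x1 \<circ> x2) (w1 \<circ> w2)"
  have "rk x1 p q \<le> rk w1 p q" for p q
  proof (cases "p \<le> k")
    case True
    then show ?thesis using rleD[OF le, of p q] rk_split_low[OF x1 x2] rk_split_low[OF w1 w2] by simp
  next
    case False
    then show ?thesis using rk_low_outside[OF x1 x2, of p q] rk_low_outside[OF w1 w2, of p q] by simp
  qed
  moreover have "rk x2 p q \<le> rk w2 p q" for p q
  proof (cases "k < q")
    case True
    then show ?thesis using rleD[OF le, of p q] rk_split_high[OF x1 x2] rk_split_high[OF w1 w2] by simp
  next
    case False
    then show ?thesis using rk_high_outside[OF x1 x2, of q p] rk_high_outside[OF w1 w2, of q p] by simp
  qed
  ultimately show "rle x1 w1 \<and> rle x2 w2" by (simp add: rle_def)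
next
  assume le: "rle x1 w1 \<and> rle x2 w2"
  have "rk (x1 \<circ> x2) p q \<le> rk (w1 \<circ> w2) p q" for p q
  proof -
    consider "p \<le> k" | "k < q" | "k < p" "q \<le> k" by linarith
    then show ?thesis
    proof cases
      case 1
      then show ?thesis using rleD[of x1 w1 p q] le rk_split_low[OF x1 x2] rk_split_low[OF w1 w2] by simp
    next
      case 2
      then show ?thesis using rleD[of x2 w2 p q] le rk_split_high[OF x1 x2] rk_split_high[OF w1 w2] by simp
    next
      case 3
      have "rk (inv x1) q k \<le> rk (inv w1) q k" "rk (inv x2) (Suc k) p \<le> rk (inv w2) (Suc k) p"
        using le x1 x2 w1 w2 by (auto intro!: rleD rle_inv permutes_bij)
      then have "(if 0 < rk (inv x1) q k \<and> 0 < rk (inv x2) (Suc k) p then 1 else 0::nat)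
          \<le> (if 0 < rk (inv w1) q k \<and> 0 < rk (inv w2) (Suc k) p then 1 else 0)" by auto
      then show ?thesis
        using rk_split_corner[OF x1 x2 3] rk_split_corner[OF w1 w2 3] by linarith
    qed
  qed
  then show "rle (x1 \<circ> x2) (w1 \<circ> w2)" by (simp add: rle_def)
qed

section \<open>Transitivity and pattern avoidance of products\<close>

lemma vertex_transitive_prod:
  assumes "vertex_transitive A E" "vertex_transitive B F"
  shows "vertex_transitive (A \<times> B) (\<lambda>(a, b) (a', b'). (a = a' \<and> F b b') \<or> (b = b' \<and> E a a'))"
  unfolding vertex_transitive_def
proof (clarify)
  fix a b a' b' assume ab: "a \<in> A" "b \<in> B" "a' \<in> A" "b' \<in> B"
  obtain \<sigma> where s: "bij_betw \<sigma> A A" "\<forall>x\<in>A. \<forall>y\<in>A. E x y \<longleftrightarrow> E (\<sigma> x) (\<sigma> y)" "\<sigma> a = a'"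
    using assms(1) ab unfolding vertex_transitive_def by blast
  obtain \<tau> where t: "bij_betw \<tau> B B" "\<forall>x\<in>B. \<forall>y\<in>B. F x y \<longleftrightarrow> F (\<tau> x) (\<tau> y)" "\<tau> b = b'"
    using assms(2) ab unfolding vertex_transitive_def by blast
  have "\<sigma> x = \<sigma> y \<longleftrightarrow> x = y" if "x \<in> A" "y \<in> A" for x y
    using s(1) that by (auto simp: bij_betw_def inj_on_eq_iff)
  moreover have "\<tau> x = \<tau> y \<longleftrightarrow> x = y" if "x \<in> B" "y \<in> B" for x y
    using t(1) that by (auto simp: bij_betw_def inj_on_eq_iff)
  moreover have "bij_betw (map_prod \<sigma> \<tau>) (A \<times> B) (A \<times> B)"
    using s(1) t(1) by (rule bij_betw_map_prod)
  ultimately show "\<exists>\<rho>. bij_betw \<rho> (A \<times> B) (A \<times> B) \<and>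
      (\<forall>x\<in>A \<times> B. \<forall>y\<in>A \<times> B.
        (case x of (a, b) \<Rightarrow> \<lambda>(a', b'). (a = a' \<and> F b b') \<or> (b = b' \<and> E a a')) y \<longleftrightarrow>
        (case \<rho> x of (a, b) \<Rightarrow> \<lambda>(a', b'). (a = a' \<and> F b b') \<or> (b = b' \<and> E a a')) (\<rho> y)) \<and>
      \<rho> (a, b) = (a', b')"
    using s(2,3) t(2,3) by (intro exI[of _ "map_prod \<sigma> \<tau>"]) auto
qed

lemma vertex_transitive_below_comp:
  assumes w1: "w1 permutes {l..k}" and w2: "w2 permutes {k..u}" and k: "l < k" "k \<le> u"
    and vt: "vertex_transitive (below {l..k} w1) adj" "vertex_transitive (below {k..u} w2) adj"
  shows "vertex_transitive (below {l..u} (w1 \<circ> w2)) adj"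
proof (rule vertex_transitive_iso[OF vertex_transitive_prod[OF vt]])
  let ?f = "\<lambda>(x1, x2). x1 \<circ> x2 :: nat \<Rightarrow> nat"
  have sub: "x1 \<circ> x2 permutes {l..u}" if "x1 permutes {l..k}" "x2 permutes {k..u}" for x1 x2
    using that k by (intro permutes_compose) (auto elim: permutes_subset)
  show "bij_betw ?f (below {l..k} w1 \<times> below {k..u} w2) (below {l..u} (w1 \<circ> w2))"
    unfolding bij_betw_def
  proof
    show "inj_on ?f (below {l..k} w1 \<times> below {k..u} w2)"
    proof (rule inj_onI)
      fix a b assume "a \<in> below {l..k} w1 \<times> below {k..u} w2" "b \<in> below {l..k} w1 \<times> below {k..u} w2"
        and eq: "?f a = ?f b"
      then have "fst a permutes {l..k}" "fst b permutes {l..k}" "snd a permutes {k..u}" "snd b permutes {k..u}"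
        by (auto simp: below_def)
      from comp_eq_iff[OF this] eq show "a = b" by (simp add: case_prod_beta prod_eq_iff)
    qed
    show "?f ` (below {l..k} w1 \<times> below {k..u} w2) = below {l..u} (w1 \<circ> w2)"
    proof
      show "?f ` (below {l..k} w1 \<times> below {k..u} w2) \<subseteq> below {l..u} (w1 \<circ> w2)"
        using sub rle_comp_iff[OF _ _ w1 w2] by (auto simp: below_def)
      show "below {l..u} (w1 \<circ> w2) \<subseteq> ?f ` (below {l..k} w1 \<times> below {k..u} w2)"
      proof
        fix x assume "x \<in> below {l..u} (w1 \<circ> w2)"
        then have x: "x permutes {l..u}" "rle x (w1 \<circ> w2)" by (auto simp: below_def)
        \<comment> \<open>The condition that allows splitting at \<open>k\<close> is the vanishing
          of a rank, so every element below the product inherits it.\<close>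
        have "rk (w1 \<circ> w2) k (Suc k) = 0"
          unfolding rk_eq_0
        proof (intro allI impI)
          fix i assume "i < k"
          then show "(w1 \<circ> w2) i < Suc k"
            using permutes_lt_fixed[OF w2] permutes_le[OF w1, of i] by simp
        qed
        then have "rk x k (Suc k) = 0" using rleD[OF x(2), of k "Suc k"] by simp
        then have "x i \<le> k" if "i < k" for i using that by (simp add: rk_eq_0 less_Suc_eq_le)
        from split_permutation[OF x(1) k this]
        obtain x1 x2 where x12: "x1 permutes {l..k}" "x2 permutes {k..u}" "x = x1 \<circ> x2" by blast
        then have "rle x1 w1" "rle x2 w2" using rle_comp_iff[OF _ _ w1 w2] x(2) by blast+
        then have "(x1, x2) \<in> below {l..k} w1 \<times> below {k..u} w2" using x12 by (simp add: below_def)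
        then show "x \<in> ?f ` (below {l..k} w1 \<times> below {k..u} w2)" using x12(3) by (metis case_prod_conv image_eqI)
      qed
    qed
  qed
qed (auto simp: below_def adj_comp_iff)

text \<open>Occurrences in \<open>w2\<close> stay in place, since \<open>w1\<close> is increasing on
  the points from \<open>k\<close> on. For \<open>w1\<close> the value \<open>w1 k\<close> is found
  in the product at position \<open>inv w2 k\<close>, which explains the exceptional clause of the
  position map.\<close>

lemma avoids_comp:
  assumes w1: "w1 permutes {l..k}" and w2: "w2 permutes {k..u::nat}" and av: "avoids (w1 \<circ> w2)"
  shows "avoids w1" "avoids w2"
proof -
  have S2: "i \<in> {k..} \<and> j \<in> {k..}" if "i < j" "w2 j < w2 i" for i j
    using inversion_in_support[OF w2 that] by simp
  have mono: "w1 p < w1 q" if "k \<le> p" "p < q" for p q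
  proof -
    have q: "w1 q = q" using that by (intro permutes_gt_fixed[OF w1]) simp
    show ?thesis
    proof (cases "p = k")
      case True
      have "w1 k \<le> k" using permutes_le[OF w1] by blast
      then show ?thesis using q that True by simp
    next
      case False
      then have "w1 p = p" using that by (intro permutes_gt_fixed[OF w1]) simp
      then show ?thesis using q that by simp
    qed
  qed
  have val2: "(w1 \<circ> w2) i < (w1 \<circ> w2) j" if "i \<in> {k..}" "j \<in> {k..}" "w2 i < w2 j" for i j
    using that permutes_ge[OF w2, of i] by (simp add: mono)
  have "has_3412 w2 \<Longrightarrow> has_3412 (w1 \<circ> w2)" "has_4231 w2 \<Longrightarrow> has_4231 (w1 \<circ> w2)"
    "has_34521 w2 \<Longrightarrow> has_34521 (w1 \<circ> w2)" "has_54123 w2 \<Longrightarrow> has_54123 (w1 \<circ> w2)"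
    by (rule avoids_transfer[where \<phi> = "\<lambda>i. i" and S = "{k..}"]; use S2 val2 in blast)+
  then show "avoids w2" using av by (auto simp: avoids_def)
  let ?\<phi> = "\<lambda>i. if i < k then i else inv w2 k"
  have S1: "i \<in> {..k} \<and> j \<in> {..k}" if "i < j" "w1 j < w1 i" for i j
    using inversion_in_support[OF w1 that] by simp
  have kk: "k \<le> inv w2 k" using permutes_ge[OF permutes_inv[OF w2], of k] by simp
  have mono1: "?\<phi> i < ?\<phi> j" if "i \<in> {..k}" "j \<in> {..k}" "i < j" for i j
    using that kk by auto
  have eq: "(w1 \<circ> w2) (?\<phi> i) = w1 i" if "i \<in> {..k}" for i
    using that permutes_lt_fixed[OF w2, of i] inv_apply(2)[OF permutes_bij[OF w2], of k]
    by (cases "i < k") auto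
  have val1: "(w1 \<circ> w2) (?\<phi> i) < (w1 \<circ> w2) (?\<phi> j)" if "i \<in> {..k}" "j \<in> {..k}" "w1 i < w1 j" for i j
    using eq[OF that(1)] eq[OF that(2)] that(3) by simp
  have "has_3412 w1 \<Longrightarrow> has_3412 (w1 \<circ> w2)" "has_4231 w1 \<Longrightarrow> has_4231 (w1 \<circ> w2)"
    "has_34521 w1 \<Longrightarrow> has_34521 (w1 \<circ> w2)" "has_54123 w1 \<Longrightarrow> has_54123 (w1 \<circ> w2)"
    by (rule avoids_transfer[where \<phi> = ?\<phi> and S = "{..k}"]; use S1 mono1 val1 in blast)+
  then show "avoids w1" using av by (auto simp: avoids_def)
qed

lemma avoids_imp_vertex_transitive:
  assumes "w permutes {l..u}" "avoids w"
  shows "vertex_transitive (below {l..u} w) adj"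
  using assms
proof (induction "u - l" arbitrary: l u w rule: less_induct)
  case less
  note w = less.prems(1) and av = less.prems(2)
  \<comment> \<open>Stated for an arbitrary permutation, as it is also applied to the inverse of the
    given one.\<close>
  have split: "vertex_transitive (below {l..u} w) adj"
    if w: "w permutes {l..u}" and av: "avoids w" and k: "l < k" "k < u" "\<And>i. i < k \<Longrightarrow> w i \<le> k" for w k
  proof -
    obtain w1 w2 where w12: "w1 permutes {l..k}" "w2 permutes {k..u}" "w = w1 \<circ> w2"
      using split_permutation[OF w k(1) less_imp_le[OF k(2)] k(3)] by blast
    have "avoids w1" "avoids w2" using avoids_comp[OF w12(1,2)] av w12(3) by auto
    then have "vertex_transitive (below {l..k} w1) adj" "vertex_transitive (below {k..u} w2) adj"
      using less.hyps[of k l] less.hyps[of u k] w12 k by simp_all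
    then show ?thesis
      using vertex_transitive_below_comp[OF w12(1,2)] k w12(3) by simp
  qed
  show ?case
  proof (cases "unsplit l u w")
    case True
    then show ?thesis using vertex_transitive_unsplit w av by blast
  next
    case False
    then obtain k where k: "l < k" "k < u" and "(\<forall>i<k. w i \<le> k) \<or> (\<forall>i>k. k \<le> w i)"
      unfolding unsplit_def by (meson leI)
    then consider "\<forall>i<k. w i \<le> k" | "\<forall>i>k. k \<le> w i" by blast
    then show ?thesis
    proof cases
      case 1
      then show ?thesis using split[OF w av k] by blast
    next
      case 2
      have "inv w i \<le> k" if "i < k" for i
      proof (rule ccontr)
        assume "\<not> inv w i \<le> k"
        then have "k \<le> w (inv w i)" using 2 by simp
        then show False using that inv_apply(2)[OF permutes_bij[OF w], of i] by simp
      qed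
      then have "vertex_transitive (below {l..u} (inv w)) adj"
        using split[OF permutes_inv[OF w] _ k] av avoids_inv[OF permutes_bij[OF w]] by blast
      from vertex_transitive_below_inv[OF permutes_inv[OF w] this] show ?thesis
        by (simp add: permutes_inv_inv[OF w])
    qed
  qed
qed


section \<open>Degrees\<close>


text \<open>A criterion for transpositions below \<open>w\<close>: some entry leads from at most
  \<open>a\<close> to at least \<open>b\<close>, and some entry leads back. The condition is
  symmetric in positions and values, so it is shared with the inverse.\<close>

definition reflections_below :: "(nat \<Rightarrow> nat) \<Rightarrow> (nat \<times> nat) set" where
  "reflections_below w = {(a, b). a < b \<and> (\<exists>i\<le>a. b \<le> w i) \<and> (\<exists>i\<ge>b. w i \<le> a)}"

lemma reflections_below_subset:
  assumes "w permutes {l..u::nat}"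
  shows "reflections_below w \<subseteq> {l..u} \<times> {l..u}"
proof
  fix ab assume "ab \<in> reflections_below w"
  then obtain a b i j where ab: "ab = (a, b)" "a < b" "i \<le> a" "b \<le> w i" "b \<le> j" "w j \<le> a"
    by (auto simp: reflections_below_def)
  then have "i < j" "w j < w i" by linarith+
  then have "l \<le> i \<and> i \<le> u \<and> l \<le> j \<and> j \<le> u" by (rule inversion_in_support[OF assms])
  then show "ab \<in> {l..u} \<times> {l..u}" using ab by auto
qed

lemma reflections_below_inv:
  assumes "bij w"
  shows "reflections_below (inv w) = reflections_below w"
proof -
  have *: "reflections_below w \<subseteq> reflections_below (inv w)" if "bij w" for w
  proof
    fix ab assume "ab \<in> reflections_below w"
    then obtain a b i j where ab: "ab = (a, b)" "a < b" "i \<le> a" "b \<le> w i" "b \<le> j" "w j \<le> a"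
      by (auto simp: reflections_below_def)
    have "inv w (w i) = i" "inv w (w j) = j" using inv_apply[OF that] by auto
    then have "\<exists>v\<le>a. b \<le> inv w v" "\<exists>v\<ge>b. inv w v \<le> a" using ab by metis+
    then show "ab \<in> reflections_below (inv w)" using ab by (simp add: reflections_below_def)
  qed
  from *[OF assms] *[OF bij_imp_bij_inv[OF assms]] show ?thesis by (simp add: inv_inv_eq assms)
qed

text \<open>The rank of the transposition exceeds that of \<open>id\<close> by one at most, and only
  for \<open>p\<close> and \<open>q\<close> in the square from \<open>a + 1\<close> to
  \<open>b\<close>. There the two entries make \<open>rk w p q\<close> and
  \<open>rk (inv w) q p\<close> positive, and as these differ by \<open>p - q\<close>, the rank of
  \<open>w\<close> is large enough.\<close>

lemma rle_transpose_reflection: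
  assumes w: "bij w" and "(a, b) \<in> reflections_below w"
  shows "rle (transpose a b) w"
  unfolding rle_def
proof (intro allI)
  fix p q
  from assms(2) obtain i j where ij: "a < b" "i \<le> a" "b \<le> w i" "b \<le> j" "w j \<le> a"
    by (auto simp: reflections_below_def)
  have le: "rk (transpose a b) p q \<le> rk id p q + (if a < p \<and> p \<le> b \<and> a < q \<and> q \<le> b then 1 else 0)"
    using rk_comp_transpose_le[of a b id p q] ij by (simp add: id_def comp_def)
  show "rk (transpose a b) p q \<le> rk w p q"
  proof (cases "a < p \<and> p \<le> b \<and> a < q \<and> q \<le> b")
    case True
    have "0 < rk w p q" unfolding rk_pos using ij True by (intro exI[of _ i]) auto
    moreover have "0 < rk (inv w) q p"
      unfolding rk_pos using ij True inv_apply(1)[OF w, of j] by (intro exI[of _ "w j"]) auto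
    moreover have "rk (inv w) q p + p = rk w p q + q" by (rule rk_inv[OF w])
    ultimately have "p - q + 1 \<le> rk w p q" by linarith
    then show ?thesis using le True rk_id[of p q] by simp
  next
    case False
    then have "rk (transpose a b) p q \<le> rk id p q" using le by (simp only: if_False add_0_right)
    also have "\<dots> \<le> rk w p q" by (rule rleD[OF rle_id[OF w]])
    finally show ?thesis .
  qed
qed

lemma rle_antisym:
  assumes "rle x y" "rle y x"
  shows "x = y"
proof
  fix p
  have "rk x p' q = rk y p' q" for p' q using assms rleD by (simp add: eq_iff)
  then have "rk x p q + (if q \<le> x p then 1 else 0) = rk x p q + (if q \<le> y p then 1 else 0)" for q
    using rk_Suc[of x p q] rk_Suc[of y p q] by metis
  then have "q \<le> x p \<longleftrightarrow> q \<le> y p" for q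
    by (metis add_left_cancel zero_neq_one)
  then show "x p = y p" by (meson eq_iff)
qed

lemma vertex_transitive_iff:
  "vertex_transitive V E \<longleftrightarrow> (\<forall>x\<in>V. \<forall>y\<in>V. \<exists>\<sigma>. automorphism V E \<sigma> \<and> \<sigma> x = y)"
  unfolding vertex_transitive_def automorphism_def by blast

lemma vertex_transitive_degree:
  assumes "vertex_transitive V E" "x \<in> V" "y \<in> V"
  shows "card {z \<in> V. E x z} = card {z \<in> V. E y z}"
proof -
  obtain \<sigma> where s: "bij_betw \<sigma> V V" "\<forall>a\<in>V. \<forall>b\<in>V. E a b \<longleftrightarrow> E (\<sigma> a) (\<sigma> b)" "\<sigma> x = y"
    using assms unfolding vertex_transitive_def by blast
  have "\<sigma> ` {z \<in> V. E x z} = {z \<in> V. E y z}"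
  proof
    show "\<sigma> ` {z \<in> V. E x z} \<subseteq> {z \<in> V. E y z}"
      using s assms by (auto simp: bij_betw_apply)
    show "{z \<in> V. E y z} \<subseteq> \<sigma> ` {z \<in> V. E x z}"
    proof
      fix z assume z: "z \<in> {z \<in> V. E y z}"
      then obtain z' where "z' \<in> V" "z = \<sigma> z'" using s(1) by (auto simp: bij_betw_def)
      then show "z \<in> \<sigma> ` {z \<in> V. E x z}" using z s(2,3) assms(2) by auto
    qed
  qed
  moreover have "inj_on \<sigma> {z \<in> V. E x z}"
    by (rule inj_on_subset[OF bij_betw_imp_inj_on[OF s(1)]]) simp
  ultimately show ?thesis by (metis card_image)
qed

lemma finite_below: "finite S \<Longrightarrow> finite (below S w)"
  by (rule finite_subset[OF _ finite_permutations[of S]]) (auto simp: below_def)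

lemma transpose_inject:
  assumes "transpose a b = transpose c d" "a < b" "c < (d::nat)"
  shows "a = c \<and> b = d"
proof -
  have "transpose c d a = b" using fun_cong[OF assms(1), of a] by simp
  then have "(a \<noteq> c \<and> a \<noteq> d \<and> b = a) \<or> (a = c \<and> b = d) \<or> (a = d \<and> b = c)"
    by (simp only: transpose_eq_iff)
  then show ?thesis using assms(2,3) by linarith
qed

text \<open>Transitivity equates the degrees of \<open>id\<close> and \<open>w\<close>. The pairs of
  the criterion give distinct neighbours of \<open>id\<close>, and each neighbour of
  \<open>w\<close> comes from an inversion, because any other transposition leads upwards and out of
  the interval.\<close>

lemma card_reflections_below_le:
  assumes w: "w permutes {l..u}" and vt: "vertex_transitive (below {l..u} w) adj"
  shows "card (reflections_below w) \<le> card (Inv w)"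
proof -
  let ?V = "below {l..u} w"
  have wV: "w \<in> ?V" using w by (simp add: below_def rle_refl)
  have idV: "id \<in> ?V" using w by (simp add: below_def permutes_id rle_id permutes_bij)
  have "card (reflections_below w) \<le> card {z \<in> ?V. adj id z}"
  proof (rule card_inj_on_le[where f = "\<lambda>(a, b). transpose a b"])
    show "inj_on (\<lambda>(a, b). transpose a b) (reflections_below w)"
      by (rule inj_onI) (auto simp: reflections_below_def dest: transpose_inject)
    show "(\<lambda>(a, b). transpose a b) ` reflections_below w \<subseteq> {z \<in> ?V. adj id z}"
    proof clarify
      fix a b assume ab: "(a, b) \<in> reflections_below w"
      then have "a \<in> {l..u}" "b \<in> {l..u}" using reflections_below_subset[OF w] by blast+
      then have "transpose a b permutes {l..u}" by (rule permutes_swap_id)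
      moreover have "rle (transpose a b) w" by (rule rle_transpose_reflection[OF permutes_bij[OF w] ab])
      moreover have "adj id (transpose a b)"
        unfolding adj_def using ab by (intro exI[of _ a] exI[of _ b]) (auto simp: reflections_below_def)
      ultimately show "transpose a b \<in> ?V \<and> adj id (transpose a b)" by (simp add: below_def)
    qed
  qed (simp add: finite_below)
  also have "\<dots> = card {z \<in> ?V. adj w z}" by (rule vertex_transitive_degree[OF vt idV wV])
  also have "\<dots> \<le> card (Inv w)"
  proof (rule surj_card_le[OF finite_Inv[OF w]])
    show "{z \<in> ?V. adj w z} \<subseteq> (\<lambda>(a, b). w \<circ> transpose a b) ` Inv w"
    proof clarify
      fix z assume "z \<in> ?V" "adj w z"
      then obtain a b where "a \<noteq> b" "z = w \<circ> transpose a b" "rle z w" by (auto simp: below_def adj_def)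
      then obtain a b where ab: "a < b" "z = w \<circ> transpose a b" "rle z w"
        by (metis linorder_neqE_nat transpose_commute)
      have "w b < w a"
      proof (rule ccontr)
        assume "\<not> w b < w a"
        moreover have "w a \<noteq> w b" using ab permutes_inj[OF w] by (auto simp: inj_eq)
        ultimately have "w a < w b" by simp
        then have "rle w z" unfolding ab(2) by (rule rle_transpose[OF ab(1)])
        then have "w = z" using ab(3) by (rule rle_antisym)
        then have "w a = w b" using ab(2) by (metis comp_apply transpose_apply_first)
        then show False using \<open>w a \<noteq> w b\<close> by simp
      qed
      then show "z \<in> (\<lambda>(a, b). w \<circ> transpose a b) ` Inv w" using ab by (auto simp: Inv_def)
    qed
  qed
  finally show ?thesis .
qed



section \<open>Deleting the largest value\<close>

definition delete_max :: "nat \<Rightarrow> (nat \<Rightarrow> nat) \<Rightarrow> nat \<Rightarrow> nat" where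
  "delete_max n w = (\<lambda>i. if i < inv w n then w i else if i < n then w (Suc i) else i)"

context
  fixes n k :: nat and w w' :: "nat \<Rightarrow> nat" and \<phi> :: "nat \<Rightarrow> nat"
  assumes w: "w permutes {1..Suc n}"
  defines "k \<equiv> inv w (Suc n)" and "w' \<equiv> delete_max (Suc n) w"
    and "\<phi> \<equiv> \<lambda>i. if i < k then i else Suc i"
begin

lemma value_at_max_position: "w k = Suc n"
  unfolding k_def by (rule inv_apply(2)[OF permutes_bij[OF w]])

lemma max_position_bounds: "1 \<le> k" "k \<le> Suc n"
  using permutes_ge[OF permutes_inv[OF w], of "Suc n"] permutes_le[OF permutes_inv[OF w], of "Suc n"]
  unfolding k_def by simp_all

lemma skip_less_iff: "\<phi> i < \<phi> j \<longleftrightarrow> i < j"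
  by (auto simp: \<phi>_def)

lemma skip_ne: "\<phi> i \<noteq> k"
  by (auto simp: \<phi>_def)

lemma skip_le: "i \<le> n \<Longrightarrow> \<phi> i \<le> Suc n"
  by (auto simp: \<phi>_def)

lemma deleted_eq: "i \<le> n \<Longrightarrow> w' i = w (\<phi> i)"
  unfolding w'_def delete_max_def \<phi>_def k_def[symmetric] by (simp add: less_Suc_eq_le)

lemma deleted_fixed: "n < i \<Longrightarrow> w' i = i"
  using max_position_bounds unfolding w'_def delete_max_def k_def[symmetric] by simp

lemma skip_surj:
  assumes "i \<le> Suc n" "i \<noteq> k"
  obtains i' where "i' \<le> n" "\<phi> i' = i" "w' i' = w i"
proof (cases "i < k")
  case True
  then have "i \<le> n" "\<phi> i = i" using max_position_bounds by (auto simp: \<phi>_def)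
  then show ?thesis using that deleted_eq by metis
next
  case False
  then obtain i' where i': "i = Suc i'" "k \<le> i'" using assms by (cases i) auto
  then have "i' \<le> n" "\<phi> i' = i" using assms by (auto simp: \<phi>_def)
  then show ?thesis using that deleted_eq by metis
qed

lemma value_less_max: "i \<le> Suc n \<Longrightarrow> i \<noteq> k \<Longrightarrow> w i \<le> n"
  using permutes_le[OF w, of i] value_at_max_position inj_eq[OF permutes_inj[OF w], of i k] by auto

lemma deleted_permutes: "w' permutes {1..n}"
proof (rule inj_imp_permutes)
  show "inj_on w' {1..n}"
  proof (rule inj_onI)
    fix i j assume ij: "i \<in> {1..n}" "j \<in> {1..n}" "w' i = w' j"
    then have "\<phi> i = \<phi> j" using deleted_eq inj_eq[OF permutes_inj[OF w]] by simp
    then show "i = j" using skip_less_iff[of i j] skip_less_iff[of j i] by simp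
  qed
next
  fix i assume i: "i \<in> {1..n}"
  then have "1 \<le> \<phi> i" by (simp add: \<phi>_def)
  then have "1 \<le> w (\<phi> i)" using permutes_ge[OF w] by blast
  moreover have "w (\<phi> i) \<le> n" using i by (intro value_less_max skip_le skip_ne) simp
  ultimately show "w' i \<in> {1..n}" using deleted_eq i by simp
next
  fix i assume "i \<notin> {1..n}"
  then have "i = 0 \<or> n < i" by auto
  then show "w' i = i"
  proof
    assume "i = 0"
    then show ?thesis using deleted_eq[of 0] max_position_bounds permutes_lt_fixed[OF w, of 0] by (simp add: \<phi>_def)
  qed (rule deleted_fixed)
qed simp

text \<open>The maximum, at position \<open>k\<close>, is inverted only with the
  \<open>Suc n - k\<close> positions to its right.\<close>

lemma card_Inv_deleted: "card (Inv w) \<le> card (Inv w') + (Suc n - k)"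
proof -
  let ?A = "(\<lambda>(i, j). (\<phi> i, \<phi> j)) ` Inv w'" and ?B = "(\<lambda>j. (k, j)) ` {k<..Suc n}"
  have "Inv w \<subseteq> ?A \<union> ?B"
  proof
    fix ij assume "ij \<in> Inv w"
    then obtain i j where ij: "ij = (i, j)" "i < j" "w j < w i" by (auto simp: Inv_def)
    have b: "i \<le> Suc n" "j \<le> Suc n" using inversion_in_support[OF w ij(2,3)] by auto
    have "w i \<le> Suc n" using permutes_le[OF w] b by blast
    then have "j \<noteq> k" using value_at_max_position ij(3) by auto
    show "ij \<in> ?A \<union> ?B"
    proof (cases "i = k")
      case True
      then show ?thesis using ij b by auto
    next
      case False
      obtain i' where i': "\<phi> i' = i" "w' i' = w i" using skip_surj[OF b(1) False] by blast
      obtain j' where j': "\<phi> j' = j" "w' j' = w j" using skip_surj[OF b(2) \<open>j \<noteq> k\<close>] by blast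
      have "(i', j') \<in> Inv w'" using i' j' ij skip_less_iff[of i' j'] by (simp add: Inv_def)
      then have "(\<phi> i', \<phi> j') \<in> ?A" by force
      then show ?thesis using i' j' ij by simp
    qed
  qed
  moreover have fin: "finite (Inv w')" by (rule finite_Inv[OF deleted_permutes])
  ultimately have "card (Inv w) \<le> card (?A \<union> ?B)" by (intro card_mono) auto
  also have "\<dots> \<le> card ?A + card ?B" by (rule card_Un_le)
  also have "\<dots> \<le> card (Inv w') + card {k<..Suc n}"
    using fin by (intro add_mono card_image_le) auto
  finally show ?thesis by simp
qed

lemma deleted_reflections_subset: "reflections_below w' \<subseteq> reflections_below w"
proof
  fix ab assume ab: "ab \<in> reflections_below w'"
  then obtain a b i j where *: "ab = (a, b)" "a < b" "i \<le> a" "b \<le> w' i" "b \<le> j" "w' j \<le> a"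
    by (auto simp: reflections_below_def)
  have b: "b \<le> n" using reflections_below_subset[OF deleted_permutes] ab *(1) by auto
  have "\<exists>i\<le>a. b \<le> w i"
  proof (cases "k \<le> a")
    case True
    then show ?thesis using value_at_max_position b by (intro exI[of _ k]) simp
  next
    case False
    then show ?thesis using * deleted_eq[of i] b by (intro exI[of _ i]) (simp add: \<phi>_def)
  qed
  moreover have "\<exists>j\<ge>b. w j \<le> a"
  proof -
    have "j \<le> n" using * deleted_fixed[of j] by (cases "n < j") auto
    moreover have "j \<le> \<phi> j" by (simp add: \<phi>_def)
    ultimately show ?thesis using * deleted_eq[of j] by (intro exI[of _ "\<phi> j"]) simp
  qed
  ultimately show "ab \<in> reflections_below w" using * by (simp add: reflections_below_def)
qed

text \<open>These are as many new reflections as the maximum has inversions, which balances the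
  induction. The entry leading back is the one at position \<open>Suc n\<close>; the assumption
  \<open>w (Suc n) \<le> k\<close> holds for \<open>w\<close> or for its inverse.\<close>

lemma max_reflections:
  assumes "w (Suc n) \<le> k"
  shows "(\<lambda>a. (a, Suc n)) ` {k..n} \<subseteq> reflections_below w - reflections_below w'"
proof -
  have "(a, Suc n) \<in> reflections_below w - reflections_below w'" if "a \<in> {k..n}" for a
  proof -
    have "\<exists>i\<le>a. Suc n \<le> w i" using that value_at_max_position by (intro exI[of _ k]) simp
    moreover have "\<exists>j\<ge>Suc n. w j \<le> a" using that assms by (intro exI[of _ "Suc n"]) simp
    moreover have "(a, Suc n) \<notin> reflections_below w'"
      using reflections_below_subset[OF deleted_permutes] by auto
    ultimately show ?thesis using that by (simp add: reflections_below_def)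
  qed
  then show ?thesis by blast
qed

lemma card_reflections_deleted:
  assumes "w (Suc n) \<le> k"
  shows "card (reflections_below w') + (Suc n - k) \<le> card (reflections_below w)"
    "card (reflections_below w) = card (reflections_below w') + (Suc n - k) \<Longrightarrow>
      (a, b) \<in> reflections_below w \<Longrightarrow> b \<le> n \<Longrightarrow> (a, b) \<in> reflections_below w'"
proof -
  let ?F = "(\<lambda>a. (a, Suc n)) ` {k..n}"
  have fin: "finite (reflections_below w)"
    by (rule finite_subset[OF reflections_below_subset[OF w]]) simp
  then have fin': "finite (reflections_below w')"
    using deleted_reflections_subset finite_subset by blast
  have "card ?F = Suc n - k" by (subst card_image) (auto simp: inj_on_def)
  moreover have "card (reflections_below w' \<union> ?F) = card (reflections_below w') + card ?F"
    using max_reflections[OF assms] fin' by (intro card_Un_disjoint) auto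
  ultimately have c: "card (reflections_below w' \<union> ?F) = card (reflections_below w') + (Suc n - k)"
    by simp
  have sub: "reflections_below w' \<union> ?F \<subseteq> reflections_below w"
    using max_reflections[OF assms] deleted_reflections_subset by blast
  show "card (reflections_below w') + (Suc n - k) \<le> card (reflections_below w)"
    using card_mono[OF fin sub] c by simp
  assume "card (reflections_below w) = card (reflections_below w') + (Suc n - k)"
  then have "reflections_below w' \<union> ?F = reflections_below w"
    using card_subset_eq[OF fin sub] c by simp
  then show "(a, b) \<in> reflections_below w \<Longrightarrow> b \<le> n \<Longrightarrow> (a, b) \<in> reflections_below w'"
    by auto
qed

lemma deleted_3412:
  assumes "\<not> has_3412 w'" "a < b" "b < c" "c < d" "k \<notin> {a, b, c, d}" "w c < w d" "w d < w a" "w a < w b"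
  shows False
proof -
  have "d \<le> Suc n" using inversion_in_support[OF w, of a d] assms by linarith
  then have le: "a \<le> Suc n" "b \<le> Suc n" "c \<le> Suc n" using assms by linarith+
  from assms(5) have ne: "a \<noteq> k" "b \<noteq> k" "c \<noteq> k" "d \<noteq> k" by auto
  obtain a' where a: "\<phi> a' = a" "w' a' = w a" using skip_surj[OF le(1) ne(1)] by blast
  obtain b' where b: "\<phi> b' = b" "w' b' = w b" using skip_surj[OF le(2) ne(2)] by blast
  obtain c' where c: "\<phi> c' = c" "w' c' = w c" using skip_surj[OF le(3) ne(3)] by blast
  obtain d' where d: "\<phi> d' = d" "w' d' = w d" using skip_surj[OF \<open>d \<le> Suc n\<close> ne(4)] by blast
  have "a' < b'" "b' < c'" "c' < d'"
    using assms(2-4) skip_less_iff[of a' b'] skip_less_iff[of b' c'] skip_less_iff[of c' d'] a b c d by simp_all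
  then have "has_3412 w'" using assms a b c d by (intro has_3412I[of a' b' c' d']) simp_all
  then show False using assms(1) by simp
qed

lemma deleted_4231:
  assumes "\<not> has_4231 w'" "a < b" "b < c" "c < d" "k \<notin> {a, b, c, d}" "w d < w b" "w b < w c" "w c < w a"
  shows False
proof -
  have "d \<le> Suc n" using inversion_in_support[OF w, of b d] assms by linarith
  then have le: "a \<le> Suc n" "b \<le> Suc n" "c \<le> Suc n" using assms by linarith+
  from assms(5) have ne: "a \<noteq> k" "b \<noteq> k" "c \<noteq> k" "d \<noteq> k" by auto
  obtain a' where a: "\<phi> a' = a" "w' a' = w a" using skip_surj[OF le(1) ne(1)] by blast
  obtain b' where b: "\<phi> b' = b" "w' b' = w b" using skip_surj[OF le(2) ne(2)] by blast
  obtain c' where c: "\<phi> c' = c" "w' c' = w c" using skip_surj[OF le(3) ne(3)] by blast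
  obtain d' where d: "\<phi> d' = d" "w' d' = w d" using skip_surj[OF \<open>d \<le> Suc n\<close> ne(4)] by blast
  have "a' < b'" "b' < c'" "c' < d'"
    using assms(2-4) skip_less_iff[of a' b'] skip_less_iff[of b' c'] skip_less_iff[of c' d'] a b c d by simp_all
  then have "has_4231 w'" using assms a b c d by (intro has_4231I[of a' b' c' d']) simp_all
  then show False using assms(1) by simp
qed

text \<open>The hypothesis \<open>refl\<close> encodes the case of equality: no reflection with
  \<open>b \<le> n\<close> is lost by the deletion. A pattern that uses the maximum is rebuilt with
  the next value \<open>n\<close>, found at position \<open>s\<close>; the loss-free reflections
  show that \<open>s\<close> is suitably placed or lead to a counting contradiction.\<close>

lemma smooth_if_deleted_smooth:
  assumes m: "w (Suc n) \<le> k" and no: "\<not> has_3412 w'" "\<not> has_4231 w'"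
    and refl: "\<And>a b. (a, b) \<in> reflections_below w \<Longrightarrow> b \<le> n \<Longrightarrow> (a, b) \<in> reflections_below w'"
  shows "\<not> has_3412 w \<and> \<not> has_4231 w"
proof -
  note inj = inj_eq[OF permutes_inj[OF w]]
  define s where "s = inv w n"
  have ws: "w s = n" unfolding s_def by (rule inv_apply(2)[OF permutes_bij[OF w]])
  have "s \<noteq> k" using ws value_at_max_position by auto
  \<comment> \<open>The reflection \<open>(k, n)\<close> survives in \<open>w'\<close> only if the
    value \<open>n\<close> is among the entries of \<open>w'\<close> up to position
    \<open>k\<close>, that is, up to position \<open>k + 1\<close> in \<open>w\<close>.\<close>
  have s_le: "s \<le> Suc k" if "k < n"
  proof -
    have "(k, n) \<in> reflections_below w"
      using that value_at_max_position m by (auto simp: reflections_below_def intro: exI[of _ k] exI[of _ "Suc n"])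
    then have "(k, n) \<in> reflections_below w'" by (rule refl) simp
    then obtain i where i: "i \<le> k" "n \<le> w' i" by (auto simp: reflections_below_def)
    then have "n \<le> w (\<phi> i)" using that deleted_eq[of i] by simp
    moreover have "w (\<phi> i) \<le> n" using i that by (intro value_less_max skip_le skip_ne) simp
    ultimately have "w (\<phi> i) = w s" using ws by simp
    then have "\<phi> i = s" using inj by simp
    moreover have "\<phi> i \<le> Suc i" by (simp add: \<phi>_def)
    ultimately show ?thesis using i by simp
  qed
  have no_4231: False
    if "a < b" "b < c" "c < d" "w d < w b" "w b < w c" "w c < w a" for a b c d
  proof (cases "k \<in> {a, b, c, d}")
    case False
    then show False using deleted_4231[OF no(2) that(1-3) _ that(4-6)] by blast
  next
    case True
    have "d \<le> Suc n" using inversion_in_support[OF w, of b d] that by linarith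
    moreover have "w a \<le> Suc n" using permutes_le[OF w, of a] that \<open>d \<le> Suc n\<close> by simp
    ultimately have "a = k" using True value_at_max_position that by auto
    then have "s \<le> Suc k" using s_le that \<open>d \<le> Suc n\<close> by simp
    have "w c \<le> n" using that \<open>w a \<le> Suc n\<close> by simp
    then have "s \<noteq> b" "s \<noteq> c" using ws that \<open>s \<le> Suc k\<close> \<open>a = k\<close> by auto
    then have "s < b" using \<open>s \<le> Suc k\<close> \<open>a = k\<close> that \<open>s \<noteq> k\<close> by simp
    have "w c \<noteq> w s" using inj \<open>s \<noteq> c\<close> by simp
    then have "w c < w s" using ws \<open>w c \<le> n\<close> by simp
    \<comment> \<open>The value \<open>n\<close> at \<open>s\<close> replaces the maximum in the
      role of the 4.\<close>
    show False
      by (rule deleted_4231[OF no(2) \<open>s < b\<close> that(2,3) _ that(4,5) \<open>w c < w s\<close>])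
        (use that \<open>a = k\<close> \<open>s \<noteq> k\<close> in auto)
  qed
  have no_3412: False
    if p: "a < b" "b < c" "c < d" "w c < w d" "w d < w a" "w a < w b" for a b c d
  proof (cases "k \<in> {a, b, c, d}")
    case False
    then show False using deleted_3412[OF no(1) p(1-3) _ p(4-6)] by blast
  next
    case True
    have d: "d \<le> Suc n" using inversion_in_support[OF w, of a d] p by linarith
    moreover have wb: "w b \<le> Suc n" using permutes_le[OF w, of b] p d by simp
    ultimately have "b = k" using True value_at_max_position p by auto
    then have sk: "s \<le> Suc k" using s_le p d by simp
    have "w a \<le> n" using p wb by simp
    have "s \<noteq> c" using ws p \<open>w a \<le> n\<close> by auto
    then have "s < c" using sk \<open>b = k\<close> p by simp
    show False
    \<comment> \<open>To the right of \<open>a\<close>, the value \<open>n\<close> can replace the 4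
      of 3412. Otherwise the contradiction is numerical: \<open>w (Suc n) \<le> s\<close> holds as
      well as \<open>s < w (Suc n)\<close>.\<close>
    proof (cases "a < s")
      case True
      have "w a \<noteq> w s" using True inj by simp
      then have "w a < w s" using ws \<open>w a \<le> n\<close> by simp
      then show False
        using deleted_3412[OF no(1) True \<open>s < c\<close> p(3) _ p(4,5)] \<open>s \<noteq> k\<close> \<open>b = k\<close> p by auto
    next
      case False
      then have "s < k" using p \<open>b = k\<close> by simp
      have wd: "w d < w s" using p \<open>w a \<le> n\<close> ws by simp
      have "c < Suc n" using p d by simp
      have mc: "w c < w (Suc n)"
      proof (rule ccontr)
        assume "\<not> w c < w (Suc n)"
        moreover have "w c \<noteq> w (Suc n)" using \<open>c < Suc n\<close> inj by simp
        ultimately have lt: "w (Suc n) < w c" by simp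
        then have "d \<noteq> Suc n" using p by auto
        then have "d < Suc n" using d by simp
        then show False
          using deleted_4231[OF no(2) \<open>s < c\<close> p(3) _ _ lt p(4) wd] \<open>s \<noteq> k\<close> \<open>b = k\<close> p by auto
      qed
      have ms: "w (Suc n) \<le> s"
      proof (rule ccontr)
        assume "\<not> w (Suc n) \<le> s"
        then have sm: "s < w (Suc n)" by simp
        then obtain e where e: "w (Suc n) = Suc e" by (cases "w (Suc n)") auto
        define B where "B = {i. i \<le> n \<and> w i \<le> e}"
        have "c \<in> B" using mc e \<open>c < Suc n\<close> by (simp add: B_def)
        have fin: "finite B" by (simp add: B_def)
        define b' where "b' = Max B"
        have "b' \<in> B" unfolding b'_def using fin \<open>c \<in> B\<close> by (intro Max_in) auto
        then have b': "b' \<le> n" "w b' \<le> e" by (simp_all add: B_def)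
        have "c \<le> b'" unfolding b'_def using fin \<open>c \<in> B\<close> by simp
        then have "k < b'" "e < b'" using p \<open>b = k\<close> m e by simp_all
        \<comment> \<open>Here \<open>b'\<close> is the last position up to \<open>n\<close> with a
          value at most \<open>e\<close>. Deletion would lose this reflection: entries past
          \<open>k\<close> move one place to the left, so \<open>w'\<close> has no value at most
          \<open>e\<close> from \<open>b'\<close> on. The entry at \<open>Suc n\<close> does not
          help, its value being \<open>e + 1\<close>.\<close>
        have "(e, b') \<in> reflections_below w"
          using \<open>e < b'\<close> b' ws sm e
          by (auto simp: reflections_below_def intro: exI[of _ s] exI[of _ b'])
        then have "(e, b') \<in> reflections_below w'" using b'(1) by (rule refl)
        then obtain j where j: "b' \<le> j" "w' j \<le> e" by (auto simp: reflections_below_def)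
        have "j \<le> n" using j deleted_fixed[of j] \<open>e < b'\<close> by (cases "n < j") auto
        have "\<phi> j = Suc j" using j \<open>k < b'\<close> by (simp add: \<phi>_def)
        then have wj: "w (Suc j) \<le> e" using j deleted_eq[OF \<open>j \<le> n\<close>] by simp
        then have "Suc j \<noteq> Suc n" using e by auto
        then have "Suc j \<in> B" using wj \<open>j \<le> n\<close> by (simp add: B_def)
        then have "Suc j \<le> b'" unfolding b'_def using fin by simp
        then show False using j by simp
      qed
      \<comment> \<open>Otherwise \<open>x, s, c, Suc n\<close> is a 3412 without the maximum. Hence
        the \<open>s - 1\<close> entries before \<open>s\<close> lie below \<open>w (Suc n)\<close>
        and differ from \<open>w c\<close>, which gives \<open>s < w (Suc n)\<close>.\<close>
      have "w x < w (Suc n)" if "1 \<le> x" "x < s" for x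
      proof (rule ccontr)
        assume "\<not> w x < w (Suc n)"
        moreover have "w x \<noteq> w (Suc n)" using inj that \<open>s < k\<close> max_position_bounds by simp
        ultimately have lt: "w (Suc n) < w x" by simp
        have "w x \<le> n" using that \<open>s < k\<close> max_position_bounds by (intro value_less_max) auto
        moreover have "w x \<noteq> w s" using inj that by simp
        ultimately have "w x < w s" using ws by simp
        then show False
          using deleted_3412[OF no(1) that(2) \<open>s < c\<close> \<open>c < Suc n\<close> _ mc lt]
            \<open>s \<noteq> k\<close> \<open>b = k\<close> p that \<open>s < k\<close> \<open>c < Suc n\<close> by auto
      qed
      moreover have "1 \<le> w x" if "1 \<le> x" for x using permutes_ge[OF w] that by blast
      moreover have "w x \<noteq> w c" if "x < s" for x using inj that \<open>s < c\<close> by simp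
      ultimately have "w ` {1..<s} \<subseteq> {1..<w (Suc n)} - {w c}" by fastforce
      then have "card (w ` {1..<s}) \<le> card ({1..<w (Suc n)} - {w c})" by (intro card_mono) auto
      moreover have "card (w ` {1..<s}) = s - 1"
        using inj by (simp add: card_image inj_on_def)
      moreover have wc: "w c \<in> {1..<w (Suc n)}" using permutes_ge[OF w, of c] mc p by auto
      ultimately have "s - 1 \<le> w (Suc n) - 1 - 1" by simp
      moreover have "2 \<le> w (Suc n)" using wc by simp
      moreover have "1 \<le> s"
      proof (rule ccontr)
        assume "\<not> 1 \<le> s"
        then have "s = 0" by simp
        then have "w (Suc n) = 0" using ms by simp
        then show False using mc by simp
      qed
      ultimately show False using ms by linarith
    qed
  qed
  show ?thesis using no_3412 no_4231 unfolding has_3412_def has_4231_def by blast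
qed

end

text \<open>Deleting the maximum at \<open>k\<close> costs at most \<open>Suc n - k\<close>
  inversions and at least as many reflections. So the inequality is inherited, and equality for
  \<open>w\<close> forces equality in both estimates and for the shorter permutation. Inversion
  exchanges \<open>k\<close> with \<open>w (Suc n)\<close> and preserves both counts.\<close>

lemma inversions_le_reflections:
  assumes "w permutes {1..n}"
  shows "card (Inv w) \<le> card (reflections_below w) \<and>
    (card (Inv w) = card (reflections_below w) \<longrightarrow> \<not> has_3412 w \<and> \<not> has_4231 w)"
  using assms
proof (induction n arbitrary: w)
  case 0
  then have "w = id" by simp
  moreover have "Inv id = {}" by (auto simp: Inv_def)
  moreover have "\<not> has_3412 id" "\<not> has_4231 id" by (auto simp: has_3412_def has_4231_def)
  ultimately show ?case by (simp only: card.empty) simp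
next
  case (Suc n)
  have main: "card (Inv w) \<le> card (reflections_below w) \<and>
      (card (Inv w) = card (reflections_below w) \<longrightarrow> \<not> has_3412 w \<and> \<not> has_4231 w)"
    if w: "w permutes {1..Suc n}" and m: "w (Suc n) \<le> inv w (Suc n)" for w
  proof -
    let ?w = "delete_max (Suc n) w"
    note IH = Suc.IH[OF deleted_permutes[OF w]]
    note c = card_Inv_deleted[OF w] card_reflections_deleted(1)[OF w m]
    have "\<not> has_3412 w \<and> \<not> has_4231 w" if eq: "card (Inv w) = card (reflections_below w)"
    proof (rule smooth_if_deleted_smooth[OF w m])
      have e: "card (Inv ?w) = card (reflections_below ?w)"
        "card (reflections_below w) = card (reflections_below ?w) + (Suc n - inv w (Suc n))"
        using IH c eq by linarith+
      show "\<not> has_3412 ?w" "\<not> has_4231 ?w" using IH e(1) by blast+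
      show "\<And>a b. (a, b) \<in> reflections_below w \<Longrightarrow> b \<le> n \<Longrightarrow> (a, b) \<in> reflections_below ?w"
        by (rule card_reflections_deleted(2)[OF w m e(2)])
    qed
    then show ?thesis using IH c by linarith
  qed
  show ?case
  proof (cases "w (Suc n) \<le> inv w (Suc n)")
    case True
    then show ?thesis by (rule main[OF Suc.prems])
  next
    case False
    note b = permutes_bij[OF Suc.prems]
    have "inv w (Suc n) \<le> inv (inv w) (Suc n)" using False by (simp add: inv_inv_eq[OF b])
    from main[OF permutes_inv[OF Suc.prems] this] show ?thesis
      by (simp add: card_Inv_inv[OF b] reflections_below_inv[OF b] has_inv[OF b])
  qed
qed


section \<open>Common neighbours\<close>


definition three_common :: "'a set \<Rightarrow> ('a \<Rightarrow> 'a \<Rightarrow> bool) \<Rightarrow> 'a set \<Rightarrow> bool" where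
  "three_common V E A \<longleftrightarrow> (\<exists>Z\<subseteq>V. card Z = 3 \<and> (\<forall>y\<in>A. \<forall>z\<in>Z. E y z))"

text \<open>One edge \<open>y\<close> at \<open>x\<close> belongs to three triples, and edges of
  different triples other than \<open>y\<close> are unrelated. Only adjacency is mentioned, so
  automorphisms preserve the property. Three is the number of letters 3, 4, 5 in the pattern, and
  the least number for which two of the corresponding points at \<open>id\<close> must lie on the
  same side of a given one.\<close>

definition triple_fan :: "'a set \<Rightarrow> ('a \<Rightarrow> 'a \<Rightarrow> bool) \<Rightarrow> 'a \<Rightarrow> bool" where
  "triple_fan V E x \<longleftrightarrow> (\<exists>y f g. y \<in> V \<and> E x y \<and>
     (\<forall>i<3::nat. f i \<in> V \<and> g i \<in> V \<and> E x (f i) \<and> E x (g i) \<and>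
        y \<noteq> f i \<and> y \<noteq> g i \<and> f i \<noteq> g i \<and> three_common V E {y, f i, g i}) \<and>
     (\<forall>i<3. \<forall>j<3. i \<noteq> j \<longrightarrow> \<not> three_common V E {f i, f j} \<and> \<not> three_common V E {g i, g j} \<and>
        \<not> three_common V E {f i, g j}))"

lemma three_common_automorphism:
  assumes s: "automorphism V E \<sigma>" and "A \<subseteq> V" and "three_common V E A"
  shows "three_common V E (\<sigma> ` A)"
proof -
  obtain Z where Z: "Z \<subseteq> V" "card Z = 3" "\<forall>y\<in>A. \<forall>z\<in>Z. E y z"
    using assms(3) unfolding three_common_def by blast
  have b: "bij_betw \<sigma> V V" and e: "\<And>a b. a \<in> V \<Longrightarrow> b \<in> V \<Longrightarrow> E a b \<Longrightarrow> E (\<sigma> a) (\<sigma> b)"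
    using s by (auto simp: automorphism_def)
  have "\<sigma> ` Z \<subseteq> V" using b Z(1) by (auto simp: bij_betw_def)
  moreover have "card (\<sigma> ` Z) = 3"
    using Z b by (metis bij_betw_def card_image inj_on_subset)
  moreover have "\<forall>y\<in>\<sigma> ` A. \<forall>z\<in>\<sigma> ` Z. E y z"
    using Z assms(2) e by blast
  ultimately show ?thesis unfolding three_common_def by blast
qed

text \<open>The fan contains negated conditions, so preservation in one direction is not
  enough.\<close>

lemma three_common_automorphism_iff:
  assumes s: "automorphism V E \<sigma>" and A: "A \<subseteq> V"
  shows "three_common V E (\<sigma> ` A) = three_common V E A"
proof
  have b: "bij_betw \<sigma> V V" using s by (simp add: automorphism_def)
  assume "three_common V E (\<sigma> ` A)"
  moreover have "\<sigma> ` A \<subseteq> V" using A b by (auto simp: bij_betw_def)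
  ultimately have "three_common V E (inv_into V \<sigma> ` \<sigma> ` A)"
    using three_common_automorphism[OF automorphism_inv_into[OF s]] by blast
  moreover have "inv_into V \<sigma> ` \<sigma> ` A = A"
    using A b by (simp add: bij_betw_def inv_into_image_cancel)
  ultimately show "three_common V E A" by simp
qed (rule three_common_automorphism[OF assms])

lemma triple_fan_automorphism:
  assumes s: "automorphism V E \<sigma>" and x: "x \<in> V" and "triple_fan V E x"
  shows "triple_fan V E (\<sigma> x)"
proof -
  obtain y f g where y: "y \<in> V" "E x y"
    and f: "\<And>i::nat. i < 3 \<Longrightarrow> f i \<in> V \<and> g i \<in> V \<and> E x (f i) \<and> E x (g i) \<and>
        y \<noteq> f i \<and> y \<noteq> g i \<and> f i \<noteq> g i \<and> three_common V E {y, f i, g i}"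
    and no: "\<And>i j::nat. i < 3 \<Longrightarrow> j < 3 \<Longrightarrow> i \<noteq> j \<Longrightarrow> \<not> three_common V E {f i, f j} \<and>
        \<not> three_common V E {g i, g j} \<and> \<not> three_common V E {f i, g j}"
    using assms(3) unfolding triple_fan_def by blast
  have b: "bij_betw \<sigma> V V" and e: "\<And>a b. a \<in> V \<Longrightarrow> b \<in> V \<Longrightarrow> E a b \<Longrightarrow> E (\<sigma> a) (\<sigma> b)"
    using s by (auto simp: automorphism_def)
  have sV: "\<And>a. a \<in> V \<Longrightarrow> \<sigma> a \<in> V" using b by (rule bij_betw_apply)
  have inj: "\<And>a b. a \<in> V \<Longrightarrow> b \<in> V \<Longrightarrow> a \<noteq> b \<Longrightarrow> \<sigma> a \<noteq> \<sigma> b"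
    using b by (auto simp: bij_betw_def inj_on_def)
  have pair: "three_common V E {\<sigma> a, \<sigma> b} = three_common V E {a, b}" if "a \<in> V" "b \<in> V" for a b
    using three_common_automorphism_iff[OF s, of "{a, b}"] that by simp
  have triple: "three_common V E {\<sigma> a, \<sigma> b, \<sigma> c}" if "a \<in> V" "b \<in> V" "c \<in> V" "three_common V E {a, b, c}" for a b c
    using three_common_automorphism[OF s, of "{a, b, c}"] that by simp
  show ?thesis
    unfolding triple_fan_def
  proof (intro exI conjI allI impI)
    show "\<sigma> y \<in> V" "E (\<sigma> x) (\<sigma> y)" using y x e sV by auto
    fix i :: nat assume i: "i < 3"
    note fi = f[OF i]
    show "(\<sigma> \<circ> f) i \<in> V" "(\<sigma> \<circ> g) i \<in> V" "E (\<sigma> x) ((\<sigma> \<circ> f) i)" "E (\<sigma> x) ((\<sigma> \<circ> g) i)"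
      "\<sigma> y \<noteq> (\<sigma> \<circ> f) i" "\<sigma> y \<noteq> (\<sigma> \<circ> g) i" "(\<sigma> \<circ> f) i \<noteq> (\<sigma> \<circ> g) i"
      using fi x y e sV inj by simp_all
    show "three_common V E {\<sigma> y, (\<sigma> \<circ> f) i, (\<sigma> \<circ> g) i}" using fi y triple by simp
    fix j :: nat assume j: "j < 3" "i \<noteq> j"
    note fj = f[OF j(1)]
    show "\<not> three_common V E {(\<sigma> \<circ> f) i, (\<sigma> \<circ> f) j}" "\<not> three_common V E {(\<sigma> \<circ> g) i, (\<sigma> \<circ> g) j}"
      "\<not> three_common V E {(\<sigma> \<circ> f) i, (\<sigma> \<circ> g) j}"
      using no[OF i j] fi fj pair by simp_all
  qed
qed

section \<open>Products of two transpositions and common neighbours\<close>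

lemma three_cycles:
  fixes a b c :: nat
  assumes "a \<noteq> b" "b \<noteq> c" "a \<noteq> c"
  shows "transpose a b \<circ> transpose b c = transpose b c \<circ> transpose a c"
    "transpose a b \<circ> transpose b c = transpose a c \<circ> transpose a b"
    "transpose b c \<circ> transpose a b = transpose a b \<circ> transpose a c"
    "transpose b c \<circ> transpose a b = transpose a c \<circ> transpose b c"
  using assms by (auto simp: fun_eq_iff transpose_def)

lemma transpose_products_ne:
  fixes a b c :: nat
  assumes "a \<noteq> b" "b \<noteq> c" "a \<noteq> c"
  shows "transpose a b \<circ> transpose b c \<noteq> transpose b c \<circ> transpose a b"
proof
  assume "transpose a b \<circ> transpose b c = transpose b c \<circ> transpose a b"
  then have "transpose a b (transpose b c a) = transpose b c (transpose a b a)" by (metis comp_apply)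
  then show False using assms by simp
qed


lemma transpose_eq_transpose_cases:
  assumes "transpose p q i = j" "i \<noteq> j"
  shows "transpose p q = transpose i j"
  using assms by (auto simp: transpose_eq_iff transpose_commute)

lemma comp_left_cancel:
  assumes "bij x"
  shows "x \<circ> f = x \<circ> g \<longleftrightarrow> f = g"
proof
  assume "x \<circ> f = x \<circ> g"
  then have "x (f i) = x (g i)" for i by (metis comp_apply)
  then show "f = g" using assms by (simp add: fun_eq_iff bij_is_inj inj_eq)
qed simp

text \<open>Write \<open>t\<close>, \<open>t'\<close> for the left factors and \<open>r\<close>,
  \<open>r'\<close> for the right ones, so that \<open>r' = t' t r\<close>. If \<open>r\<close>
  moved a point fixed by \<open>t\<close> and \<open>t'\<close>, then \<open>r'\<close> would equal
  \<open>r\<close> and \<open>t\<close> would equal \<open>t'\<close>. So \<open>r\<close> lives on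
  the points of \<open>t\<close> and \<open>t'\<close>, and few cases remain.\<close>

lemma transposition_products:
  fixes a b c d p q p' q' :: nat
  assumes ne: "a \<noteq> b" "c \<noteq> d" "p \<noteq> q" and tt: "transpose a b \<noteq> transpose c d"
    and eq: "transpose a b \<circ> transpose p q = transpose c d \<circ> transpose p' q'"
  shows "transpose a b \<circ> transpose p q \<in>
    {id, transpose a b \<circ> transpose c d, transpose c d \<circ> transpose a b}"
proof -
  let ?t = "transpose a b" and ?t' = "transpose c d" and ?r = "transpose p q" and ?r' = "transpose p' q'"
  have ev: "?t (?r i) = ?t' (?r' i)" for i using fun_cong[OF eq, of i] by simp
  have r': "?r' i = ?t' (?t (?r i))" for i using ev[of i] by simp
  have "?r \<noteq> ?r'"
  proof
    assume "?r = ?r'"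
    then have "?t i = ?t' i" for i using ev[of "?r i"] by simp
    then show False using tt by auto
  qed
  have moved: "i \<in> {a, b, c, d}" if "i \<in> {p, q}" for i
  proof (rule ccontr)
    assume "i \<notin> {a, b, c, d}"
    moreover have "?r' (?r i) = ?t' (?t i)" using r'[of "?r i"] by simp
    ultimately have "?r' (?r i) = i" by simp
    moreover have "?r i \<noteq> i" using that ne(3) by auto
    ultimately have "?r' = transpose (?r i) i" by (intro transpose_eq_transpose_cases)
    then have "?r' = ?r" using that by (auto simp: transpose_commute)
    then show False using \<open>?r \<noteq> ?r'\<close> by simp
  qed
  have pq: "p \<in> {a, b, c, d}" "q \<in> {a, b, c, d}" using moved by auto
  show ?thesis
  proof (cases "{a, b} \<inter> {c, d} = {}")
    case True
    \<comment> \<open>For disjoint \<open>t\<close> and \<open>t'\<close>, a transposition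
      \<open>r\<close> joining them makes \<open>t' t r\<close> a four-cycle, which is not an
      involution.\<close>
    have mixed: False if i: "i \<in> {a, b}" "j \<in> {c, d}" "?r = transpose i j" for i j
    proof -
      have tt': "?t i \<in> {a, b}" "?t i \<noteq> i" "?t' j \<in> {c, d}" "?t' j \<noteq> j" using i ne by auto
      then have fix1: "?t j = j" "?t (?t' j) = ?t' j" "?t' i = i" "?t' (?t i) = ?t i" "i \<noteq> ?t' j"
        using i True by auto
      have "?r' i = ?t' j" using r'[of i] i(3) fix1 by simp
      moreover have "?r' (?t' j) = j"
        using r'[of "?t' j"] i(3) fix1 tt' by simp
      ultimately have "?r' (?r' i) = j" by simp
      then show False using i True by auto
    qed
    consider "p \<in> {a, b}" "q \<in> {a, b}" | "p \<in> {c, d}" "q \<in> {c, d}"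
      | "p \<in> {a, b}" "q \<in> {c, d}" | "q \<in> {a, b}" "p \<in> {c, d}" using pq by blast
    then show ?thesis
    proof cases
      case 1
      then have "?r = ?t" using ne by (auto simp: transpose_commute)
      then show ?thesis by simp
    next
      case 2
      then have "?r = ?t'" using ne by (auto simp: transpose_commute)
      then show ?thesis by simp
    next
      case 3
      then show ?thesis using mixed[of p q] by simp
    next
      case 4
      then show ?thesis using mixed[of q p] by (simp add: transpose_commute)
    qed
  next
    case False
    then obtain e where e: "e \<in> {a, b}" "e \<in> {c, d}" by auto
    define f h where "f = ?t e" and "h = ?t' e"
    have t: "?t = transpose e f" "f \<noteq> e" "{a, b} = {e, f}"
      using e(1) ne(1) by (auto simp: f_def transpose_commute)
    have t': "?t' = transpose e h" "h \<noteq> e" "{c, d} = {e, h}"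
      using e(2) ne(2) by (auto simp: h_def transpose_commute)
    have "f \<noteq> h" using tt t t' by auto
    have "p \<in> {e, f, h}" "q \<in> {e, f, h}" using pq t(3) t'(3) by auto
    then consider "?r = transpose e f" | "?r = transpose e h" | "?r = transpose f h"
      using ne(3) by (auto simp: transpose_commute)
    then show ?thesis
    proof cases
      case 1
      then show ?thesis using t by simp
    next
      case 2
      then show ?thesis using t t' by simp
    next
      case 3
      have "?t \<circ> ?r = ?t' \<circ> ?t"
        using three_cycles(3)[of f e h] t t' \<open>f \<noteq> h\<close> 3 by (simp add: transpose_commute)
      then show ?thesis by simp
    qed
  qed
qed

lemma common_neighbour_cases:
  fixes x :: "nat \<Rightarrow> nat"
  assumes x: "bij x" and ne: "a \<noteq> b" "c \<noteq> d" and tt: "transpose a b \<noteq> transpose c d"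
    and z: "adj (x \<circ> transpose a b) z" "adj (x \<circ> transpose c d) z"
  shows "z \<in> {x, x \<circ> (transpose a b \<circ> transpose c d), x \<circ> (transpose c d \<circ> transpose a b)}"
proof -
  let ?t = "transpose a b" and ?t' = "transpose c d"
  from z obtain p q p' q' where pq: "p \<noteq> q" "z = x \<circ> ?t \<circ> transpose p q"
    and pq': "z = x \<circ> ?t' \<circ> transpose p' q'" unfolding adj_def by blast
  then have "x \<circ> (?t \<circ> transpose p q) = x \<circ> (?t' \<circ> transpose p' q')" by (simp only: comp_assoc)
  then have "?t \<circ> transpose p q = ?t' \<circ> transpose p' q'" by (simp only: comp_left_cancel[OF x])
  from transposition_products[OF ne pq(1) tt this]
  show ?thesis unfolding pq(2) comp_assoc by (auto simp only: insert_iff empty_iff comp_id)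
qed

text \<open>There are only three candidates for a common neighbour. If three exist, all candidates
  are distinct, lie in \<open>V\<close> and are adjacent to every member of
  \<open>A\<close>.\<close>

lemma three_common_transposes:
  fixes x :: "nat \<Rightarrow> nat"
  assumes tc: "three_common V adj A" and A: "x \<circ> transpose a b \<in> A" "x \<circ> transpose c d \<in> A"
    and x: "bij x" and ne: "a \<noteq> b" "c \<noteq> d" and tt: "transpose a b \<noteq> transpose c d"
  defines "u \<equiv> transpose a b \<circ> transpose c d" and "v \<equiv> transpose c d \<circ> transpose a b"
  shows "u \<noteq> v" "x \<circ> u \<in> V" "x \<circ> v \<in> V" "y \<in> A \<Longrightarrow> adj y (x \<circ> u)" "y \<in> A \<Longrightarrow> adj y (x \<circ> v)"
proof -
  obtain Z where Z: "Z \<subseteq> V" "card Z = 3" "\<forall>y\<in>A. \<forall>z\<in>Z. adj y z"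
    using tc unfolding three_common_def by blast
  have "z \<in> {x, x \<circ> u, x \<circ> v}" if "z \<in> Z" for z
    unfolding u_def v_def by (rule common_neighbour_cases[OF x ne tt]) (use Z(3) A that in blast)+
  then have sub: "Z \<subseteq> {x, x \<circ> u, x \<circ> v}" by blast
  have "card {x, x \<circ> u, x \<circ> v} \<le> 3" by (simp add: card_insert_if)
  then have eq: "Z = {x, x \<circ> u, x \<circ> v}" using sub Z(2) by (intro card_seteq) auto
  show "u \<noteq> v"
  proof
    assume "u = v"
    then have "card Z \<le> 2" using eq by (simp add: card_insert_if)
    then show False using Z(2) by simp
  qed
  show "x \<circ> u \<in> V" "x \<circ> v \<in> V" "y \<in> A \<Longrightarrow> adj y (x \<circ> u)" "y \<in> A \<Longrightarrow> adj y (x \<circ> v)"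
    using Z(1,3) eq by blast+
qed

lemma transpose_commute_disjoint:
  assumes "{a, b} \<inter> {c, d} = {}"
  shows "transpose a b \<circ> transpose c d = transpose c d \<circ> transpose a b"
  using assms by (auto simp: fun_eq_iff transpose_def)

text \<open>Let \<open>y\<close> be the transposition of \<open>a\<close> and \<open>c\<close>. Then
  \<open>y z\<close> differs from \<open>z y\<close> and is adjacent to \<open>z'\<close> as well;
  among the candidates for a common neighbour of \<open>y\<close> and \<open>z'\<close> it can only
  be \<open>z' y\<close>, so \<open>z'\<close> is the conjugate of \<open>z\<close> by
  \<open>y\<close>. As \<open>z\<close> does not commute with \<open>y\<close>, it moves exactly one
  of \<open>a\<close> and \<open>c\<close>.\<close>

lemma triangle_at_id:
  fixes a c :: nat
  assumes tc: "three_common V adj {transpose a c, z, z'}" and ac: "a \<noteq> c"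
    and zz: "adj id z" "adj id z'" and ne: "transpose a c \<noteq> z" "transpose a c \<noteq> z'" "z \<noteq> z'"
  shows "\<exists>v. v \<noteq> a \<and> v \<noteq> c \<and> {z, z'} = {transpose a v, transpose c v}"
proof -
  let ?y = "transpose a c"
  obtain p q where p: "p \<noteq> q" "z = transpose p q" using zz(1) by (auto simp: adj_def)
  obtain p' q' where p': "p' \<noteq> q'" "z' = transpose p' q'" using zz(2) by (auto simp: adj_def)
  have in_A: "id \<circ> ?y \<in> {?y, z, z'}" "id \<circ> transpose p q \<in> {?y, z, z'}" using p by auto
  have "?y \<noteq> transpose p q" using ne(1) p by simp
  note tcD = three_common_transposes[OF tc in_A bij_id ac p(1) this]
  have nc: "?y \<circ> z \<noteq> z \<circ> ?y" using tcD(1) p by simp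
  have "adj ?y (?y \<circ> z)" "adj z' (?y \<circ> z)" using tcD(4) p by simp_all
  then have "?y \<circ> z \<in> {id, id \<circ> (?y \<circ> z'), id \<circ> (z' \<circ> ?y)}"
    using common_neighbour_cases[OF bij_id ac p'(1), of "?y \<circ> z"] ne(2) p' by simp
  moreover have "?y \<circ> z \<noteq> id"
  proof
    assume "?y \<circ> z = id"
    then have "?y \<circ> (?y \<circ> z) = ?y" by simp
    then show False using ne(1) by (simp add: o_assoc)
  qed
  moreover have "?y \<circ> z \<noteq> ?y \<circ> z'" using ne(3) by (simp add: comp_left_cancel)
  ultimately have yz: "?y \<circ> z = z' \<circ> ?y" by simp
  have conj: "z' = transpose (?y p) (?y q)"
  proof -
    have "z' = (z' \<circ> ?y) \<circ> ?y" by (simp add: comp_assoc)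
    also have "\<dots> = (?y \<circ> transpose p q) \<circ> ?y" using yz p by simp
    also have "?y \<circ> transpose p q = transpose (?y p) (?y q) \<circ> ?y"
      by (rule conj_transpose) simp
    also have "\<dots> \<circ> ?y = transpose (?y p) (?y q)" by (simp add: comp_assoc)
    finally show ?thesis .
  qed
  have "{p, q} \<inter> {a, c} \<noteq> {}"
    using nc p transpose_commute_disjoint[of a c p q] by blast
  moreover have "{p, q} \<noteq> {a, c}" using ne(1) p by (auto simp: doubleton_eq_iff transpose_commute)
  ultimately obtain e v where ev: "e \<in> {a, c}" "v \<notin> {a, c}" "z = transpose e v" "{p, q} = {e, v}"
  proof -
    assume *: "{p, q} \<inter> {a, c} \<noteq> {}" "{p, q} \<noteq> {a, c}"
      and th: "\<And>e v. e \<in> {a, c} \<Longrightarrow> v \<notin> {a, c} \<Longrightarrow> z = transpose e v \<Longrightarrow> {p, q} = {e, v} \<Longrightarrow> thesis"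
    show thesis
    proof (cases "p \<in> {a, c}")
      case True
      then have "q \<notin> {a, c}" using * p(1) by auto
      then show ?thesis using th[of p q] True p by simp
    next
      case False
      then have "q \<in> {a, c}" using * by auto
      then show ?thesis using th[of q p] False p by (simp add: transpose_commute insert_commute)
    qed
  qed
  have "?y v = v" using ev(2) by simp
  have "z' = transpose (?y e) v"
    using conj ev(4) \<open>?y v = v\<close> by (auto simp: doubleton_eq_iff transpose_commute)
  then have "{z, z'} = {transpose a v, transpose c v}" using ev(1,3) by auto
  then show ?thesis using ev(2) by blast
qed

section \<open>Common neighbours inside a lower interval\<close>

lemma below_descent:
  assumes x: "x \<in> below {l..u} w" and "\<alpha> < \<beta>" "x \<beta> < x \<alpha>"
  shows "x \<circ> transpose \<alpha> \<beta> \<in> below {l..u} w"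
proof -
  let ?y = "x \<circ> transpose \<alpha> \<beta>"
  have xp: "x permutes {l..u}" "rle x w" using x by (auto simp: below_def)
  have "\<alpha> \<in> {l..u}" "\<beta> \<in> {l..u}" using inversion_in_support[OF xp(1) assms(2,3)] by auto
  then have "?y permutes {l..u}" using xp(1) by (intro permutes_comp_transpose)
  moreover have "rle ?y (?y \<circ> transpose \<alpha> \<beta>)" using assms by (intro rle_transpose) auto
  then have "rle ?y x" by (simp add: comp_assoc)
  ultimately show ?thesis using xp(2) rle_trans by (auto simp: below_def)
qed

lemma adj_transpose: "a \<noteq> b \<Longrightarrow> y = x \<circ> transpose a b \<Longrightarrow> adj x y"
  unfolding adj_def by blast

lemma three_commonI:
  assumes "z1 \<in> V" "z2 \<in> V" "z3 \<in> V" "z1 \<noteq> z2" "z1 \<noteq> z3" "z2 \<noteq> z3"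
    "\<And>y. y \<in> A \<Longrightarrow> E y z1 \<and> E y z2 \<and> E y z3"
  shows "three_common V E A"
  unfolding three_common_def using assms by (intro exI[of _ "{z1, z2, z3}"]) auto

lemma transpose_products_ne_id:
  fixes a b c :: nat
  assumes "a \<noteq> b" "b \<noteq> c" "a \<noteq> c"
  shows "transpose a b \<circ> transpose b c \<noteq> id" "transpose b c \<circ> transpose a b \<noteq> id"
proof -
  have "(transpose a b \<circ> transpose b c) c = a" "(transpose b c \<circ> transpose a b) a = c"
    using assms by simp_all
  then show "transpose a b \<circ> transpose b c \<noteq> id" "transpose b c \<circ> transpose a b \<noteq> id"
    using assms(3) by (metis id_apply)+
qed

text \<open>For \<open>s\<close> between \<open>a\<close> and \<open>v\<close>, the transposition of
  \<open>a\<close> and \<open>v\<close> is inverted at \<open>a, s\<close> and at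
  \<open>s, v\<close>. Undoing either inversion yields the two three-cycles, which therefore lie in
  the interval together with \<open>id\<close>.\<close>

lemma three_common_star:
  assumes t': "transpose a v \<in> below {l..u} w" and w: "w permutes {l..u}"
    and s: "(a < s \<and> s < v) \<or> (v < s \<and> s < a)"
  shows "three_common (below {l..u} w) adj {transpose a s, transpose a v}"
proof -
  let ?V = "below {l..u} w" and ?t = "transpose a s" and ?t' = "transpose a v"
  have d: "s \<noteq> a" "a \<noteq> v" "s \<noteq> v" using s by auto
  note cyc = three_cycles[OF d(1,2,3)]
  have 1: "?t' \<circ> ?t \<in> ?V"
    using s
  proof
    assume "a < s \<and> s < v"
    then show ?thesis using below_descent[OF t', of a s] by simp
  next
    assume "v < s \<and> s < a"
    then show ?thesis using below_descent[OF t', of s a] by (simp add: transpose_commute)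
  qed
  have 2: "?t' \<circ> transpose s v \<in> ?V"
    using s
  proof
    assume "a < s \<and> s < v"
    then show ?thesis using below_descent[OF t', of s v] by simp
  next
    assume "v < s \<and> s < a"
    then show ?thesis using below_descent[OF t', of v s] by (simp add: transpose_commute)
  qed
  have e: "?t \<circ> ?t' = ?t' \<circ> transpose s v" "?t' \<circ> ?t = ?t \<circ> transpose s v"
    using cyc(1,3) by (simp_all add: transpose_commute)
  have idV: "id \<in> ?V" using w by (simp add: below_def permutes_id rle_id permutes_bij)
  show ?thesis
  proof (rule three_commonI[OF idV _ 1])
    show "?t \<circ> ?t' \<in> ?V" using 2 e(1) by simp
    show "id \<noteq> ?t \<circ> ?t'" "id \<noteq> ?t' \<circ> ?t" "?t \<circ> ?t' \<noteq> ?t' \<circ> ?t"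
      using transpose_products_ne_id[OF d(1,2,3)] transpose_products_ne[OF d(1,2,3)]
      by (auto simp: transpose_commute)
    fix y assume y: "y \<in> {?t, ?t'}"
    have "adj ?t id" "adj ?t' id" using d by (auto intro: adj_transpose[of a])
    moreover have "adj ?t (?t \<circ> ?t')" "adj ?t' (?t' \<circ> ?t)"
      using d by (auto intro: adj_transpose[of a v] adj_transpose[of a s])
    moreover have "adj ?t (?t' \<circ> ?t)" "adj ?t' (?t \<circ> ?t')"
      by (rule adj_transpose[OF d(3) e(2)], rule adj_transpose[OF d(3) e(1)])
    ultimately show "adj y id \<and> adj y (?t \<circ> ?t') \<and> adj y (?t' \<circ> ?t)" using y by auto
  qed
qed

lemma three_common_subset: "three_common V E A \<Longrightarrow> B \<subseteq> A \<Longrightarrow> three_common V E B"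
  unfolding three_common_def by blast

text \<open>Three edges at \<open>a\<close> always contain two on the same side of \<open>a\<close>, and those have three common neighbours.\<close>
lemma no_triple_fan_id:
  assumes w: "w permutes {l..u}"
  shows "\<not> triple_fan (below {l..u} w) adj id"
proof
  let ?V = "below {l..u} w"
  assume "triple_fan ?V adj id"
  then obtain y f g where y: "adj id y"
    and f: "\<And>i::nat. i < 3 \<Longrightarrow> f i \<in> ?V \<and> g i \<in> ?V \<and> adj id (f i) \<and> adj id (g i) \<and>
        y \<noteq> f i \<and> y \<noteq> g i \<and> f i \<noteq> g i \<and> three_common ?V adj {y, f i, g i}"
    and no: "\<And>i j::nat. i < 3 \<Longrightarrow> j < 3 \<Longrightarrow> i \<noteq> j \<Longrightarrow> \<not> three_common ?V adj {f i, f j} \<and>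
        \<not> three_common ?V adj {g i, g j} \<and> \<not> three_common ?V adj {f i, g j}"
    unfolding triple_fan_def by blast
  obtain a c where ac: "a \<noteq> c" "y = transpose a c" using y by (auto simp: adj_def)
  have "\<exists>v. v \<noteq> a \<and> v \<noteq> c \<and> {f i, g i} = {transpose a v, transpose c v}" if "i < 3" for i
    using triangle_at_id[of ?V a c "f i" "g i"] f[OF that] ac by simp
  then obtain v where v: "\<And>i. i < 3 \<Longrightarrow> v i \<noteq> a \<and> {f i, g i} = {transpose a (v i), transpose c (v i)}"
    by metis
  \<comment> \<open>In each pair one member moves \<open>a\<close>. Whether it is \<open>f i\<close>
    or \<open>g i\<close> may depend on \<open>i\<close>, so all three kinds of negated conditions
    are used.\<close>
  have fg: "transpose a (v i) \<in> {f i, g i}" if "i < 3" for i using v[OF that] by auto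
  have inV: "transpose a (v i) \<in> ?V" if "i < 3" for i using fg[OF that] f[OF that] by auto
  have no': "\<not> three_common ?V adj {transpose a (v i), transpose a (v j)}"
    if ij: "i < 3" "j < 3" "i \<noteq> j" for i j
  proof -
    have "\<not> three_common ?V adj {g i, f j}" using no[of j i] ij by (simp add: insert_commute)
    then show ?thesis using fg[OF ij(1)] fg[OF ij(2)] no[OF ij] by auto
  qed
  have ne: "v i \<noteq> v j" if ij: "i < 3" "j < 3" "i \<noteq> j" for i j
  proof
    assume "v i = v j"
    moreover have "three_common ?V adj {transpose a (v i)}"
      using three_common_subset[of ?V adj "{y, f i, g i}"] f[OF ij(1)] fg[OF ij(1)] by auto
    ultimately show False using no'[OF ij] by simp
  qed
  have side: False if ij: "i < 3" "j < 3" "i \<noteq> j" and s: "a < v i \<longleftrightarrow> a < v j" for i j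
  proof -
    have "v i \<noteq> a" "v j \<noteq> a" "v i \<noteq> v j" using v ij ne by auto
    then consider "(a < v i \<and> v i < v j) \<or> (v j < v i \<and> v i < a)"
      | "(a < v j \<and> v j < v i) \<or> (v i < v j \<and> v j < a)" using s by linarith
    then show False
    proof cases
      case 1
      then show False using three_common_star[OF inV[OF ij(2)] w 1] no'[OF ij] by simp
    next
      case 2
      then show False using three_common_star[OF inV[OF ij(1)] w 2] no'[of j i] ij by simp
    qed
  qed
  show False using side[of 0 1] side[of 0 2] side[of 1 2] by auto
qed



section \<open>Related and unrelated reflections at the top of the interval\<close>

lemma not_rle_if_first_larger:
  assumes "\<And>i. i < p \<Longrightarrow> x i = w i" "w p < x p"
  shows "\<not> rle x w"
proof
  assume "rle x w"
  then have "rk x (Suc p) (x p) \<le> rk w (Suc p) (x p)" by (rule rleD)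
  moreover have "rk x p (x p) = rk w p (x p)" using assms(1) by (intro rk_cong) simp
  ultimately show False using assms(2) by (simp add: rk_Suc)
qed

text \<open>One of the two three-cycles puts the larger value \<open>w s'\<close> at position
  \<open>s\<close> and leaves all earlier positions alone, so the product is not below
  \<open>w\<close>.\<close>

lemma not_three_common_ascent:
  assumes w: "w permutes {l..u}" and s: "s < s'" "s' < v" "w s < w s'"
  shows "\<not> three_common (below {l..u} w) adj {w \<circ> transpose s v, w \<circ> transpose s' v}"
proof
  let ?t = "transpose s v" and ?t' = "transpose s' v"
  assume tc: "three_common (below {l..u} w) adj {w \<circ> ?t, w \<circ> ?t'}"
  have "?t s \<noteq> ?t' s" using s by simp
  then have "?t \<noteq> ?t'" by metis
  then have "w \<circ> (?t' \<circ> ?t) \<in> below {l..u} w"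
    using three_common_transposes(3)[OF tc _ _ permutes_bij[OF w], of s v s' v] s by simp
  then have "rle (w \<circ> (?t' \<circ> ?t)) w" by (simp add: below_def)
  moreover have "\<not> rle (w \<circ> (?t' \<circ> ?t)) w"
    by (rule not_rle_if_first_larger[of s]) (use s in auto)
  ultimately show False by simp
qed

lemma not_three_common_disjoint:
  assumes w: "w permutes {l..u}" and "distinct [a, b, c, d]"
  shows "\<not> three_common (below {l..u} w) adj {w \<circ> transpose a b, w \<circ> transpose c d}"
proof
  let ?t = "transpose a b" and ?t' = "transpose c d"
  assume tc: "three_common (below {l..u} w) adj {w \<circ> ?t, w \<circ> ?t'}"
  have "?t a \<noteq> ?t' a" using assms(2) by auto
  then have "?t \<noteq> ?t'" by metis
  then have "?t \<circ> ?t' \<noteq> ?t' \<circ> ?t"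
    using three_common_transposes(1)[OF tc _ _ permutes_bij[OF w], of a b c d] assms(2) by simp
  then show False using transpose_commute_disjoint[of a b c d] assms(2) by auto
qed

text \<open>From three decreasing entries each three-cycle is reached by two exchanges that both
  undo an inversion, so the products stay in the interval. Inside the symmetric group on three
  points, both three-cycles are adjacent to all three transpositions.\<close>

lemma three_common_descents:
  assumes w: "w \<in> below {l..u} v" and b: "bij w" and abc: "a < b" "b < c" "w c < w b" "w b < w a"
  shows "three_common (below {l..u} v) adj {w \<circ> transpose b c, w \<circ> transpose a b, w \<circ> transpose a c}"
proof -
  have d: "a \<noteq> b" "b \<noteq> c" "a \<noteq> c" using abc by auto
  let ?ab = "transpose a b" and ?bc = "transpose b c" and ?ac = "transpose a c"
  have 1: "w \<circ> ?ab \<circ> ?bc \<in> below {l..u} v"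
    by (intro below_descent w) (use abc in auto)
  have 2: "w \<circ> ?bc \<circ> ?ab \<in> below {l..u} v"
    by (intro below_descent w) (use abc in auto)
  show ?thesis
  proof (rule three_commonI[OF w 1 2])
    show "w \<noteq> w \<circ> ?ab \<circ> ?bc" "w \<noteq> w \<circ> ?bc \<circ> ?ab" "w \<circ> ?ab \<circ> ?bc \<noteq> w \<circ> ?bc \<circ> ?ab"
      using transpose_products_ne_id[OF d] transpose_products_ne[OF d] comp_left_cancel[OF b, of id]
      by (auto simp: comp_assoc comp_left_cancel[OF b])
    fix y assume y: "y \<in> {w \<circ> ?bc, w \<circ> ?ab, w \<circ> ?ac}"
    have *: "adj (w \<circ> t) (w \<circ> z)" if "adj t z" for t z using that by (simp add: adj_comp_left[OF b])
    have "adj ?bc id" "adj ?ab id" "adj ?ac id"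
      using d by (auto intro: adj_transpose[of b c] adj_transpose[of a b] adj_transpose[of a c])
    moreover have "adj ?bc (?ab \<circ> ?bc)" "adj ?ab (?ab \<circ> ?bc)" "adj ?ac (?ab \<circ> ?bc)"
      using adj_transpose[OF d(3) three_cycles(1)[OF d]] adj_transpose[OF d(2) refl]
        adj_transpose[OF d(1) three_cycles(2)[OF d]] by auto
    moreover have "adj ?bc (?bc \<circ> ?ab)" "adj ?ab (?bc \<circ> ?ab)" "adj ?ac (?bc \<circ> ?ab)"
      using adj_transpose[OF d(1) refl] adj_transpose[OF d(3) three_cycles(3)[OF d]]
        adj_transpose[OF d(2) three_cycles(4)[OF d]] by auto
    ultimately show "adj y w \<and> adj y (w \<circ> ?ab \<circ> ?bc) \<and> adj y (w \<circ> ?bc \<circ> ?ab)"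
      using y *[of _ id] * by (auto simp only: comp_assoc comp_id insert_iff empty_iff)
  qed
qed

text \<open>The edge \<open>y\<close> exchanges the letters 2 and 1; \<open>f i\<close> and
  \<open>g i\<close> exchange one of 3, 4, 5 with 2 and with 1. Edges using the same small letter
  are unrelated because 3, 4, 5 increase; edges using different small and different large letters
  are disjoint and commute.\<close>

lemma triple_fan_34521:
  assumes w: "w permutes {l..u}" and "has_34521 w"
  shows "triple_fan (below {l..u} w) adj w"
proof -
  let ?V = "below {l..u} w"
  obtain i1 i2 i3 p q where i: "i1 < i2" "i2 < i3" "i3 < p" "p < q"
      "w q < w p" "w p < w i1" "w i1 < w i2" "w i2 < w i3"
    using assms(2) unfolding has_34521_def by blast
  define s where "s = (\<lambda>i::nat. if i = 0 then i1 else if i = 1 then i2 else i3)"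
  have s: "s i < p \<and> w p < w (s i)" for i using i by (simp add: s_def)
  have ss: "s i < s j \<and> w (s i) < w (s j)" if "i < j" "j < 3" for i j
    using i that by (auto simp: s_def)
  define y where "y = w \<circ> transpose p q"
  define f g where "f = (\<lambda>i. w \<circ> transpose (s i) p)" and "g = (\<lambda>i. w \<circ> transpose (s i) q)"
  have b: "bij w" by (rule permutes_bij[OF w])
  have wV: "w \<in> ?V" using w by (simp add: below_def rle_refl)
  have sym: "\<not> three_common ?V adj {f i, f j} \<and> \<not> three_common ?V adj {g i, g j}" if "i < j" "j < 3" for i j
    unfolding f_def g_def
    using not_three_common_ascent[OF w, of "s i" "s j" p] not_three_common_ascent[OF w, of "s i" "s j" q]
      ss[OF that] s[of j] i by simp
  show ?thesis
    unfolding triple_fan_def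
  proof (intro exI conjI allI impI)
    show "y \<in> ?V" unfolding y_def by (rule below_descent[OF wV i(4,5)])
    show "adj w y" unfolding y_def using i by (intro adj_transpose[of p q]) auto
    fix k :: nat assume k: "k < 3"
    show "f k \<in> ?V" unfolding f_def using s[of k] by (intro below_descent[OF wV]) auto
    show "g k \<in> ?V" unfolding g_def using s[of k] i by (intro below_descent[OF wV]) auto
    show "adj w (f k)" unfolding f_def using s[of k] by (intro adj_transpose[of "s k" p]) auto
    show "adj w (g k)" unfolding g_def using s[of k] i by (intro adj_transpose[of "s k" q]) auto
    have "transpose p q p \<noteq> transpose (s k) p p" "transpose p q q \<noteq> transpose (s k) q q"
      "transpose (s k) p p \<noteq> transpose (s k) q p"
      using s[of k] i by auto
    then have "transpose p q \<noteq> transpose (s k) p" "transpose p q \<noteq> transpose (s k) q"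
      "transpose (s k) p \<noteq> transpose (s k) q" by metis+
    then show "y \<noteq> f k" "y \<noteq> g k" "f k \<noteq> g k"
      unfolding y_def f_def g_def by (simp_all only: comp_left_cancel[OF b] not_False_eq_True)
    show "three_common ?V adj {y, f k, g k}"
      unfolding y_def f_def g_def using s[of k] i by (intro three_common_descents[OF wV b]) auto
    fix j :: nat assume j: "j < 3" "k \<noteq> j"
    consider "k < j" | "j < k" using j by linarith
    then show "\<not> three_common ?V adj {f k, f j}" "\<not> three_common ?V adj {g k, g j}"
      using sym[of k j] sym[of j k] j k by (auto simp: insert_commute)
    have "s k \<noteq> s j" using ss[of k j] ss[of j k] j k by (metis less_irrefl linorder_neqE_nat)
    then show "\<not> three_common ?V adj {f k, g j}"
      unfolding f_def g_def using s[of k] s[of j] i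
      by (intro not_three_common_disjoint[OF w]) auto
  qed
qed

lemma vertex_transitive_no_34521:
  assumes w: "w permutes {l..u}" and vt: "vertex_transitive (below {l..u} w) adj"
  shows "\<not> has_34521 w"
proof
  let ?V = "below {l..u} w"
  assume "has_34521 w"
  then have "triple_fan ?V adj w" by (rule triple_fan_34521[OF w])
  moreover have "w \<in> ?V" using w by (simp add: below_def rle_refl)
  moreover have "id \<in> ?V" using w by (simp add: below_def permutes_id rle_id permutes_bij)
  ultimately have "triple_fan ?V adj id"
    using vt triple_fan_automorphism unfolding vertex_transitive_iff by metis
  then show False using no_triple_fan_id[OF w] by simp
qed

lemma vertex_transitive_imp_avoids:
  assumes w: "w permutes {1..n}" and vt: "vertex_transitive (below {1..n} w) adj"
  shows "avoids w"
proof -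
  have "\<not> has_3412 w \<and> \<not> has_4231 w"
    using inversions_le_reflections[OF w] card_reflections_below_le[OF w vt] by linarith
  moreover have "\<not> has_34521 w" by (rule vertex_transitive_no_34521[OF w vt])
  moreover have "\<not> has_34521 (inv w)"
    by (rule vertex_transitive_no_34521[OF permutes_inv[OF w] vertex_transitive_below_inv[OF w vt]])
  ultimately show ?thesis by (simp add: avoids_def has_inv[OF permutes_bij[OF w]])
qed

section \<open>Translation to the stated notions\<close>

lemma bruhat_interval_eq_below:
  assumes "w permutes {1..n}"
  shows "bruhat_interval n id w = below {1..n} w"
  using assms by (auto simp: bruhat_interval_def bruhat_le_iff below_def permutes_id rle_id permutes_bij)

lemma bruhat_adj_eq_adj:
  assumes x: "x permutes {1..n}" and y: "y permutes {1..n}"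
  shows "bruhat_adj n x y = adj x y"
proof
  show "adj x y" if "bruhat_adj n x y"
    using that unfolding bruhat_adj_def reflection_def adj_def by blast
  assume "adj x y"
  then obtain a b where ab: "a \<noteq> b" "y = x \<circ> transpose a b" by (auto simp: adj_def)
  have "i \<in> {1..n}" if "transpose a b i \<noteq> i" for i
  proof (rule ccontr)
    assume "i \<notin> {1..n}"
    then have "x i = i" "y i = i" using x y by (simp_all add: permutes_not_in)
    then have "x (transpose a b i) = x i" using ab(2) by simp
    then show False using that permutes_inj[OF x] by (simp add: inj_eq)
  qed
  from this[of a] this[of b] have "a \<in> {1..n}" "b \<in> {1..n}" using ab(1) by simp_all
  then show "bruhat_adj n x y" unfolding bruhat_adj_def reflection_def using ab by blast
qed

lemma vertex_transitive_bruhat_iff: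
  assumes w: "w permutes {1..n}"
  shows "vertex_transitive (bruhat_interval n id w) (bruhat_adj n) \<longleftrightarrow>
    vertex_transitive (below {1..n} w) adj"
proof -
  have eq: "bruhat_adj n x y = adj x y" if "x \<in> below {1..n} w" "y \<in> below {1..n} w" for x y
    using that bruhat_adj_eq_adj by (simp add: below_def)
  show ?thesis
    unfolding bruhat_interval_eq_below[OF w]
    by (rule iffI; erule vertex_transitive_iso[OF _ bij_betw_id]) (simp_all add: eq)
qed

text \<open>Occurrences become lists indexed from 0, whereas the definition numbers positions from
  1; for a concrete pattern finitely many comparisons remain.\<close>

lemma contains_patternI:
  fixes f :: "nat list"
  assumes "length f = length p" "sorted_wrt (<) f" "set f \<subseteq> {1..n}"
    and "\<forall>i<length p. \<forall>j<length p. w (f ! i) < w (f ! j) \<longleftrightarrow> p ! i < p ! j"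
  shows "contains_pattern n w p"
  unfolding contains_pattern_def
proof (intro exI[of _ "\<lambda>i. f ! (i - 1)"] conjI ballI)
  show "strict_mono_on {1..length p} (\<lambda>i. f ! (i - 1))"
    using assms(1,2) by (auto simp: strict_mono_on_def sorted_wrt_iff_nth_less)
  show "(\<lambda>i. f ! (i - 1)) ` {1..length p} \<subseteq> {1..n}"
  proof
    fix v assume "v \<in> (\<lambda>i. f ! (i - 1)) ` {1..length p}"
    then obtain i where "v = f ! (i - 1)" "i - 1 < length f" using assms(1) by fastforce
    then show "v \<in> {1..n}" using assms(3) nth_mem by blast
  qed
qed (use assms(4) in auto)

lemma contains_patternD:
  assumes "contains_pattern n w p"
  shows "\<exists>f :: nat \<Rightarrow> nat. (\<forall>i j. i < j \<and> j < length p \<longrightarrow> f i < f j) \<and>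
    (\<forall>i j. i < length p \<and> j < length p \<and> p ! i < p ! j \<longrightarrow> w (f i) < w (f j))"
proof -
  from assms obtain a where a: "strict_mono_on {1..length p} a"
    and v: "\<forall>i\<in>{1..length p}. \<forall>j\<in>{1..length p}. w (a i) < w (a j) \<longleftrightarrow> p ! (i - 1) < p ! (j - 1)"
    unfolding contains_pattern_def by blast
  show ?thesis
  proof (intro exI[of _ "a \<circ> Suc"] conjI allI impI)
    show "(a \<circ> Suc) i < (a \<circ> Suc) j" if "i < j \<and> j < length p" for i j
      using strict_mono_onD[OF a, of "Suc i" "Suc j"] that by simp
    show "w ((a \<circ> Suc) i) < w ((a \<circ> Suc) j)"
      if "i < length p \<and> j < length p \<and> p ! i < p ! j" for i j
      using v[rule_format, of "Suc i" "Suc j"] that by simp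
  qed
qed

lemma contains_3412:
  assumes w: "w permutes {1..n}"
  shows "contains_pattern n w [3, 4, 1, 2] = has_3412 w"
proof
  assume "contains_pattern n w [3, 4, 1, 2]"
  from contains_patternD[OF this] obtain f :: "nat \<Rightarrow> nat"
    where f1: "\<forall>i j. i < j \<and> j < length [3::nat, 4, 1, 2] \<longrightarrow> f i < f j"
      and f2: "\<forall>i j. i < length [3::nat, 4, 1, 2] \<and> j < length [3::nat, 4, 1, 2] \<and> [3::nat, 4, 1, 2] ! i < [3::nat, 4, 1, 2] ! j \<longrightarrow> w (f i) < w (f j)"
    by blast
  show "has_3412 w"
    by (rule has_3412I[of "f 0" "f 1" "f 2" "f 3"]; (rule f1[rule_format] | rule f2[rule_format])) simp_all
next
  assume "has_3412 w"
  then obtain a b c d where *: "a < b" "b < c" "c < d" "w c < w d" "w d < w a" "w a < w b"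
    unfolding has_3412_def by blast
  have "1 \<le> a" "d \<le> n" using inversion_in_support[OF w, of a d] * by linarith+
  then show "contains_pattern n w [3, 4, 1, 2]"
    using * by (intro contains_patternI[of "[a, b, c, d]"]) (auto simp: All_less_Suc)
qed

lemma contains_4231:
  assumes w: "w permutes {1..n}"
  shows "contains_pattern n w [4, 2, 3, 1] = has_4231 w"
proof
  assume "contains_pattern n w [4, 2, 3, 1]"
  from contains_patternD[OF this] obtain f :: "nat \<Rightarrow> nat"
    where f1: "\<forall>i j. i < j \<and> j < length [4::nat, 2, 3, 1] \<longrightarrow> f i < f j"
      and f2: "\<forall>i j. i < length [4::nat, 2, 3, 1] \<and> j < length [4::nat, 2, 3, 1] \<and> [4::nat, 2, 3, 1] ! i < [4::nat, 2, 3, 1] ! j \<longrightarrow> w (f i) < w (f j)"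
    by blast
  show "has_4231 w"
    by (rule has_4231I[of "f 0" "f 1" "f 2" "f 3"]; (rule f1[rule_format] | rule f2[rule_format])) simp_all
next
  assume "has_4231 w"
  then obtain a b c d where *: "a < b" "b < c" "c < d" "w d < w b" "w b < w c" "w c < w a"
    unfolding has_4231_def by blast
  have "1 \<le> a" "d \<le> n" using inversion_in_support[OF w, of a d] * by linarith+
  then show "contains_pattern n w [4, 2, 3, 1]"
    using * by (intro contains_patternI[of "[a, b, c, d]"]) (auto simp: All_less_Suc)
qed

lemma contains_34521:
  assumes w: "w permutes {1..n}"
  shows "contains_pattern n w [3, 4, 5, 2, 1] = has_34521 w"
proof
  assume "contains_pattern n w [3, 4, 5, 2, 1]"
  from contains_patternD[OF this] obtain f :: "nat \<Rightarrow> nat"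
    where f1: "\<forall>i j. i < j \<and> j < length [3::nat, 4, 5, 2, 1] \<longrightarrow> f i < f j"
      and f2: "\<forall>i j. i < length [3::nat, 4, 5, 2, 1] \<and> j < length [3::nat, 4, 5, 2, 1] \<and> [3::nat, 4, 5, 2, 1] ! i < [3::nat, 4, 5, 2, 1] ! j \<longrightarrow> w (f i) < w (f j)"
    by blast
  show "has_34521 w"
    by (rule has_34521I[of "f 0" "f 1" "f 2" "f 3" "f 4"]; (rule f1[rule_format] | rule f2[rule_format])) simp_all
next
  assume "has_34521 w"
  then obtain a b c d e where *: "a < b" "b < c" "c < d" "d < e"
      "w e < w d" "w d < w a" "w a < w b" "w b < w c"
    unfolding has_34521_def by blast
  have "1 \<le> a" "e \<le> n" using inversion_in_support[OF w, of a e] * by linarith+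
  then show "contains_pattern n w [3, 4, 5, 2, 1]"
    using * by (intro contains_patternI[of "[a, b, c, d, e]"]) (auto simp: All_less_Suc)
qed

lemma contains_54123:
  assumes w: "w permutes {1..n}"
  shows "contains_pattern n w [5, 4, 1, 2, 3] = has_54123 w"
proof
  assume "contains_pattern n w [5, 4, 1, 2, 3]"
  from contains_patternD[OF this] obtain f :: "nat \<Rightarrow> nat"
    where f1: "\<forall>i j. i < j \<and> j < length [5::nat, 4, 1, 2, 3] \<longrightarrow> f i < f j"
      and f2: "\<forall>i j. i < length [5::nat, 4, 1, 2, 3] \<and> j < length [5::nat, 4, 1, 2, 3] \<and> [5::nat, 4, 1, 2, 3] ! i < [5::nat, 4, 1, 2, 3] ! j \<longrightarrow> w (f i) < w (f j)"
    by blast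
  show "has_54123 w"
    by (rule has_54123I[of "f 0" "f 1" "f 2" "f 3" "f 4"]; (rule f1[rule_format] | rule f2[rule_format])) simp_all
next
  assume "has_54123 w"
  then obtain a b c d e where *: "a < b" "b < c" "c < d" "d < e"
      "w c < w d" "w d < w e" "w e < w b" "w b < w a"
    unfolding has_54123_def by blast
  have "1 \<le> a" "e \<le> n" using inversion_in_support[OF w, of a e] * by linarith+
  then show "contains_pattern n w [5, 4, 1, 2, 3]"
    using * by (intro contains_patternI[of "[a, b, c, d, e]"]) (auto simp: All_less_Suc)
qed

theorem theorem1p3:
  fixes n :: nat and w :: "nat \<Rightarrow> nat"
  assumes "w \<in> Sym n"
  shows "vertex_transitive (bruhat_interval n id w) (bruhat_adj n) \<longleftrightarrow>
    (avoids_pattern n w [3,4,1,2] \<and> avoids_pattern n w [4,2,3,1] \<and>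
     avoids_pattern n w [3,4,5,2,1] \<and> avoids_pattern n w [5,4,1,2,3])"
proof -
  have w: "w permutes {1..n}" using assms by (simp add: Sym_def)
  have "vertex_transitive (bruhat_interval n id w) (bruhat_adj n) \<longleftrightarrow> avoids w"
    using vertex_transitive_bruhat_iff[OF w] vertex_transitive_imp_avoids[OF w]
      avoids_imp_vertex_transitive[OF w] by blast
  then show ?thesis
    unfolding avoids_def avoids_pattern_def contains_3412[OF w] contains_4231[OF w]
      contains_34521[OF w] contains_54123[OF w] .
qed

end
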